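(* Let $d\ge1$, $\alpha\ge0$, $\lambda>0$ and $\tilde C>0$. Let $\mathbb P$ be the law of a stationary marked simple point process on $\mathbb R^d$ with intensity $\rho\in(0,+\infty)$ such that $$\mathbb P\big(\omega\in\Omega:\ \tau_x\omega\neq\tau_{x'}\omega\ \ \forall x\neq x'\text{ in }\mathbb R^d\big)=1$$ and $\mathbb P^0(E_0\in(-s,s))>0$ for any $s>0$. Set $$\ell(\beta):=(\lambda\tilde C^{\alpha+1}/\rho)^{\frac1{\alpha+1+d}}\beta^{\frac{\alpha+1}{\alpha+1+d}},$$ let $\mathbb P^\beta$ be the law of $\omega_{\ell(\beta),\beta}$ when $\omega$ is sampled by $\mathbb P$, and let $\mathbb E^\beta_0$ be the expectation with respect to the Palm distribution associated to $\mathbb P^\beta$. Assume that there are conjugate exponents $p,q\in(1,+\infty)$ such that $\widehat\omega([0,1]^d)^{q+1}$ has finite expectation with respect to $\mathbb P$ and $$\limsup_{\beta\to+\infty}\mathbb E^\beta_0\big[(\mathrm{diam}\,C[1,1])^{2p}\big]<+\infty$$ or, more generally (instead of the last condition), $$\limsup_{\beta\to+\infty}\beta^{-\frac{\alpha+1}{\alpha+1+d}}\ln\mathbb E^\beta_0\big[(\mathrm{diam}\,C[1,1])^{2p}\big]\le0.$$ Then for any unit vector $v\in\mathbb R^d$ $$\limsup_{\beta\to+\infty}\beta^{-\frac{\alpha+1}{\alpha+1+d}}\ln\big(v\cdot D(\beta)v\big)\le-(\lambda\tilde C^{\alpha+1}/\rho)^{\frac1{\alpha+1+d}}.$$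
   Context: $\Omega$ is the space of sets $\omega=\{(x_i,E_{x_i})\}\subset\mathbb R^d\times\mathbb R$ such that $\widehat\omega:=\{x_i\}$ is locally finite in $\mathbb R^d$ (each $x\in\widehat\omega$ has exactly one mark $E_x$), with $\sigma$-algebra generated by the counts $\omega\mapsto|\omega\cap A|$, $A$ Borel. $\widehat\omega(A)$ is the number of points of $\widehat\omega$ in $A$. $\tau_x\omega:=\{(x_i-x,E_{x_i})\}$. A marked simple point process is a random element of $\Omega$; it is stationary if its law is invariant under all $\tau_x$, $x\in\mathbb R^d$; its intensity is the expectation of $\widehat\omega([0,1]^d)$. Palm distribution of a stationary law $\mathbb P$ with intensity $\rho\in(0,\infty)$: the probability $\mathbb P^0$ on $\Omega_0:=\{\omega:0\in\widehat\omega\}$ with $\mathbb P^0(A)=\frac1\rho\int_\Omega d\mathbb P(\omega)\sum_{x\in\widehat\omega\cap[0,1]^d}\mathbf 1_A(\tau_x\omega)$. (Under the assumptions, $\mathbb P^\beta$ is stationary with finite positive intensity, so its Palm distribution is well defined.) For $\zeta,\beta>0$: $\omega_{\zeta,\beta}:=\{(x/\zeta,\beta E_x/\zeta):x\in\widehat\omega,\ |E_x|\le\zeta/\beta\}$; $\omega_{\ell(\beta),\beta}$ is the case $\zeta=\ell(\beta)$. $\mathcal G[1,1](\omega)$ is the graph with vertex set $\widehat\omega$ and edges $\{x,y\}$, $x\ne y$, with $|x-y|+|E_x|+|E_y|+|E_x-E_y|\le1$. For $\omega\in\Omega_0$, $C[1,1]=C[1,1](\omega)$ is the connected component of $0$ in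 $\mathcal G[1,1](\omega)$. $\mathrm{diam}\,A:=\sup\{|x_i-y_i|:x,y\in A,\ 1\le i\le d\}\in[0,+\infty]$. Convention: $\ln0=-\infty$. $c_{x,y}(\omega,\beta):=\exp\{-|x-y|-\beta(|E_x|+|E_y|+|E_x-E_y|)\}$ for $x\neq y$ in $\widehat\omega$, $c_{x,x}:=0$. $D(\beta)$ (relative to $\mathbb P$) is the unique symmetric nonnegative $d\times d$ matrix such that for all $a\in\mathbb R^d$, $a\cdot D(\beta)a=\inf_{f\in L^\infty(\mathbb P^0)}\frac12\int_{\Omega_0}d\mathbb P^0(\omega)\sum_{x\in\widehat\omega}c_{0,x}(\omega,\beta)(a\cdot x-\nabla_xf(\omega))^2$, $\nabla_xf(\omega):=f(\tau_x\omega)-f(\omega)$. It is well defined since $\int d\mathbb P^0(\omega)\sum_{x\in\widehat\omega}c_{0,x}(\omega,\beta)|x|^2<\infty$, which holds because $\mathbb E[\widehat\omega([0,1]^d)^2]<\infty$ under the assumptions. *)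

theory Defs
  imports "HOL-Probability.Probability"
begin

type_synonym 'n config = "((real ^ 'n) \<times> real) set"

section \<open>Marked configurations\<close>

definition pts :: "('n::finite) config \<Rightarrow> (real ^ 'n) set" where
  "pts \<omega> = fst ` \<omega>"

text \<open>Injectivity of \<^term>\<open>fst\<close> says that each point carries exactly one mark.\<close>

definition Omega :: "('n::finite) config set" where
  "Omega = {\<omega>. inj_on fst \<omega> \<and> (\<forall>K. bounded K \<longrightarrow> finite (pts \<omega> \<inter> K))}"

definition num_pts :: "('n::finite) config \<Rightarrow> ((real ^ 'n) \<times> real) set \<Rightarrow> ennreal" where
  "num_pts \<omega> A = emeasure (count_space UNIV) (\<omega> \<inter> A)"

definition config_space :: "('n::finite) config measure" where
  "config_space = sigma Omega {{\<omega> \<in> Omega. num_pts \<omega> A \<in> B} | A B. A \<in> sets borel \<and> B \<in> sets borel}"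

definition mark :: "('n::finite) config \<Rightarrow> real ^ 'n \<Rightarrow> real" where
  "mark \<omega> x = (THE e. (x, e) \<in> \<omega>)"

definition translate :: "real ^ 'n \<Rightarrow> ('n::finite) config \<Rightarrow> 'n config" where
  "translate x \<omega> = (\<lambda>(y, e). (y - x, e)) ` \<omega>"

definition unit_cube :: "(real ^ 'n::finite) set" where
  "unit_cube = {x. \<forall>i. 0 \<le> x $ i \<and> x $ i \<le> 1}"

section \<open>Stationary laws and Palm distributions\<close>

definition stationary_law :: "('n::finite) config measure \<Rightarrow> bool" where
  "stationary_law P \<longleftrightarrow> prob_space P \<and> sets P = sets config_space \<and>
     (\<forall>x. distr P config_space (translate x) = P)"

definition intensity :: "('n::finite) config measure \<Rightarrow> ennreal" where
  "intensity P = (\<integral>\<^sup>+ \<omega>. of_nat (card (pts \<omega> \<inter> unit_cube)) \<partial>P)"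

definition Omega0 :: "('n::finite) config set" where
  "Omega0 = {\<omega> \<in> Omega. 0 \<in> pts \<omega>}"

definition palm :: "('n::finite) config measure \<Rightarrow> 'n config measure" where
  "palm P = measure_of Omega0 (sets (restrict_space config_space Omega0))
     (\<lambda>A. (\<integral>\<^sup>+ \<omega>. (\<Sum>x \<in> pts \<omega> \<inter> unit_cube. indicator A (translate x \<omega>)) \<partial>P) / intensity P)"

section \<open>Rescaled and thinned configurations\<close>

definition rescale :: "real \<Rightarrow> real \<Rightarrow> ('n::finite) config \<Rightarrow> 'n config" where
  "rescale \<zeta> \<beta> \<omega> = (\<lambda>(x, e). (x /\<^sub>R \<zeta>, \<beta> * e / \<zeta>)) ` {(x, e) \<in> \<omega>. \<bar>e\<bar> \<le> \<zeta> / \<beta>}"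

definition rescaled_law :: "real \<Rightarrow> real \<Rightarrow> ('n::finite) config measure \<Rightarrow> 'n config measure" where
  "rescaled_law \<zeta> \<beta> P = distr P config_space (rescale \<zeta> \<beta>)"

section \<open>The graph and the cluster of the origin\<close>

definition graph_edges :: "('n::finite) config \<Rightarrow> ((real ^ 'n) \<times> (real ^ 'n)) set" where
  "graph_edges \<omega> = {(x, y). x \<in> pts \<omega> \<and> y \<in> pts \<omega> \<and> x \<noteq> y \<and>
     norm (x - y) + \<bar>mark \<omega> x\<bar> + \<bar>mark \<omega> y\<bar> + \<bar>mark \<omega> x - mark \<omega> y\<bar> \<le> 1}"

definition cluster0 :: "('n::finite) config \<Rightarrow> (real ^ 'n) set" where
  "cluster0 \<omega> = {y. (0, y) \<in> (graph_edges \<omega>)\<^sup>*}"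

text \<open>The diameter is taken in the sup-norm and may be infinite, so the library's real-valued,
  Euclidean \<^const>\<open>diameter\<close> does not apply.\<close>

definition sup_diam :: "(real ^ 'n::finite) set \<Rightarrow> ennreal" where
  "sup_diam A = (SUP x\<in>A. SUP y\<in>A. SUP i. ennreal \<bar>x $ i - y $ i\<bar>)"

section \<open>Powers and logarithms of extended nonnegative reals\<close>

text \<open>Only used for exponents \<open>r > 0\<close>.\<close>

definition ennpowr :: "ennreal \<Rightarrow> real \<Rightarrow> ennreal" where
  "ennpowr x r = (if x = \<infinity> then \<infinity> else ennreal (enn2real x powr r))"

definition ennln :: "ennreal \<Rightarrow> ereal" where
  "ennln x = (if x = 0 then -\<infinity> else if x = \<infinity> then \<infinity> else ereal (ln (enn2real x)))"

section \<open>The diffusion matrix\<close>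

definition cond :: "('n::finite) config \<Rightarrow> real \<Rightarrow> real ^ 'n \<Rightarrow> real ^ 'n \<Rightarrow> real" where
  "cond \<omega> \<beta> x y = (if x = y then 0
     else exp (- norm (x - y) - \<beta> * (\<bar>mark \<omega> x\<bar> + \<bar>mark \<omega> y\<bar> + \<bar>mark \<omega> x - mark \<omega> y\<bar>)))"

text \<open>The elements of \<open>L\<^sup>\<infinity>\<close> are represented by measurable, almost everywhere bounded
  functions.\<close>

definition Linfty :: "'a measure \<Rightarrow> ('a \<Rightarrow> real) set" where
  "Linfty M = {f \<in> borel_measurable M. \<exists>C. AE \<omega> in M. \<bar>f \<omega>\<bar> \<le> C}"

definition energy :: "('n::finite) config measure \<Rightarrow> real \<Rightarrow> real ^ 'n \<Rightarrow> ('n config \<Rightarrow> real) \<Rightarrow> ennreal" where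
  "energy P \<beta> a f = (1 / 2) * (\<integral>\<^sup>+ \<omega>. (\<integral>\<^sup>+ x.
     ennreal (cond \<omega> \<beta> 0 x * (a \<bullet> x - (f (translate x \<omega>) - f \<omega>))\<^sup>2) \<partial>count_space (pts \<omega>)) \<partial>palm P)"

definition is_diffusion_matrix :: "('n::finite) config measure \<Rightarrow> real \<Rightarrow> real ^ 'n ^ 'n \<Rightarrow> bool" where
  "is_diffusion_matrix P \<beta> M \<longleftrightarrow> transpose M = M \<and> (\<forall>a. 0 \<le> a \<bullet> (M *v a)) \<and>
     (\<forall>a. ennreal (a \<bullet> (M *v a)) = (INF f \<in> Linfty (palm P). energy P \<beta> a f))"

definition diffusion_matrix :: "('n::finite) config measure \<Rightarrow> real \<Rightarrow> real ^ 'n ^ 'n" where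
  "diffusion_matrix P \<beta> = (THE M. is_diffusion_matrix P \<beta> M)"

section \<open>Well-formedness of the image laws\<close>

lemma config_gen_subset:
  "{{\<omega> \<in> Omega. num_pts \<omega> A \<in> B} | A B. A \<in> sets borel \<and> B \<in> sets borel} \<subseteq> Pow Omega"
  by auto

lemma space_config_space [simp]: "space config_space = Omega"
  unfolding config_space_def by (rule space_measure_of[OF config_gen_subset])

lemma measurable_config_spaceI:
  fixes f :: "'a \<Rightarrow> ('n::finite) config"
  assumes "f \<in> space M \<rightarrow> Omega"
    and "\<And>A. A \<in> sets borel \<Longrightarrow> (\<lambda>x. num_pts (f x) A) \<in> borel_measurable M"
  shows "f \<in> measurable M config_space"
  unfolding config_space_def
proof (rule measurable_measure_of[OF config_gen_subset assms(1)])
  fix S :: "'n config set" assume "S \<in> {{\<omega> \<in> Omega. num_pts \<omega> A \<in> B} | A B. A \<in> sets borel \<and> B \<in> sets (borel :: ennreal measure)}"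
  then obtain A B where S: "S = {\<omega> \<in> Omega. num_pts \<omega> A \<in> B}" "A \<in> sets borel" "B \<in> sets borel"
    by auto
  have "f -` S \<inter> space M = (\<lambda>x. num_pts (f x) A) -` B \<inter> space M"
    using assms(1) S(1) by auto
  then show "f -` S \<inter> space M \<in> sets M"
    using assms(2)[OF S(2)] S(3) by (auto intro: measurable_sets)
qed

lemma measurable_num_pts:
  assumes "A \<in> sets borel"
  shows "(\<lambda>\<omega>. num_pts \<omega> A) \<in> borel_measurable config_space"
proof (rule measurableI)
  fix B :: "ennreal set" assume "B \<in> sets borel"
  then have "{\<omega> \<in> Omega. num_pts \<omega> A \<in> B} \<in> sets config_space"
    unfolding config_space_def using assms by (auto intro!: in_measure_of config_gen_subset)
  moreover have "(\<lambda>\<omega>. num_pts \<omega> A) -` B \<inter> space config_space = {\<omega> \<in> Omega. num_pts \<omega> A \<in> B}"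
    by auto
  ultimately show "(\<lambda>\<omega>. num_pts \<omega> A) -` B \<inter> space config_space \<in> sets config_space"
    by simp
qed simp

lemma num_pts_image:
  assumes "inj g"
  shows "num_pts (g ` S) A = num_pts S (g -` A)"
proof -
  have "g ` S \<inter> A = g ` (S \<inter> g -` A)" by auto
  moreover have "finite (g ` (S \<inter> g -` A)) \<longleftrightarrow> finite (S \<inter> g -` A)"
    by (rule finite_image_iff[OF inj_on_subset[OF assms subset_UNIV]])
  moreover have "card (g ` (S \<inter> g -` A)) = card (S \<inter> g -` A)"
    by (rule card_image[OF inj_on_subset[OF assms subset_UNIV]])
  ultimately show ?thesis
    unfolding num_pts_def by (simp add: emeasure_count_space)
qed

lemma affine_image_Omega:
  fixes \<omega> :: "('n::finite) config"
  assumes "\<omega> \<in> Omega" "S \<subseteq> \<omega>" "c > 0"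
  shows "(\<lambda>(y, e). (c *\<^sub>R y + b, k * e)) ` S \<in> Omega"
proof -
  let ?g = "\<lambda>(y, e). (c *\<^sub>R y + b, k * e)"
  have inj: "inj_on fst \<omega>" and fin: "\<And>K. bounded K \<Longrightarrow> finite (pts \<omega> \<inter> K)"
    using assms(1) by (auto simp: Omega_def)
  have "inj_on fst (?g ` S)"
  proof (rule inj_onI)
    fix u w assume "u \<in> ?g ` S" "w \<in> ?g ` S" and eq: "fst u = fst w"
    then obtain y e y' e' where *: "(y, e) \<in> S" "(y', e') \<in> S" "u = ?g (y, e)" "w = ?g (y', e')"
      by auto
    then have "y = y'" using eq assms(3) by simp
    then have "(y, e) = (y', e')" using inj_onD[OF inj, of "(y, e)" "(y', e')"] * assms(2) by auto
    then show "u = w" using * by simp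
  qed
  moreover have "finite (pts (?g ` S) \<inter> K)" if "bounded K" for K
  proof -
    have "bounded ((\<lambda>z. (1 / c) *\<^sub>R z + (- (1 / c) *\<^sub>R b)) ` K)"
      using bounded_translation[OF bounded_scaling[OF that, of "1 / c"], of "- (1 / c) *\<^sub>R b"]
      by (simp only: image_image add.commute)
    from finite_imageI[OF fin[OF this], of "\<lambda>y. c *\<^sub>R y + b"]
    show ?thesis
    proof (rule rev_finite_subset, safe)
      fix z assume "z \<in> pts (?g ` S)" "z \<in> K"
      then obtain y e where "(y, e) \<in> S" and z: "z = c *\<^sub>R y + b" by (auto simp: pts_def)
      then have "y \<in> pts \<omega>" using assms(2) by (force simp: pts_def)
      moreover have "y = (1 / c) *\<^sub>R z + (- (1 / c) *\<^sub>R b)"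
        using assms(3) z by (simp add: scaleR_right_distrib)
      ultimately show "z \<in> (\<lambda>y. c *\<^sub>R y + b) ` (pts \<omega> \<inter> (\<lambda>z. (1 / c) *\<^sub>R z + (- (1 / c) *\<^sub>R b)) ` K)"
        using z \<open>z \<in> K\<close> by blast
    qed
  qed
  ultimately show ?thesis by (simp add: Omega_def)
qed

lemma measurable_translate:
  fixes x :: "real ^ 'a::finite"
  shows "translate x \<in> measurable config_space config_space"
proof (rule measurable_config_spaceI)
  show "translate x \<in> space config_space \<rightarrow> Omega"
  proof
    fix \<omega> :: "'a config" assume "\<omega> \<in> space config_space"
    then have "(\<lambda>(y, e). (1 *\<^sub>R y + (- x), 1 * e)) ` \<omega> \<in> Omega"
      by (intro affine_image_Omega[of \<omega>]) auto
    then show "translate x \<omega> \<in> Omega" by (simp add: translate_def)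
  qed
  fix A :: "((real ^ 'a) \<times> real) set" assume A: "A \<in> sets borel"
  have inj: "inj (\<lambda>(y, e). (y - x, e) :: (real ^ 'a) \<times> real)" by (auto simp: inj_def)
  have "(\<lambda>(y, e). (y - x, e) :: (real ^ 'a) \<times> real) \<in> borel_measurable borel"
    by (intro borel_measurable_continuous_onI) (auto simp: case_prod_unfold intro!: continuous_intros)
  from measurable_sets[OF this A] have "(\<lambda>(y, e). (y - x, e)) -` A \<in> sets borel"
    by (simp only: space_borel Int_UNIV_right)
  then show "(\<lambda>\<omega>. num_pts (translate x \<omega>) A) \<in> borel_measurable config_space"
    unfolding translate_def num_pts_image[OF inj] by (rule measurable_num_pts)
qed

lemma measurable_rescale:
  assumes "\<zeta> > 0" "\<beta> > 0"
  shows "rescale \<zeta> \<beta> \<in> measurable (config_space :: ('a::finite) config measure) config_space"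
proof (rule measurable_config_spaceI)
  show "rescale \<zeta> \<beta> \<in> space (config_space :: 'a config measure) \<rightarrow> Omega"
  proof
    fix \<omega> :: "'a config" assume "\<omega> \<in> space config_space"
    then have "(\<lambda>(y, e). ((1 / \<zeta>) *\<^sub>R y + 0, (\<beta> / \<zeta>) * e)) ` {(x, e) \<in> \<omega>. \<bar>e\<bar> \<le> \<zeta> / \<beta>} \<in> Omega"
      using assms by (intro affine_image_Omega[of \<omega>]) auto
    then show "rescale \<zeta> \<beta> \<omega> \<in> Omega"
      by (simp add: rescale_def inverse_eq_divide)
  qed
  fix A :: "((real ^ 'a) \<times> real) set" assume A: "A \<in> sets borel"
  let ?g = "\<lambda>(x, e). (x /\<^sub>R \<zeta>, \<beta> * e / \<zeta>) :: (real ^ 'a) \<times> real"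
  let ?T = "{(x :: real ^ 'a, e). \<bar>e\<bar> \<le> \<zeta> / \<beta>}"
  have inj: "inj ?g" using assms by (auto simp: inj_def)
  have "?g \<in> borel_measurable borel"
    using assms by (intro borel_measurable_continuous_onI) (auto simp: case_prod_unfold intro!: continuous_intros)
  from measurable_sets[OF this A] have "?g -` A \<in> sets borel"
    by (simp only: space_borel Int_UNIV_right)
  moreover have "closed ?T"
    unfolding case_prod_unfold by (intro closed_Collect_le continuous_intros)
  ultimately have meas: "?T \<inter> ?g -` A \<in> sets borel" by auto
  have "num_pts (rescale \<zeta> \<beta> \<omega>) A = num_pts \<omega> (?T \<inter> ?g -` A)" for \<omega> :: "'a config"
  proof -
    have "num_pts (rescale \<zeta> \<beta> \<omega>) A = num_pts {(x, e) \<in> \<omega>. \<bar>e\<bar> \<le> \<zeta> / \<beta>} (?g -` A)"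
      unfolding rescale_def by (rule num_pts_image[OF inj])
    also have "\<dots> = num_pts \<omega> (?T \<inter> ?g -` A)"
      unfolding num_pts_def by (rule arg_cong[where f = "emeasure _"]) auto
    finally show ?thesis .
  qed
  then show "(\<lambda>\<omega>. num_pts (rescale \<zeta> \<beta> \<omega>) A) \<in> borel_measurable (config_space :: 'a config measure)"
    using measurable_num_pts[OF meas] by simp
qed

lemma sets_palm:
  fixes P :: "('n::finite) config measure"
  shows "sets (palm P) = sets (restrict_space config_space Omega0)"
proof -
  let ?M = "restrict_space config_space Omega0 :: 'n config measure"
  have "space ?M = Omega0"
    by (auto simp: space_restrict_space Omega0_def)
  then show ?thesis
    unfolding palm_def using sets.sets_measure_of_eq[of ?M] by simp
qed

end

theory Submission
  imports Defs "HOL-Real_Asymp.Real_Asymp"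
begin

text \<open>Write \<open>\<zeta> = \<ell>(\<beta>)\<close>. The variational formula for \<open>v \<cdot> D(\<beta>)v\<close> is tested with a truncation of
  \<open>f(\<omega>) = sup (- v \<cdot> y)\<close>, the supremum being over the cluster of the origin in the graph of all
  pairs with \<open>c\<^sub>x\<^sub>,\<^sub>y \<ge> exp(- \<zeta>)\<close>. Along an edge of this graph, \<open>f(\<tau>\<^sub>x\<omega>) - f(\<omega>) = v \<cdot> x\<close>, so
  these pairs contribute nothing, while every other pair has conductance at most
  \<open>exp(- (1 - \<epsilon>)\<zeta>) exp(- \<epsilon>|x|)\<close>. The energy is therefore at most a constant times \<open>exp(- (1 - \<epsilon>)\<zeta>)\<close>
  times a mean of \<open>\<Sum>\<^sub>x exp(- \<epsilon>|x|)(1 + f(\<omega>)\<^sup>2 + f(\<tau>\<^sub>x\<omega>)\<^sup>2)\<close>. Covering space by unit cubes, Young's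
  inequality and stationarity bound this mean by \<open>E[N\<^sup>q\<^sup>+\<^sup>1]\<close> (\<open>N\<close> the number of points in the unit
  cube) and the \<open>2p\<close>-th moment of \<open>f\<close>, which grows at most like a power of \<open>\<zeta>\<close> times the
  \<open>2p\<close>-th moment of the cluster diameter.\<close>

section \<open>Counting integrals over configurations\<close>

text \<open>The constant in the limit is \<open>ell \<beta> / \<beta> powr \<gamma>\<close> with
  \<open>\<gamma>\<close> the exponent of \<open>ell\<close>, so every factor that is subexponential
  in \<zeta> is free; this licenses the crude cube counts below. The obstacle is that the cluster
  hypothesis is a Palm mean for the thinned and rescaled law, while the energy is a Palm mean for
  the original one. Campbell's formula writes both as means of sums over points in a cube under the
  stationary law, where they can be compared: sites deleted by the thinning contribute nothing,
  because the height at a missing origin is 0. Truncation is forced because clusters may be infinite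
  and test functions must be bounded. The \<open>q + 1\<close> moment arises from two cubes
  \<open>A\<close> and \<open>B\<close>: Young's inequality splits \<open>card B * f\<^sup>2\<close>
  into \<open>card B\<close> to the \<open>q\<close> and \<open>f\<close> to the
  \<open>2 * p\<close>, and the sum over \<open>A\<close> adds one more count. Finally,
  \<open>diffusion_matrix\<close> is a definite description, so the infimum of the energies must
  first be shown to be a quadratic form with a unique symmetric matrix.\<close>

lemma finite_Omega:
  assumes "\<omega> \<in> Omega" "bounded S"
  shows "finite {u \<in> \<omega>. fst u \<in> S}"
proof -
  have "finite (pts \<omega> \<inter> S)" "inj_on fst \<omega>"
    using assms by (auto simp: Omega_def)
  moreover have "fst ` {u \<in> \<omega>. fst u \<in> S} \<subseteq> pts \<omega> \<inter> S"
    by (auto simp: pts_def)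
  moreover have "inj_on fst {u \<in> \<omega>. fst u \<in> S}"
    by (rule inj_on_subset[OF \<open>inj_on fst \<omega>\<close>]) auto
  ultimately show ?thesis
    by (meson finite_imageD finite_subset)
qed

text \<open>A pi-lambda argument over measurable rectangles, for which the count is an indicator
  times a count in a fixed set. The complement step subtracts counts, which must be finite; hence
  everything is first done inside the cylinders \<open>?D m\<close>, which are exhausted at the
  end.\<close>

lemma measurable_emeasure_config:
  fixes g :: "'a \<Rightarrow> ('n::finite) config"
  assumes g: "g \<in> measurable M config_space" and Q: "Q \<in> sets (M \<Otimes>\<^sub>M borel)"
  shows "(\<lambda>z. num_pts (g z) (Pair z -` Q)) \<in> borel_measurable M"
proof -
  let ?D = "\<lambda>m::nat. {u::(real ^ 'n) \<times> real. norm (fst u) \<le> real m}"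
  have D: "?D m \<in> sets borel" for m
    by (intro borel_closed closed_Collect_le continuous_intros)
  have Om: "g z \<in> Omega" if "z \<in> space M" for z
    using measurable_space[OF g that] by simp
  have fin: "finite (g z \<inter> ?D m)" if "z \<in> space M" for z m
    using finite_Omega[OF Om[OF that], of "cball 0 (real m)"] by (simp add: Int_def dist_norm)
  have restr: "(\<lambda>z. num_pts (g z) (?D m \<inter> Pair z -` Q)) \<in> borel_measurable M" for m
    using Int_stable_pair_measure_generator pair_measure_closed
    using Q unfolding sets_pair_measure
  proof (induction rule: sigma_sets_induct_disjoint)
    case (basic X)
    then obtain A B where X: "X = A \<times> B" "A \<in> sets M" "B \<in> sets borel" by auto
    have "(\<lambda>z. num_pts (g z) (?D m \<inter> B)) \<in> borel_measurable M"
      using measurable_compose[OF g measurable_num_pts] D X(3) by blast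
    then have "(\<lambda>z. indicator A z * num_pts (g z) (?D m \<inter> B)) \<in> borel_measurable M"
      using X(2) by measurable
    moreover have "num_pts (g z) (?D m \<inter> Pair z -` X) = indicator A z * num_pts (g z) (?D m \<inter> B)" for z
      using X by (cases "z \<in> A") (auto simp: num_pts_def)
    ultimately show ?case by simp
  next
    case empty
    show ?case by (simp add: num_pts_def)
  next
    case (compl X)
    have "num_pts (g z) (?D m \<inter> Pair z -` (space M \<times> space borel - X))
        = num_pts (g z) (?D m) - num_pts (g z) (?D m \<inter> Pair z -` X)" if "z \<in> space M" for z
    proof -
      have "g z \<inter> (?D m \<inter> Pair z -` (space M \<times> space borel - X))
          = (g z \<inter> ?D m) - (g z \<inter> (?D m \<inter> Pair z -` X))"
        using that by auto
      moreover have "finite (g z \<inter> (?D m \<inter> Pair z -` X))"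
        by (rule finite_subset[OF _ fin[OF that, of m]]) auto
      ultimately show ?thesis
        unfolding num_pts_def by (simp only:) (subst emeasure_Diff; auto)
    qed
    moreover have "(\<lambda>z. num_pts (g z) (?D m) - num_pts (g z) (?D m \<inter> Pair z -` X)) \<in> borel_measurable M"
      using compl measurable_compose[OF g measurable_num_pts[OF D]] by measurable
    ultimately show ?case by (simp cong: measurable_cong)
  next
    case (union X)
    have "num_pts (g z) (?D m \<inter> Pair z -` (\<Union>i. X i)) = (\<Sum>i. num_pts (g z) (?D m \<inter> Pair z -` X i))" for z
    proof -
      have "g z \<inter> (?D m \<inter> Pair z -` (\<Union>i. X i)) = (\<Union>i. g z \<inter> (?D m \<inter> Pair z -` X i))" by auto
      moreover have "disjoint_family (\<lambda>i. g z \<inter> (?D m \<inter> Pair z -` X i))"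
        using union(1) by (auto simp: disjoint_family_on_def)
      ultimately show ?thesis
        unfolding num_pts_def by (simp add: suminf_emeasure)
    qed
    with union show ?case by simp
  qed
  have "num_pts (g z) (Pair z -` Q) = (SUP m. num_pts (g z) (?D m \<inter> Pair z -` Q))" for z
  proof -
    have "g z \<inter> Pair z -` Q = (\<Union>m. g z \<inter> (?D m \<inter> Pair z -` Q))"
      by (auto intro: real_arch_simple)
    moreover have "incseq (\<lambda>m. g z \<inter> (?D m \<inter> Pair z -` Q))"
      by (auto simp: incseq_def intro: order_trans)
    ultimately show ?thesis
      unfolding num_pts_def by (simp add: SUP_emeasure_incseq)
  qed
  with restr show ?thesis by simp
qed

text \<open>The source of measurability for all sums over points: both the configuration and the
  summand may depend on the parameter. For indicators the integral is the count treated above; the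
  rest is monotone approximation.\<close>

lemma measurable_nn_integral_config:
  fixes g :: "'a \<Rightarrow> ('n::finite) config"
  assumes g: "g \<in> measurable M config_space"
    and h: "h \<in> borel_measurable (M \<Otimes>\<^sub>M borel)"
  shows "(\<lambda>z. \<integral>\<^sup>+ u. h (z, u) \<partial>count_space (g z)) \<in> borel_measurable M"
  using h
proof (induction rule: borel_measurable_induct)
  case (cong f h)
  have "(\<integral>\<^sup>+ u. f (z, u) \<partial>count_space (g z)) = (\<integral>\<^sup>+ u. h (z, u) \<partial>count_space (g z))" if "z \<in> space M" for z
    using cong(3) that by (intro nn_integral_cong) (auto simp: space_pair_measure)
  with cong(4) show ?case by (simp cong: measurable_cong)
next
  case (set A)
  have "(\<integral>\<^sup>+ u. indicator A (z, u) \<partial>count_space (g z)) = num_pts (g z) (Pair z -` A)" for z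
  proof -
    have "(\<integral>\<^sup>+ u. indicator A (z, u) \<partial>count_space (g z)) = (\<integral>\<^sup>+ u. indicator (Pair z -` A \<inter> g z) u \<partial>count_space (g z))"
      by (intro nn_integral_cong) (auto simp: indicator_def)
    also have "\<dots> = num_pts (g z) (Pair z -` A)"
      by (subst nn_integral_indicator) (auto simp: num_pts_def emeasure_count_space Int_commute)
    finally show ?thesis .
  qed
  then show ?case using measurable_emeasure_config[OF g set] by simp
next
  case (mult u c)
  then show ?case by (simp add: nn_integral_cmult)
next
  case (add u v)
  then show ?case by (simp add: nn_integral_add)
next
  case (seq U)
  have "(\<integral>\<^sup>+ u. (SUP i. U i) (z, u) \<partial>count_space (g z)) = (SUP i. \<integral>\<^sup>+ u. U i (z, u) \<partial>count_space (g z))" for z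
    using seq(3) by (subst nn_integral_monotone_convergence_SUP[symmetric])
      (auto simp: incseq_def le_fun_def image_image)
  with seq show ?case by simp
qed

lemma nn_integral_count_Omega:
  assumes "\<omega> \<in> Omega" "bounded S"
  shows "(\<integral>\<^sup>+ u. indicator S (fst u) * h u \<partial>count_space \<omega>) = (\<Sum>u\<in>{u\<in>\<omega>. fst u \<in> S}. h u)"
proof -
  have "(\<integral>\<^sup>+ u. indicator S (fst u) * h u \<partial>count_space \<omega>)
      = (\<integral>\<^sup>+ u. h u * indicator {u\<in>\<omega>. fst u \<in> S} u \<partial>count_space \<omega>)"
    by (intro nn_integral_cong) (auto simp: indicator_def)
  also have "\<dots> = (\<integral>\<^sup>+ u. h u \<partial>count_space {u\<in>\<omega>. fst u \<in> S})"
    by (subst nn_integral_restrict_space[symmetric])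
       (auto simp: restrict_count_space intro!: arg_cong2[where f=nn_integral] arg_cong[where f=count_space])
  also have "\<dots> = (\<Sum>u\<in>{u\<in>\<omega>. fst u \<in> S}. h u)"
    by (rule nn_integral_count_space_finite[OF finite_Omega[OF assms]])
  finally show ?thesis .
qed

lemma nn_integral_pts:
  assumes "\<omega> \<in> Omega"
  shows "(\<integral>\<^sup>+ x. h x \<partial>count_space (pts \<omega>)) = (\<integral>\<^sup>+ u. h (fst u) \<partial>count_space \<omega>)"
proof -
  have "bij_betw fst \<omega> (pts \<omega>)"
    using assms by (auto simp: Omega_def pts_def bij_betw_def)
  then show ?thesis by (rule nn_integral_bij_count_space[symmetric])
qed

section \<open>Translations of configurations\<close>

lemma translate_iff: "u \<in> translate x \<omega> \<longleftrightarrow> (fst u + x, snd u) \<in> \<omega>"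
  by (cases u) (force simp: translate_def)

lemma translate_translate: "translate x (translate y \<omega>) = translate (x + y) \<omega>"
  by (auto simp: set_eq_iff translate_iff add.assoc)

lemma translate_0 [simp]: "translate 0 \<omega> = \<omega>"
  by (auto simp: set_eq_iff translate_iff)

lemma pts_translate: "y \<in> pts (translate x \<omega>) \<longleftrightarrow> y + x \<in> pts \<omega>"
  by (force simp: pts_def translate_def image_iff)

lemma translate_Omega: "\<omega> \<in> Omega \<Longrightarrow> translate x \<omega> \<in> Omega"
  using measurable_space[OF measurable_translate, of \<omega> x] by simp

lemma nn_integral_translate:
  "(\<integral>\<^sup>+ u. h u \<partial>count_space (translate x \<omega>)) = (\<integral>\<^sup>+ u. h (fst u - x, snd u) \<partial>count_space \<omega>)"
proof -
  have "bij_betw (\<lambda>u. (fst u - x, snd u)) \<omega> (translate x \<omega>)"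
    by (auto simp: bij_betw_def inj_on_def translate_def case_prod_unfold prod_eq_iff)
  then show ?thesis by (rule nn_integral_bij_count_space[symmetric])
qed

text \<open>Palm calculus shifts a configuration by one of its own points, so measurability must
  hold jointly in shift and configuration. The shift is moved into the counted set, which makes the
  count a parametrised sum over points.\<close>

lemma measurable_translate_joint:
  "(\<lambda>z. translate (fst z) (snd z)) \<in> measurable (borel \<Otimes>\<^sub>M config_space) (config_space :: ('n::finite) config measure)"
proof (rule measurable_config_spaceI)
  let ?M = "(borel :: (real ^ 'n) measure) \<Otimes>\<^sub>M (config_space :: 'n config measure)"
  show "(\<lambda>z. translate (fst z) (snd z)) \<in> space ?M \<rightarrow> (Omega :: 'n config set)"
    by (auto simp: space_pair_measure translate_Omega)
  fix A :: "((real ^ 'n) \<times> real) set" assume A: "A \<in> sets borel"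
  have fs: "fst \<in> borel_measurable (borel :: ((real ^ 'n) \<times> real) measure)"
    "snd \<in> borel_measurable (borel :: ((real ^ 'n) \<times> real) measure)"
    by (auto intro!: borel_measurable_continuous_onI continuous_intros)
  have "(\<lambda>z. (fst (snd z) - fst (fst z), snd (snd z))) \<in> borel_measurable (?M \<Otimes>\<^sub>M (borel :: ((real ^ 'n) \<times> real) measure))"
    by (intro borel_measurable_Pair borel_measurable_diff measurable_compose[OF measurable_snd fs(1)]
        measurable_compose[OF measurable_snd fs(2)] measurable_compose[OF measurable_fst measurable_fst])
  then have "(\<lambda>z. indicator A (fst (snd z) - fst (fst z), snd (snd z)) :: ennreal)
      \<in> borel_measurable (?M \<Otimes>\<^sub>M (borel :: ((real ^ 'n) \<times> real) measure))"
    using A by measurable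
  from measurable_nn_integral_config[OF measurable_snd this]
  have "(\<lambda>z. \<integral>\<^sup>+ u. indicator A (fst u - fst z, snd u) \<partial>count_space (snd z)) \<in> borel_measurable ?M"
    by simp
  moreover have "num_pts \<omega> A = (\<integral>\<^sup>+ u. indicator A u \<partial>count_space \<omega>)" for \<omega> :: "'n config"
  proof -
    have "(\<integral>\<^sup>+ u. indicator A u \<partial>count_space \<omega>) = (\<integral>\<^sup>+ u. indicator (A \<inter> \<omega>) u \<partial>count_space \<omega>)"
      by (intro nn_integral_cong) (auto simp: indicator_def)
    then show ?thesis
      by (subst (asm) nn_integral_indicator) (auto simp: num_pts_def emeasure_count_space Int_commute)
  qed
  ultimately show "(\<lambda>z. num_pts (translate (fst z) (snd z)) A) \<in> borel_measurable ?M"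
    by (simp add: nn_integral_translate)
qed

section \<open>Campbell's formula for the Palm distribution\<close>

lemma unit_cube_eq_cbox: "unit_cube = (cbox 0 (\<chi> i. 1) :: (real ^ 'n::finite) set)"
  by (auto simp: unit_cube_def mem_box_cart)

lemma bounded_unit_cube [simp]: "bounded (unit_cube :: (real ^ 'n::finite) set)"
  by (simp add: unit_cube_eq_cbox)

lemma unit_cube_borel [measurable]: "(unit_cube :: (real ^ 'n::finite) set) \<in> sets borel"
  by (simp add: unit_cube_eq_cbox)

lemma measurable_fst_mark [measurable]: "fst \<in> borel_measurable (borel :: ((real ^ 'n::finite) \<times> real) measure)"
  by (auto intro!: borel_measurable_continuous_onI continuous_intros)

lemma measurable_snd_mark [measurable]: "snd \<in> borel_measurable (borel :: ((real ^ 'n::finite) \<times> real) measure)"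
  by (auto intro!: borel_measurable_continuous_onI continuous_intros)

lemma Omega0_sets [measurable]: "(Omega0 :: ('n::finite) config set) \<in> sets config_space"
proof -
  let ?A = "{0} \<times> UNIV :: ((real ^ 'n) \<times> real) set"
  have "?A \<in> sets borel"
    by (simp add: closed_Times)
  from measurable_num_pts[OF this]
  have "{\<omega> \<in> space config_space. num_pts \<omega> ?A \<noteq> 0} \<in> sets config_space" by measurable
  moreover have "num_pts \<omega> ?A \<noteq> 0 \<longleftrightarrow> 0 \<in> pts \<omega>" for \<omega> :: "'n config"
  proof -
    have "num_pts \<omega> ?A \<noteq> 0 \<longleftrightarrow> \<omega> \<inter> ?A \<noteq> {}"
      by (cases "finite (\<omega> \<inter> ?A)") (auto simp: num_pts_def emeasure_count_space)
    also have "\<dots> \<longleftrightarrow> 0 \<in> pts \<omega>" by (force simp: pts_def)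
    finally show ?thesis .
  qed
  ultimately show ?thesis by (simp add: Omega0_def)
qed

lemma space_palm [simp]: "space (palm P) = Omega0"
  by (metis Int_absorb1 Omega0_sets sets.sets_into_space sets_eq_imp_space_eq sets_palm space_restrict_space2)

lemma sets_palm_iff:
  fixes P :: "('a::finite) config measure"
  shows "A \<in> sets (palm P) \<longleftrightarrow> A \<in> sets config_space \<and> A \<subseteq> Omega0"
  
proof -
  have eq: "Omega0 \<inter> space config_space = (Omega0 :: 'a config set)" by (auto simp: Omega0_def)
  show ?thesis
    using sets_restrict_space_iff[of Omega0 config_space A] Omega0_sets unfolding sets_palm eq by blast
qed

lemma measurable_palmI: "G \<in> measurable config_space N \<Longrightarrow> G \<in> measurable (palm P) N"
  using measurable_restrict_space1 measurable_cong_sets[OF sets_palm refl] by blast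

text \<open>The sum inside \<open>palm\<close>, for an arbitrary region and function. It runs over
  marked points rather than \<open>pts \<omega>\<close>, so that
  \<open>measurable_nn_integral_config\<close> applies directly.\<close>

definition campbell :: "(real ^ 'n) set \<Rightarrow> (('n::finite) config \<Rightarrow> ennreal) \<Rightarrow> 'n config \<Rightarrow> ennreal" where
  "campbell B G \<omega> = (\<integral>\<^sup>+ u. indicator B (fst u) * G (translate (fst u) \<omega>) \<partial>count_space \<omega>)"

lemma measurable_translate_pair:
  assumes "f \<in> measurable M borel" "g \<in> measurable M config_space"
  shows "(\<lambda>z. translate (f z) (g z)) \<in> measurable M config_space"
  using measurable_compose[OF measurable_Pair[OF assms] measurable_translate_joint] by simp

lemma measurable_campbell:
  fixes G :: "('n::finite) config \<Rightarrow> ennreal"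
  assumes [measurable]: "B \<in> sets borel" and G: "G \<in> borel_measurable config_space"
  shows "campbell B G \<in> borel_measurable config_space"
proof -
  have x: "(\<lambda>z. fst (snd z)) \<in> borel_measurable ((config_space :: 'n config measure) \<Otimes>\<^sub>M (borel :: ((real ^ 'n) \<times> real) measure))"
    by (rule measurable_compose[OF measurable_snd measurable_fst_mark])
  have "(\<lambda>z. indicator B (fst (snd z)) * G (translate (fst (snd z)) (fst z)) :: ennreal)
      \<in> borel_measurable ((config_space :: 'n config measure) \<Otimes>\<^sub>M (borel :: ((real ^ 'n) \<times> real) measure))"
    using x by (intro borel_measurable_times_ennreal measurable_compose[OF x borel_measurable_indicator]
        measurable_compose[OF _ G] measurable_translate_pair) auto
  from measurable_nn_integral_config[OF measurable_ident this]
  show ?thesis by (simp add: campbell_def[abs_def])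
qed

lemma campbell_sum:
  assumes "\<omega> \<in> Omega" "bounded B"
  shows "campbell B G \<omega> = (\<Sum>u\<in>{u\<in>\<omega>. fst u \<in> B}. G (translate (fst u) \<omega>))"
  unfolding campbell_def by (rule nn_integral_count_Omega[OF assms])

lemma sum_pts:
  assumes "\<omega> \<in> Omega"
  shows "(\<Sum>x \<in> pts \<omega> \<inter> B. h x) = (\<Sum>u\<in>{u\<in>\<omega>. fst u \<in> B}. h (fst u))"
proof (rule sum.reindex_cong[of fst])
  show "inj_on fst {u \<in> \<omega>. fst u \<in> B}"
    using assms by (auto simp: Omega_def inj_on_def)
qed (auto simp: pts_def)

lemma campbell_palm_sum:
  assumes "\<omega> \<in> Omega"
  shows "(\<Sum>x \<in> pts \<omega> \<inter> unit_cube. G (translate x \<omega>)) = campbell unit_cube G \<omega>"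
  using assms by (simp add: campbell_sum sum_pts)

text \<open>\<open>measure_of\<close> returns the given set function only once that is known to be
  countably additive; additivity comes from exchanging the integrals with the series of
  indicators.\<close>

lemma emeasure_palm:
  fixes P :: "('n::finite) config measure"
  assumes P: "sets P = sets config_space" and A: "A \<in> sets (palm P)"
  shows "emeasure (palm P) A = (\<integral>\<^sup>+ \<omega>. campbell unit_cube (indicator A) \<omega> \<partial>P) / intensity P"
proof -
  have sp: "space P = Omega" using sets_eq_imp_space_eq[OF P] by simp
  let ?\<mu> = "\<lambda>A. (\<integral>\<^sup>+ \<omega>. (\<Sum>x \<in> pts \<omega> \<inter> unit_cube. indicator A (translate x \<omega>)) \<partial>P) / intensity P"
  have eq: "?\<mu> A = (\<integral>\<^sup>+ \<omega>. campbell unit_cube (indicator A) \<omega> \<partial>P) / intensity P" for A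
    by (intro arg_cong2[where f="(/)"] nn_integral_cong refl) (simp add: sp campbell_palm_sum)
  have meas: "campbell unit_cube (indicator B) \<in> borel_measurable P" if "B \<in> sets (palm P)" for B
    using that by (auto simp: measurable_cong_sets[OF P refl] sets_palm_iff
        intro!: measurable_campbell borel_measurable_indicator)
  have "emeasure (palm P) A = ?\<mu> A"
    using palm_def
  proof (rule emeasure_measure_of)
    show "sets (restrict_space config_space (Omega0 :: 'n config set)) \<subseteq> Pow Omega0"
      using sets_palm[of P] sets_palm_iff[of _ P] by auto
    show "A \<in> sets (palm P)" by (rule A)
    show "positive (sets (palm P)) ?\<mu>" by (simp add: positive_def)
    show "countably_additive (sets (palm P)) ?\<mu>"
      unfolding countably_additive_def eq
    proof (intro allI impI)
      fix S :: "nat \<Rightarrow> 'n config set"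
      assume S: "range S \<subseteq> sets (palm P)" "disjoint_family S" "\<Union> (range S) \<in> sets (palm P)"
      have "campbell unit_cube (indicator (\<Union> (range S))) \<omega> = (\<Sum>i. campbell unit_cube (indicator (S i)) \<omega>)" for \<omega>
        unfolding campbell_def
        by (subst nn_integral_suminf[symmetric]) (simp_all add: suminf_indicator[OF S(2)])
      then have "(\<integral>\<^sup>+ \<omega>. campbell unit_cube (indicator (\<Union> (range S))) \<omega> \<partial>P)
         = (\<Sum>i. \<integral>\<^sup>+ \<omega>. campbell unit_cube (indicator (S i)) \<omega> \<partial>P)"
        using S(1) by (simp add: nn_integral_suminf meas subset_eq)
      then show "(\<Sum>i. (\<integral>\<^sup>+ \<omega>. campbell unit_cube (indicator (S i)) \<omega> \<partial>P) / intensity P)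
        = (\<integral>\<^sup>+ \<omega>. campbell unit_cube (indicator (\<Union> (range S))) \<omega> \<partial>P) / intensity P"
        by (simp add: divide_ennreal_def)
    qed
  qed
  with eq show ?thesis by simp
qed

text \<open>Turns Palm means into means under the stationary law, where cubes can be translated
  freely. The extension from events to functions is by monotone approximation.\<close>

lemma nn_integral_palm:
  fixes P :: "('n::finite) config measure"
  assumes P: "sets P = sets config_space" and G: "G \<in> borel_measurable config_space"
  shows "(\<integral>\<^sup>+ \<omega>. G \<omega> \<partial>palm P) = (\<integral>\<^sup>+ \<omega>. campbell unit_cube G \<omega> \<partial>P) / intensity P"
  using G
proof (induction rule: borel_measurable_induct)
  case (cong f g)
  have sp: "space P = Omega" using sets_eq_imp_space_eq[OF P] by simp
  have "campbell unit_cube f \<omega> = campbell unit_cube g \<omega>" if "\<omega> \<in> Omega" for \<omega>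
    unfolding campbell_def using cong(3) translate_Omega[OF that] by (intro nn_integral_cong) auto
  then have "(\<integral>\<^sup>+ \<omega>. campbell unit_cube f \<omega> \<partial>P) = (\<integral>\<^sup>+ \<omega>. campbell unit_cube g \<omega> \<partial>P)"
    by (intro nn_integral_cong) (simp add: sp)
  moreover have "(\<integral>\<^sup>+ \<omega>. f \<omega> \<partial>palm P) = (\<integral>\<^sup>+ \<omega>. g \<omega> \<partial>palm P)"
    using cong(3) by (intro nn_integral_cong) (auto simp: Omega0_def)
  ultimately show ?case using cong(4) by simp
next
  case (set A)
  \<comment> \<open>The Palm measure lives on \<open>Omega0\<close>. Cutting \<open>A\<close> down
    to it is harmless: seen from one of its own points, a configuration has a point at the
    origin.\<close>
  then have A: "A \<inter> Omega0 \<in> sets (palm P)"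
    using Omega0_sets by (auto simp: sets_palm_iff)
  have sp: "space P = Omega" using sets_eq_imp_space_eq[OF P] by simp
  have "(\<integral>\<^sup>+ \<omega>. indicator A \<omega> \<partial>palm P) = (\<integral>\<^sup>+ \<omega>. indicator (A \<inter> Omega0) \<omega> \<partial>palm P)"
    by (intro nn_integral_cong) (auto simp: indicator_def)
  also have "\<dots> = emeasure (palm P) (A \<inter> Omega0)"
    using A by simp
  also have "\<dots> = (\<integral>\<^sup>+ \<omega>. campbell unit_cube (indicator (A \<inter> Omega0)) \<omega> \<partial>P) / intensity P"
    by (rule emeasure_palm[OF P A])
  also have "(\<integral>\<^sup>+ \<omega>. campbell unit_cube (indicator (A \<inter> Omega0)) \<omega> \<partial>P) = (\<integral>\<^sup>+ \<omega>. campbell unit_cube (indicator A) \<omega> \<partial>P)"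
    unfolding campbell_def
  proof (intro nn_integral_cong)
    fix \<omega> and u :: "(real ^ 'n) \<times> real" assume "\<omega> \<in> space P" "u \<in> space (count_space \<omega>)"
    then have "translate (fst u) \<omega> \<in> Omega0"
      by (auto simp: Omega0_def sp translate_Omega pts_translate) (auto simp: pts_def)
    then show "indicator unit_cube (fst u) * indicator (A \<inter> Omega0) (translate (fst u) \<omega>)
        = (indicator unit_cube (fst u) * indicator A (translate (fst u) \<omega>) :: ennreal)"
      by (simp add: indicator_def)
  qed
  finally show ?case .
next
  case (mult u c)
  note [measurable] = measurable_palmI[OF mult(2), of P]
  have [measurable]: "campbell unit_cube u \<in> borel_measurable P"
    using measurable_campbell[OF unit_cube_borel mult(2)] by (simp add: measurable_cong_sets[OF P refl])
  have "campbell unit_cube (\<lambda>x. c * u x) \<omega> = c * campbell unit_cube u \<omega>" for \<omega>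
    unfolding campbell_def by (subst nn_integral_cmult[symmetric]) (auto simp: mult_ac)
  then show ?case
    using mult(4) by (simp add: nn_integral_cmult ennreal_times_divide)
next
  case (add u v)
  have uv: "u \<in> borel_measurable config_space" "v \<in> borel_measurable config_space"
    using add by auto
  note [measurable] = measurable_palmI[OF uv(1), of P] measurable_palmI[OF uv(2), of P]
  have [measurable]: "campbell unit_cube u \<in> borel_measurable P" "campbell unit_cube v \<in> borel_measurable P"
    using measurable_campbell[OF unit_cube_borel] add by (simp_all add: measurable_cong_sets[OF P refl])
  have "campbell unit_cube (\<lambda>x. v x + u x) \<omega> = campbell unit_cube v \<omega> + campbell unit_cube u \<omega>" for \<omega>
    unfolding campbell_def by (subst nn_integral_add[symmetric]) (auto simp: distrib_left)
  then show ?case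
    using add by (simp add: nn_integral_add divide_ennreal_def distrib_right)
next
  case (seq U)
  note [measurable] = measurable_palmI[OF seq(1), where P = P]
  have [measurable]: "campbell unit_cube (U i) \<in> borel_measurable P" for i
    using measurable_campbell[OF unit_cube_borel seq(1)] by (simp add: measurable_cong_sets[OF P refl])
  have inc: "incseq (\<lambda>i. campbell unit_cube (U i))"
    using seq(3) unfolding campbell_def
    by (auto simp: incseq_def le_fun_def intro!: nn_integral_mono mult_left_mono)
  have "campbell unit_cube (SUP i. U i) \<omega> = (SUP i. campbell unit_cube (U i) \<omega>)" for \<omega>
    unfolding campbell_def using seq(3)
    by (subst nn_integral_monotone_convergence_SUP[symmetric])
       (auto simp: incseq_def le_fun_def SUP_mult_left_ennreal image_image intro!: mult_left_mono)
  then have e1: "(\<integral>\<^sup>+ \<omega>. campbell unit_cube (SUP i. U i) \<omega> \<partial>P) = (SUP i. \<integral>\<^sup>+ \<omega>. campbell unit_cube (U i) \<omega> \<partial>P)"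
    using inc by (simp add: nn_integral_monotone_convergence_SUP)
  have e2: "(\<integral>\<^sup>+ \<omega>. (SUP i. U i) \<omega> \<partial>palm P) = (SUP i. \<integral>\<^sup>+ \<omega>. U i \<omega> \<partial>palm P)"
    using seq(3) by (simp add: nn_integral_monotone_convergence_SUP image_image)
  show ?case
    unfolding e1 e2 using seq(5) by (simp add: divide_ennreal_def SUP_mult_right_ennreal)
qed

section \<open>The cluster of the origin\<close>

text \<open>A point with the property exists iff the counting integral of the indicator of the
  property is nonzero.\<close>

lemma pred_bex_config:
  fixes g :: "'a \<Rightarrow> ('n::finite) config"
  assumes g: "g \<in> measurable M config_space"
    and Q: "Measurable.pred (M \<Otimes>\<^sub>M borel) (\<lambda>z. Q (fst z) (snd z))"
  shows "Measurable.pred M (\<lambda>z. \<exists>u\<in>g z. Q z u)"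
proof -
  have "(\<lambda>z. indicator {z \<in> space (M \<Otimes>\<^sub>M borel). Q (fst z) (snd z)} z :: ennreal) \<in> borel_measurable (M \<Otimes>\<^sub>M borel)"
    using Q by measurable
  from measurable_nn_integral_config[OF g this]
  have "Measurable.pred M (\<lambda>z. (\<integral>\<^sup>+ u. indicator {z \<in> space (M \<Otimes>\<^sub>M borel). Q (fst z) (snd z)} (z, u) \<partial>count_space (g z)) \<noteq> (0::ennreal))"
    by measurable
  moreover have "(\<integral>\<^sup>+ u. indicator {z \<in> space (M \<Otimes>\<^sub>M borel). Q (fst z) (snd z)} (z, u) \<partial>count_space (g z)) \<noteq> (0::ennreal)
     \<longleftrightarrow> (\<exists>u\<in>g z. Q z u)" if "z \<in> space M" for z
    using that by (subst nn_integral_0_iff_AE) (auto simp: AE_count_space space_pair_measure indicator_def)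
  ultimately show ?thesis by (simp cong: measurable_cong)
qed

lemma measurable_SUP_config:
  fixes g :: "'a \<Rightarrow> ('n::finite) config" and h :: "'a \<times> _ \<Rightarrow> ennreal"
  assumes g: "g \<in> measurable M config_space" and h: "h \<in> borel_measurable (M \<Otimes>\<^sub>M borel)"
  shows "(\<lambda>z. SUP u\<in>g z. h (z, u)) \<in> borel_measurable M"
proof (rule borel_measurableI_greater)
  fix c
  have "Measurable.pred (M \<Otimes>\<^sub>M borel) (\<lambda>z. c < h (fst z, snd z))"
    using h by simp
  from pred_bex_config[OF g this]
  show "{z \<in> space M. c < (SUP u\<in>g z. h (z, u))} \<in> sets M"
    by (simp add: less_SUP_iff pred_def)
qed

section \<open>Clusters described by finite walks\<close>

definition close :: "(real ^ 'n::finite) \<times> real \<Rightarrow> (real ^ 'n) \<times> real \<Rightarrow> bool" where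
  "close u w \<longleftrightarrow> norm (fst u - fst w) + \<bar>snd u\<bar> + \<bar>snd w\<bar> + \<bar>snd u - snd w\<bar> \<le> 1"

text \<open>Fixing the number of steps gives a recursive description of the cluster, measurable one
  step at a time. A step may stay at the same site, and membership of the end point in \<omega> is
  imposed only where \<open>reach\<close> is used.\<close>

primrec reach :: "nat \<Rightarrow> ('n::finite) config \<Rightarrow> (real ^ 'n) \<times> real \<Rightarrow> bool" where
  "reach 0 \<omega> w \<longleftrightarrow> fst w = 0"
| "reach (Suc n) \<omega> w \<longleftrightarrow> (\<exists>u\<in>\<omega>. reach n \<omega> u \<and> close u w)"

lemma pred_reach:
  "Measurable.pred ((config_space :: ('n::finite) config measure) \<Otimes>\<^sub>M borel) (\<lambda>z. reach n (fst z) (snd z))"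
proof (induction n)
  case 0
  have "(\<lambda>z. fst (snd z)) \<in> borel_measurable ((config_space :: 'n config measure) \<Otimes>\<^sub>M (borel :: ((real ^ 'n) \<times> real) measure))"
    by (rule measurable_compose[OF measurable_snd measurable_fst_mark])
  then show ?case by simp
next
  case (Suc n)
  let ?B = "borel :: ((real ^ 'n) \<times> real) measure"
  let ?M = "((config_space :: 'n config measure) \<Otimes>\<^sub>M ?B)"
  have "(\<lambda>z. (fst (fst z), snd z)) \<in> measurable (?M \<Otimes>\<^sub>M ?B) ?M"
    by measurable
  from measurable_compose[OF this Suc]
  have 1: "Measurable.pred (?M \<Otimes>\<^sub>M ?B) (\<lambda>z. reach n (fst (fst z)) (snd z))" by simp
  have u: "(\<lambda>z. snd z) \<in> measurable (?M \<Otimes>\<^sub>M ?B) ?B" "(\<lambda>z. snd (fst z)) \<in> measurable (?M \<Otimes>\<^sub>M ?B) ?B"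
    by measurable
  note [measurable] = measurable_compose[OF u(1) measurable_fst_mark] measurable_compose[OF u(1) measurable_snd_mark]
    measurable_compose[OF u(2) measurable_fst_mark] measurable_compose[OF u(2) measurable_snd_mark]
  have 2: "Measurable.pred (?M \<Otimes>\<^sub>M ?B) (\<lambda>z. close (snd z) (snd (fst z)))"
    unfolding close_def by measurable
  have "Measurable.pred (?M \<Otimes>\<^sub>M ?B) (\<lambda>z. reach n (fst (fst z)) (snd z) \<and> close (snd z) (snd (fst z)))"
    using 1 2 by measurable
  from pred_bex_config[OF measurable_fst this]
  show ?case by simp
qed

lemma mark_eq:
  assumes "\<omega> \<in> Omega" "u \<in> \<omega>"
  shows "mark \<omega> (fst u) = snd u"
  unfolding mark_def
proof (rule the_equality)
  show "(fst u, snd u) \<in> \<omega>" using assms by simp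
  show "e = snd u" if "(fst u, e) \<in> \<omega>" for e
    using assms that inj_onD[of fst \<omega> "(fst u, e)" u] by (cases u) (auto simp: Omega_def)
qed

lemma cluster0_eq_reach:
  assumes \<omega>: "\<omega> \<in> Omega" "0 \<in> pts \<omega>"
  shows "cluster0 \<omega> = fst ` {w \<in> \<omega>. \<exists>n. reach n \<omega> w}"
proof (intro equalityI subsetI)
  fix y assume "y \<in> cluster0 \<omega>"
  then have "(0, y) \<in> (graph_edges \<omega>)\<^sup>*" by (simp add: cluster0_def)
  then show "y \<in> fst ` {w \<in> \<omega>. \<exists>n. reach n \<omega> w}"
  proof (induction rule: rtrancl_induct)
    case base
    from \<omega>(2) obtain w where "w \<in> \<omega>" "fst w = 0" by (auto simp: pts_def)
    then show ?case by (intro image_eqI[of _ _ w]) (auto intro: exI[of _ 0])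
  next
    case (step y z)
    then obtain u n where u: "u \<in> \<omega>" "fst u = y" "reach n \<omega> u" by auto
    from step(2) obtain w where w: "w \<in> \<omega>" "fst w = z" by (auto simp: graph_edges_def pts_def)
    have "close u w"
      using step(2) u w mark_eq[OF \<omega>(1) u(1)] mark_eq[OF \<omega>(1) w(1)]
      by (auto simp: graph_edges_def close_def)
    with u have "reach (Suc n) \<omega> w" by auto
    with w show ?case by blast
  qed
next
  fix y assume "y \<in> fst ` {w \<in> \<omega>. \<exists>n. reach n \<omega> w}"
  then obtain w n where "w \<in> \<omega>" "reach n \<omega> w" "y = fst w" by auto
  moreover have "reach n \<omega> w \<Longrightarrow> w \<in> \<omega> \<Longrightarrow> fst w \<in> cluster0 \<omega>" for n w
  proof (induction n arbitrary: w)
    case 0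
    then show ?case by (simp add: cluster0_def)
  next
    case (Suc n)
    then obtain u where u: "u \<in> \<omega>" "reach n \<omega> u" "close u w" by auto
    show ?case
    \<comment> \<open>A step that stays put is not an edge of the graph, but it does not leave the
      cluster either.\<close>
    proof (cases "fst u = fst w")
      case True
      with Suc.IH[OF u(2,1)] show ?thesis by simp
    next
      case False
      then have "(fst u, fst w) \<in> graph_edges \<omega>"
        using u Suc.prems(2) mark_eq[OF \<omega>(1) u(1)] mark_eq[OF \<omega>(1) Suc.prems(2)]
        by (auto simp: graph_edges_def close_def pts_def)
      with Suc.IH[OF u(2,1)] show ?thesis
        by (auto simp: cluster0_def intro: rtrancl_into_rtrancl)
    qed
  qed
  ultimately show "y \<in> cluster0 \<omega>" by blast
qed

lemma graph_edges_pts: "(x, y) \<in> graph_edges \<omega> \<Longrightarrow> x \<in> pts \<omega> \<and> y \<in> pts \<omega>"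
  by (simp add: graph_edges_def)

text \<open>The reflexive closure contains 0 even when 0 is not a vertex. The resulting zero height
  is what makes sites removed by the thinning disappear from the moments.\<close>

lemma cluster0_isolated:
  assumes "0 \<notin> pts \<omega>"
  shows "cluster0 \<omega> = {0}"
proof -
  have "y = 0" if "(0, y) \<in> (graph_edges \<omega>)\<^sup>*" for y
    using that assms by (cases rule: converse_rtranclE) (auto dest: graph_edges_pts)
  then show ?thesis by (auto simp: cluster0_def)
qed

text \<open>The test function before rescaling and truncation. Clipping negative values by
  \<open>ennreal\<close> is harmless, since the cluster always contains 0; the value \<infinity>
  covers unbounded clusters.\<close>

definition cluster_height :: "real ^ 'n \<Rightarrow> ('n::finite) config \<Rightarrow> ennreal" where
  "cluster_height a \<omega> = (SUP y\<in>cluster0 \<omega>. ennreal (- (a \<bullet> y)))"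

lemma cluster_height_isolated: "0 \<notin> pts \<omega> \<Longrightarrow> cluster_height a \<omega> = 0"
  by (simp add: cluster_height_def cluster0_isolated)

text \<open>Trades the random index set of the supremum for all points and all walk lengths, the
  form that \<open>measurable_SUP_config\<close> can handle.\<close>

lemma cluster_height_eq_reach:
  assumes \<omega>: "\<omega> \<in> Omega"
  shows "cluster_height a \<omega> = (SUP w\<in>\<omega>. SUP n. of_bool (0 \<in> pts \<omega> \<and> reach n \<omega> w) * ennreal (- (a \<bullet> fst w)))"
proof (cases "0 \<in> pts \<omega>")
  case False
  then show ?thesis
    by (auto simp: cluster_height_isolated intro!: antisym SUP_least)
next
  case True
  show ?thesis
    unfolding cluster_height_def cluster0_eq_reach[OF \<omega> True]
  proof (intro antisym SUP_least)
    fix y assume "y \<in> fst ` {w \<in> \<omega>. \<exists>n. reach n \<omega> w}"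
    then obtain w n where w: "w \<in> \<omega>" "y = fst w" "reach n \<omega> w" by auto
    then show "ennreal (- (a \<bullet> y)) \<le> (SUP w\<in>\<omega>. SUP n. of_bool (0 \<in> pts \<omega> \<and> reach n \<omega> w) * ennreal (- (a \<bullet> fst w)))"
      using True by (intro SUP_upper2[OF w(1)] SUP_upper2[of n]) auto
  next
    fix w n assume "w \<in> \<omega>"
    then show "of_bool (0 \<in> pts \<omega> \<and> reach n \<omega> w) * ennreal (- (a \<bullet> fst w))
        \<le> (SUP y\<in>fst ` {w \<in> \<omega>. \<exists>n. reach n \<omega> w}. ennreal (- (a \<bullet> y)))"
      by (cases "reach n \<omega> w") (auto intro!: SUP_upper2[of "fst w"])
  qed
qed

lemma measurable_cluster_height: "cluster_height a \<in> borel_measurable (config_space :: ('n::finite) config measure)"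
proof -
  let ?B = "borel :: ((real ^ 'n) \<times> real) measure"
  let ?M = "(config_space :: 'n config measure)"
  note [measurable] = pred_reach[where 'n = 'n]
  have [measurable]: "Measurable.pred ?M (\<lambda>\<omega>. 0 \<in> pts \<omega>)"
    using Omega0_sets[where 'n = 'n] unfolding Omega0_def pred_def by simp
  have [measurable]: "(\<lambda>z. fst (snd z)) \<in> borel_measurable (?M \<Otimes>\<^sub>M ?B)"
    by (rule measurable_compose[OF measurable_snd measurable_fst_mark])
  have "(\<lambda>z. SUP n. of_bool (0 \<in> pts (fst z) \<and> reach n (fst z) (snd z)) * ennreal (- (a \<bullet> fst (snd z))))
      \<in> borel_measurable (?M \<Otimes>\<^sub>M ?B)"
    by measurable
  from measurable_SUP_config[OF measurable_ident this]
  have "(\<lambda>\<omega>. SUP w\<in>\<omega>. SUP n. of_bool (0 \<in> pts \<omega> \<and> reach n \<omega> w) * ennreal (- (a \<bullet> fst w))) \<in> borel_measurable ?M"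
    by simp
  then show ?thesis
    by (subst measurable_cong[OF cluster_height_eq_reach]) auto
qed

section \<open>Heights seen from neighbouring sites\<close>

lemma mark_translate: "mark (translate x \<omega>) y = mark \<omega> (y + x)"
  by (simp add: mark_def translate_iff)

lemma graph_edges_translate: "(y, z) \<in> graph_edges (translate x \<omega>) \<longleftrightarrow> (y + x, z + x) \<in> graph_edges \<omega>"
  by (simp add: graph_edges_def mark_translate pts_translate)

lemma cluster0_translate_edge:
  assumes "(0, x) \<in> graph_edges \<omega>" "y \<in> cluster0 (translate x \<omega>)"
  shows "y + x \<in> cluster0 \<omega>"
proof -
  have "(0, y) \<in> (graph_edges (translate x \<omega>))\<^sup>*" using assms by (simp add: cluster0_def)
  then have "(x, y + x) \<in> (graph_edges \<omega>)\<^sup>*"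
    by (induction rule: rtrancl_induct) (auto simp: graph_edges_translate intro: rtrancl_into_rtrancl)
  with assms(1) show ?thesis by (simp add: cluster0_def)
qed

lemma cluster_height_edge_le:
  assumes "(0, x) \<in> graph_edges \<omega>" "cluster_height a \<omega> = ennreal s" "0 \<le> s"
  shows "0 \<le> s + a \<bullet> x" "cluster_height a (translate x \<omega>) \<le> ennreal (s + a \<bullet> x)"
proof -
  have le: "- (a \<bullet> y) \<le> s" if "y \<in> cluster0 \<omega>" for y
  proof -
    have "ennreal (- (a \<bullet> y)) \<le> ennreal s"
      using that assms(2) unfolding cluster_height_def by (metis SUP_upper)
    then show ?thesis using assms(3) by (cases "0 \<le> - (a \<bullet> y)") (simp, linarith)
  qed
  have "x \<in> cluster0 \<omega>" using assms(1) by (auto simp: cluster0_def)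
  from le[OF this] show "0 \<le> s + a \<bullet> x" by simp
  show "cluster_height a (translate x \<omega>) \<le> ennreal (s + a \<bullet> x)"
    unfolding cluster_height_def
  proof (intro SUP_least ennreal_leI)
    fix y assume "y \<in> cluster0 (translate x \<omega>)"
    from le[OF cluster0_translate_edge[OF assms(1) this]]
    show "- (a \<bullet> y) \<le> s + a \<bullet> x" by (simp add: inner_add_right)
  qed
qed

lemma graph_edges_sym: "(x, y) \<in> graph_edges \<omega> \<Longrightarrow> (y, x) \<in> graph_edges \<omega>"
  by (auto simp: graph_edges_def norm_minus_commute abs_minus_commute add_ac)

text \<open>Neighbours lie in one cluster, so moving to \<open>x\<close> only changes the reference
  point. The one-sided bound is used along the edge and, after translating, along the reversed edge;
  finiteness of the height turns the two bounds into an equation.\<close>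

lemma cluster_height_edge:
  assumes e: "(0, x) \<in> graph_edges \<omega>" and s: "cluster_height a \<omega> = ennreal s" "0 \<le> s"
  shows "0 \<le> s + a \<bullet> x" "cluster_height a (translate x \<omega>) = ennreal (s + a \<bullet> x)"
proof -
  note le = cluster_height_edge_le[OF e s]
  obtain s' where s': "cluster_height a (translate x \<omega>) = ennreal s'" "0 \<le> s'"
    using le(2) by (cases "cluster_height a (translate x \<omega>)") (auto simp: top_unique)
  have "(0, - x) \<in> graph_edges (translate x \<omega>)"
    using graph_edges_sym[OF e] by (simp add: graph_edges_translate)
  from cluster_height_edge_le[OF this s']
  have "0 \<le> s' - a \<bullet> x" "ennreal s \<le> ennreal (s' - a \<bullet> x)"
    using s by (simp_all add: translate_translate)
  with le s' show "0 \<le> s + a \<bullet> x" "cluster_height a (translate x \<omega>) = ennreal (s + a \<bullet> x)"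
    by (auto intro!: arg_cong[where f=ennreal] simp: ennreal_le_iff)
qed

text \<open>Cauchy-Schwarz bounds the height by the Euclidean norm, hence by the sum of the absolute
  coordinates. Each of these is at most the sup-norm diameter because 0 is in the cluster.\<close>

lemma cluster_height_le_sup_diam:
  fixes a :: "real ^ 'n::finite"
  assumes "norm a = 1"
  shows "cluster_height a \<omega> \<le> of_nat CARD('n) * sup_diam (cluster0 \<omega>)"
  unfolding cluster_height_def
proof (intro SUP_least)
  fix y assume y: "y \<in> cluster0 \<omega>"
  have 0: "0 \<in> cluster0 \<omega>" by (simp add: cluster0_def)
  have "ennreal (- (a \<bullet> y)) \<le> ennreal (\<Sum>i\<in>UNIV. \<bar>y $ i\<bar>)"
  proof (intro ennreal_leI)
    have "- (a \<bullet> y) \<le> norm a * norm y"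
      using Cauchy_Schwarz_ineq2[of a y] by linarith
    also have "\<dots> \<le> (\<Sum>i\<in>UNIV. \<bar>y $ i\<bar>)"
      using norm_le_l1_cart[of y] assms by simp
    finally show "- (a \<bullet> y) \<le> (\<Sum>i\<in>UNIV. \<bar>y $ i\<bar>)" .
  qed
  also have "\<dots> = (\<Sum>i\<in>UNIV. ennreal \<bar>y $ i - 0 $ i\<bar>)" by simp
  also have "\<dots> \<le> (\<Sum>i\<in>(UNIV::'n set). sup_diam (cluster0 \<omega>))"
    unfolding sup_diam_def
    by (intro sum_mono SUP_upper2[OF y] SUP_upper2[OF 0] SUP_upper) auto
  finally show "ennreal (- (a \<bullet> y)) \<le> of_nat CARD('n) * sup_diam (cluster0 \<omega>)" by simp
qed

section \<open>Thinning and rescaling\<close>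

lemma rescale_iff:
  assumes "\<zeta> > 0" "\<beta> > 0"
  shows "u \<in> rescale \<zeta> \<beta> \<omega> \<longleftrightarrow> (\<zeta> *\<^sub>R fst u, \<zeta> * snd u / \<beta>) \<in> \<omega> \<and> \<bar>snd u\<bar> \<le> 1"
proof
  assume "u \<in> rescale \<zeta> \<beta> \<omega>"
  then show "(\<zeta> *\<^sub>R fst u, \<zeta> * snd u / \<beta>) \<in> \<omega> \<and> \<bar>snd u\<bar> \<le> 1"
    using assms by (auto simp: rescale_def field_simps abs_mult)
next
  assume *: "(\<zeta> *\<^sub>R fst u, \<zeta> * snd u / \<beta>) \<in> \<omega> \<and> \<bar>snd u\<bar> \<le> 1"
  then show "u \<in> rescale \<zeta> \<beta> \<omega>"
    unfolding rescale_def using assms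
    by (intro image_eqI[of _ _ "(\<zeta> *\<^sub>R fst u, \<zeta> * snd u / \<beta>)"]) (auto simp: field_simps abs_mult prod_eq_iff)
qed

lemma rescale_translate:
  assumes "\<zeta> > 0" "\<beta> > 0"
  shows "rescale \<zeta> \<beta> (translate x \<omega>) = translate (x /\<^sub>R \<zeta>) (rescale \<zeta> \<beta> \<omega>)"
  using assms by (auto simp: set_eq_iff rescale_iff translate_iff scaleR_add_right)

text \<open>The last hypothesis says that the conductance of the pair is at least
  \<open>exp (- \<zeta>)\<close>; divided by \<zeta> it is exactly the edge condition of the
  rescaled graph.\<close>

lemma rescale_edge:
  assumes "\<zeta> > 0" "\<beta> > 0" and \<omega>: "\<omega> \<in> Omega" and x: "0 \<in> pts \<omega>" "x \<in> pts \<omega>" "x \<noteq> 0"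
    and le: "norm x + \<beta> * (\<bar>mark \<omega> 0\<bar> + \<bar>mark \<omega> x\<bar> + \<bar>mark \<omega> 0 - mark \<omega> x\<bar>) \<le> \<zeta>"
  shows "(0, x /\<^sub>R \<zeta>) \<in> graph_edges (rescale \<zeta> \<beta> \<omega>)"
proof -
  obtain e0 ex where e: "(0, e0) \<in> \<omega>" "(x, ex) \<in> \<omega>" using x by (auto simp: pts_def)
  have m: "mark \<omega> 0 = e0" "mark \<omega> x = ex"
    using mark_eq[OF \<omega> e(1)] mark_eq[OF \<omega> e(2)] by auto
  have le': "norm x + (\<beta> * \<bar>e0\<bar> + \<beta> * \<bar>ex\<bar> + \<beta> * \<bar>e0 - ex\<bar>) \<le> \<zeta>"
    using le unfolding m by (simp add: distrib_left)
  have nn: "0 \<le> norm x" "0 \<le> \<beta> * \<bar>e0\<bar>" "0 \<le> \<beta> * \<bar>ex\<bar>" "0 \<le> \<beta> * \<bar>e0 - ex\<bar>" using assms(2) by auto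
  have R: "rescale \<zeta> \<beta> \<omega> \<in> Omega"
    using measurable_space[OF measurable_rescale[OF assms(1,2)]] \<omega> by simp
  have in0: "(0, \<beta> * e0 / \<zeta>) \<in> rescale \<zeta> \<beta> \<omega>" and inx: "(x /\<^sub>R \<zeta>, \<beta> * ex / \<zeta>) \<in> rescale \<zeta> \<beta> \<omega>"
  proof -
    \<comment> \<open>All summands are nonnegative, so the bound limits each single mark: both end
      points survive the thinning.\<close>
    have "\<beta> * \<bar>e0\<bar> \<le> \<zeta>" "\<beta> * \<bar>ex\<bar> \<le> \<zeta>" using le' nn by linarith+
    then show "(0, \<beta> * e0 / \<zeta>) \<in> rescale \<zeta> \<beta> \<omega>" "(x /\<^sub>R \<zeta>, \<beta> * ex / \<zeta>) \<in> rescale \<zeta> \<beta> \<omega>"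
      using assms(1,2) e by (simp_all add: rescale_iff abs_mult)
  qed
  have mR: "mark (rescale \<zeta> \<beta> \<omega>) 0 = \<beta> * e0 / \<zeta>" "mark (rescale \<zeta> \<beta> \<omega>) (x /\<^sub>R \<zeta>) = \<beta> * ex / \<zeta>"
    using mark_eq[OF R in0] mark_eq[OF R inx] by auto
  have "norm (x /\<^sub>R \<zeta>) + \<bar>\<beta> * e0 / \<zeta>\<bar> + \<bar>\<beta> * ex / \<zeta>\<bar> + \<bar>\<beta> * e0 / \<zeta> - \<beta> * ex / \<zeta>\<bar>
      = (norm x + (\<beta> * \<bar>e0\<bar> + \<beta> * \<bar>ex\<bar> + \<beta> * \<bar>e0 - ex\<bar>)) / \<zeta>"
  proof -
    have "\<beta> * e0 / \<zeta> - \<beta> * ex / \<zeta> = \<beta> * (e0 - ex) / \<zeta>"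
      by (simp add: right_diff_distrib diff_divide_distrib)
    then show ?thesis
      using assms(1,2) by (simp add: abs_mult add_divide_distrib divide_inverse_commute distrib_left)
  qed
  also have "\<dots> \<le> 1" using le' assms(1) by simp
  finally show ?thesis
    using x(3) assms(1) image_eqI[OF _ in0, of 0 fst] image_eqI[OF _ inx, of "x /\<^sub>R \<zeta>" fst]
    by (simp add: graph_edges_def mR pts_def)
qed

section \<open>Covering by lattice cubes\<close>

lemma ennpowr_top [simp]: "ennpowr \<top> r = \<top>"
  by (simp add: ennpowr_def)

lemma ennpowr_ennreal: "0 \<le> x \<Longrightarrow> ennpowr (ennreal x) r = ennreal (x powr r)"
  by (simp add: ennpowr_def)

lemma ennpowr_0 [simp]: "ennpowr 0 r = 0"
  by (simp add: ennpowr_def)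

lemma measurable_ennpowr [measurable]:
  assumes [measurable]: "f \<in> borel_measurable M"
  shows "(\<lambda>x. ennpowr (f x) r) \<in> borel_measurable M"
  unfolding ennpowr_def by measurable

lemma ennpowr_mono:
  assumes "x \<le> y" "0 \<le> r"
  shows "ennpowr x r \<le> ennpowr y r"
  using assms
  by (cases x; cases y) (auto simp: ennpowr_ennreal ennreal_le_iff top_unique intro!: ennreal_leI powr_mono2)

lemma ennpowr_cmult:
  assumes "c > 0"
  shows "ennpowr (ennreal c * x) r = ennreal (c powr r) * ennpowr x r"
  using assms
  by (cases x) (auto simp: ennpowr_ennreal powr_mult ennreal_mult_top simp flip: ennreal_mult)

text \<open>Young's inequality, with the factors 1/p and 1/q bounded by 1.\<close>

lemma youngs_ennreal:
  fixes f :: ennreal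
  assumes "p > 1" "q > 1" "1 / p + 1 / q = 1"
  shows "of_nat b * f\<^sup>2 \<le> ennreal (real b powr q) + ennpowr f (2 * p)"
proof (cases f)
  case top
  then show ?thesis by simp
next
  case (real t)
  have "real b * t\<^sup>2 \<le> (t\<^sup>2) powr p / p + real b powr q / q"
    using Youngs_inequality[of p q "t\<^sup>2" "real b"] assms by (simp add: mult.commute)
  also have "\<dots> \<le> (t\<^sup>2) powr p + real b powr q"
  proof -
    have "x / r \<le> x" if "1 < r" "0 \<le> x" for x r :: real
      using that mult_left_mono[of 1 r x] by (simp add: divide_le_eq)
    then show ?thesis using assms by (intro add_mono) auto
  qed
  also have "(t\<^sup>2) powr p = t powr (2 * p)"
    using real powr_powr[of t 2 p] by (simp add: powr_numeral)
  finally have "ennreal (real b * t\<^sup>2) \<le> ennreal (real b powr q + t powr (2 * p))"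
    by (intro ennreal_leI) simp
  then show ?thesis
    using real by (simp add: ennpowr_ennreal ennreal_mult ennreal_power ennreal_of_nat_eq_real_of_nat)
qed

text \<open>Replace both numbers by their maximum, whose power is one of the two summands on the
  right.\<close>

lemma nat_mult_powr_le:
  fixes a b :: nat
  assumes "r \<ge> 1"
  shows "real a * real b powr r \<le> real a powr (r + 1) + real b powr (r + 1)"
proof -
  let ?m = "max (real a) (real b)"
  have "real a * real b powr r \<le> ?m * ?m powr r"
    using assms by (intro mult_mono powr_mono2) auto
  also have "\<dots> = ?m powr (r + 1)"
    by (cases "?m = 0") (simp_all add: powr_add)
  also have "\<dots> \<le> real a powr (r + 1) + real b powr (r + 1)"
    by (cases "a \<le> b") simp_all
  finally show ?thesis .
qed

text \<open>A nonzero natural number is at least 1, hence at most its \<open>q\<close>-th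
  power.\<close>

lemma nat_mult_le_powr:
  fixes a b :: nat
  assumes "q \<ge> 1"
  shows "real a * real b \<le> real a powr (q + 1) + real b powr (q + 1)"
proof (cases "b = 0")
  case False
  then have "real b powr 1 \<le> real b powr q"
    using assms by (intro powr_mono) auto
  then have "real a * real b \<le> real a * real b powr q"
    by (intro mult_left_mono) auto
  with nat_mult_powr_le[OF assms, of a b] show ?thesis by linarith
qed simp

text \<open>Here the exponents of the hypotheses originate. Summing over the second index leaves
  \<open>card B * (f u)\<^sup>2\<close>, which Young splits into \<open>card B\<close> to the
  \<open>q\<close> and \<open>f u\<close> to the \<open>2 * p\<close>. Summing the former over
  \<open>A\<close> costs a factor \<open>card A\<close>, whence the power \<open>q + 1\<close>. The
  3 counts the terms of the summand.\<close>

lemma pair_sum_bound: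
  fixes f :: "'a \<Rightarrow> ennreal"
  assumes pq: "p > 1" "q > 1" "1 / p + 1 / q = 1"
    and fin: "finite A" "finite B"
  shows "(\<Sum>u\<in>A. \<Sum>w\<in>B. 1 + (f u)\<^sup>2 + (f w)\<^sup>2)
    \<le> 3 * (ennreal (card A powr (q + 1)) + ennreal (card B powr (q + 1)))
      + (\<Sum>u\<in>A. ennpowr (f u) (2 * p)) + (\<Sum>w\<in>B. ennpowr (f w) (2 * p))"
proof -
  let ?R = "\<lambda>a b. ennreal (real a powr (q + 1)) + ennreal (real b powr (q + 1))"
  have prod: "of_nat a * ennreal (real b powr q) \<le> ?R a b" for a b
    using nat_mult_powr_le[of q a b] pq
    by (simp add: ennreal_of_nat_eq_real_of_nat flip: ennreal_mult ennreal_plus)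
  have sq: "(\<Sum>u\<in>X. of_nat b * (f u)\<^sup>2) \<le> ?R (card X) b + (\<Sum>u\<in>X. ennpowr (f u) (2 * p))" for X b
  proof -
    have "(\<Sum>u\<in>X. of_nat b * (f u)\<^sup>2) \<le> (\<Sum>u\<in>X. ennreal (real b powr q) + ennpowr (f u) (2 * p))"
      by (intro sum_mono youngs_ennreal pq)
    also have "\<dots> = of_nat (card X) * ennreal (real b powr q) + (\<Sum>u\<in>X. ennpowr (f u) (2 * p))"
      by (simp add: sum.distrib)
    finally show ?thesis using prod[of "card X" b] by (meson add_right_mono order_trans)
  qed
  have "(\<Sum>u\<in>A. \<Sum>w\<in>B. 1 + (f u)\<^sup>2 + (f w)\<^sup>2)
      = of_nat (card A) * of_nat (card B) + (\<Sum>u\<in>A. of_nat (card B) * (f u)\<^sup>2) + (\<Sum>w\<in>B. of_nat (card A) * (f w)\<^sup>2)"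
    by (simp only: sum.distrib sum_constant sum_distrib_left mult_1_right)
  also have "\<dots> \<le> ?R (card A) (card B) + (?R (card A) (card B) + (\<Sum>u\<in>A. ennpowr (f u) (2 * p)))
      + (?R (card B) (card A) + (\<Sum>w\<in>B. ennpowr (f w) (2 * p)))"
  proof (intro add_mono sq)
    show "of_nat (card A) * of_nat (card B) \<le> ?R (card A) (card B)"
      using nat_mult_le_powr[of q "card A" "card B"] pq
      by (simp add: ennreal_of_nat_eq_real_of_nat flip: ennreal_mult ennreal_plus)
  qed
  also have "\<dots> = (?R (card A) (card B) + ?R (card A) (card B) + ?R (card A) (card B))
      + (\<Sum>u\<in>A. ennpowr (f u) (2 * p)) + (\<Sum>w\<in>B. ennpowr (f w) (2 * p))"
    by (simp add: add_ac)
  also have "?R (card A) (card B) + ?R (card A) (card B) + ?R (card A) (card B) = 3 * ?R (card A) (card B)"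
    by (simp flip: ennreal_plus ennreal_mult' add: ennreal_numeral[symmetric] del: ennreal_numeral)
  finally show ?thesis .
qed

section \<open>Covering space by unit cubes\<close>

definition lattice_cube :: "('n \<Rightarrow> int) \<Rightarrow> (real ^ 'n::finite) set" where
  "lattice_cube k = (\<lambda>x. x - (\<chi> i. real_of_int (k i))) -` unit_cube"

lemma mem_lattice_cube: "x \<in> lattice_cube k \<longleftrightarrow> (\<forall>i. real_of_int (k i) \<le> x $ i \<and> x $ i \<le> real_of_int (k i) + 1)"
  by (auto simp: lattice_cube_def unit_cube_def algebra_simps)

lemma bounded_lattice_cube [simp]: "bounded (lattice_cube k :: (real ^ 'n::finite) set)"
proof -
  have "lattice_cube k \<subseteq> cbox (\<chi> i. real_of_int (k i)) (\<chi> i. real_of_int (k i) + 1)"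
    by (auto simp: mem_lattice_cube mem_box_cart)
  then show ?thesis using bounded_cbox bounded_subset by blast
qed

text \<open>Rewrites a sum over a distant cube as one over the unit cube of a shifted configuration,
  the form to which stationarity applies.\<close>

lemma campbell_lattice_cube:
  "campbell (lattice_cube k) G \<omega> = campbell unit_cube G (translate (\<chi> i. real_of_int (k i)) \<omega>)"
  unfolding campbell_def
  by (subst nn_integral_translate) (simp add: translate_translate lattice_cube_def indicator_vimage[unfolded comp_def, symmetric] indicator_def)

definition lattice_box :: "nat \<Rightarrow> ('n::finite \<Rightarrow> int) set" where
  "lattice_box n = {k. \<forall>i. - int n \<le> k i \<and> k i \<le> int n}"

lemma lattice_box_PiE: "lattice_box n = (UNIV :: ('n::finite) set) \<rightarrow>\<^sub>E {- int n..int n}" for n :: nat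
  by (auto simp: lattice_box_def PiE_def Pi_def)

lemma finite_lattice_box [simp]: "finite (lattice_box n)"
  by (simp add: lattice_box_PiE finite_PiE)

lemma card_lattice_box: "card (lattice_box n :: ('n::finite \<Rightarrow> int) set) = (2 * n + 1) ^ CARD('n)"
proof -
  have "card {- int n..int n} = 2 * n + 1" by (simp add: nat_eq_iff)
  then show ?thesis unfolding lattice_box_PiE by (subst card_funcsetE) simp_all
qed

lemma lattice_box_cover:
  assumes "\<And>i. \<bar>y $ i\<bar> \<le> real n"
  shows "\<exists>k\<in>lattice_box n. y \<in> lattice_cube k"
proof (intro bexI[of _ "\<lambda>i. \<lfloor>y $ i\<rfloor>"])
  have "- int n \<le> \<lfloor>y $ i\<rfloor> \<and> \<lfloor>y $ i\<rfloor> \<le> int n" for i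
  proof -
    have "- real n \<le> y $ i" "y $ i \<le> real n" using assms[of i] by linarith+
    then show ?thesis by linarith
  qed
  then show "(\<lambda>i. \<lfloor>y $ i\<rfloor>) \<in> lattice_box n"
    by (auto simp: lattice_box_def)
  show "y \<in> lattice_cube (\<lambda>i. \<lfloor>y $ i\<rfloor>)"
    by (auto simp: mem_lattice_cube)
qed

text \<open>The polynomial factor absorbs the square of the linear part of the gradient; \<epsilon>
  is the share of the exponential decay kept for summing over space.\<close>

definition decay :: "real \<Rightarrow> real ^ 'n::finite \<Rightarrow> real" where
  "decay \<epsilon> x = (1 + (norm x)\<^sup>2) * exp (- \<epsilon> * norm x)"

text \<open>An upper bound for \<open>decay\<close> at distances between \<open>n - 2\<close> and
  \<open>n - 1\<close>, those assigned to the box of radius \<open>n\<close> in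
  \<open>decay_le_layers\<close>.\<close>

definition decay_weight :: "real \<Rightarrow> nat \<Rightarrow> real" where
  "decay_weight \<epsilon> n = (1 + (real n)\<^sup>2) * exp (\<epsilon> * (2 - real n))"

lemma decay_pos: "decay \<epsilon> x > 0"
  by (simp add: decay_def add_pos_nonneg)

lemma measurable_decay: "decay \<epsilon> \<in> borel_measurable borel"
  unfolding decay_def[abs_def] by measurable

lemma power_le_fact_exp:
  fixes x :: real
  assumes "0 \<le> x"
  shows "x ^ n \<le> fact n * exp x"
proof -
  have "inverse (fact n) * x ^ n = (\<Sum>k\<in>{n}. inverse (fact k) * x ^ k)" by simp
  also have "\<dots> \<le> (\<Sum>k. inverse (fact k) * x ^ k)"
    using assms by (intro sum_le_suminf summable_exp) auto
  also have "\<dots> = exp x" by (simp add: exp_def scaleR_conv_of_real)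
  finally show ?thesis by (simp add: field_simps)
qed

lemma summable_decay_weight:
  assumes "\<epsilon> > 0"
  shows "summable (\<lambda>n. decay_weight \<epsilon> n * (2 * real n + 1) ^ d)"
proof -
  \<comment> \<open>With this \<delta> the polynomial in \<open>2 * n + 1\<close> is paid for by
    half of the decay rate, and a geometric series of ratio \<open>exp (- (\<epsilon> / 2))\<close>
    remains.\<close>
  define \<delta> where "\<delta> = \<epsilon> / 4"
  have \<delta>: "\<delta> > 0" using assms by (simp add: \<delta>_def)
  let ?C = "fact (d + 2) / \<delta> ^ (d + 2) * exp (\<delta> + 2 * \<epsilon>)"
  show ?thesis
  proof (rule summable_comparison_test')
    show "summable (\<lambda>n. ?C * exp (- (\<epsilon> / 2)) ^ n)"
      using assms by (intro summable_mult summable_geometric) simp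
    fix n :: nat
    have "(1 + (real n)\<^sup>2) * (2 * real n + 1) ^ d \<le> (2 * real n + 1)\<^sup>2 * (2 * real n + 1) ^ d"
      by (intro mult_right_mono) (auto simp: power2_eq_square algebra_simps)
    also have "\<dots> = (\<delta> * (2 * real n + 1)) ^ (d + 2) / \<delta> ^ (d + 2)"
      using \<delta> by (simp add: power_mult_distrib power_add power2_eq_square)
    also have "\<dots> \<le> fact (d + 2) * exp (\<delta> * (2 * real n + 1)) / \<delta> ^ (d + 2)"
      using \<delta> by (intro divide_right_mono power_le_fact_exp) auto
    finally have "(1 + (real n)\<^sup>2) * (2 * real n + 1) ^ d * exp (\<epsilon> * (2 - real n))
        \<le> fact (d + 2) * exp (\<delta> * (2 * real n + 1)) / \<delta> ^ (d + 2) * exp (\<epsilon> * (2 - real n))"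
      by (intro mult_right_mono) auto
    also have "\<dots> = fact (d + 2) / \<delta> ^ (d + 2) * exp (\<delta> * (2 * real n + 1) + \<epsilon> * (2 - real n))"
      by (simp add: exp_add)
    also have "\<delta> * (2 * real n + 1) + \<epsilon> * (2 - real n) = (\<delta> + 2 * \<epsilon>) + real n * (- (\<epsilon> / 2))"
      by (simp add: \<delta>_def field_simps)
    also have "exp \<dots> = exp (\<delta> + 2 * \<epsilon>) * exp (- (\<epsilon> / 2)) ^ n"
      unfolding exp_add exp_of_nat_mult by simp
    finally show "norm (decay_weight \<epsilon> n * (2 * real n + 1) ^ d) \<le> ?C * exp (- (\<epsilon> / 2)) ^ n"
      by (simp add: decay_weight_def mult_ac)
  qed
qed

text \<open>For each pair a single cube in a single layer already dominates. Layers and closed cubes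
  overlap, which is harmless in an upper bound.\<close>

lemma decay_le_layers:
  fixes x y :: "real ^ 'n::finite"
  assumes \<epsilon>: "\<epsilon> > 0" and x: "x \<in> unit_cube"
  shows "ennreal (decay \<epsilon> (y - x)) \<le> (\<Sum>n. ennreal (decay_weight \<epsilon> n) * (\<Sum>k\<in>lattice_box n. indicator (lattice_cube k) y))"
proof -
  \<comment> \<open>Since \<open>x\<close> may be anywhere in the unit cube, a coordinate of
    \<open>y\<close> can exceed the distance by 1; the added 1 accounts for this.\<close>
  define n where "n = nat \<lceil>norm (y - x)\<rceil> + 1"
  have n: "norm (y - x) + 1 \<le> real n" "real n \<le> norm (y - x) + 2"
    using norm_ge_zero[of "y - x"] unfolding n_def by linarith+
  have "\<bar>y $ i\<bar> \<le> real n" for i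
  proof -
    have "\<bar>y $ i - x $ i\<bar> \<le> norm (y - x)"
      using component_le_norm_cart[of "y - x" i] by simp
    moreover have "0 \<le> x $ i" "x $ i \<le> 1" using x by (auto simp: unit_cube_def)
    ultimately show ?thesis using n by linarith
  qed
  from lattice_box_cover[OF this] obtain k where k: "k \<in> lattice_box n" "y \<in> lattice_cube k" by blast
  have "(norm (y - x))\<^sup>2 \<le> (real n)\<^sup>2"
    using n norm_ge_zero[of "y - x"] by (intro power_mono) auto
  moreover have "- \<epsilon> * norm (y - x) \<le> \<epsilon> * (2 - real n)"
  proof -
    have "\<epsilon> * (real n - 2) \<le> \<epsilon> * norm (y - x)" using n \<epsilon> by (intro mult_left_mono) auto
    then show ?thesis by (simp add: algebra_simps)
  qed
  ultimately have "decay \<epsilon> (y - x) \<le> decay_weight \<epsilon> n"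
    unfolding decay_def decay_weight_def by (intro mult_mono) auto
  then have "ennreal (decay \<epsilon> (y - x)) \<le> ennreal (decay_weight \<epsilon> n) * indicator (lattice_cube k) y"
    using k by (simp add: ennreal_leI)
  also have "\<dots> \<le> ennreal (decay_weight \<epsilon> n) * (\<Sum>k\<in>lattice_box n. indicator (lattice_cube k) y)"
    using k(1) by (intro mult_left_mono member_le_sum) auto
  also have "\<dots> = (\<Sum>n\<in>{n}. ennreal (decay_weight \<epsilon> n) * (\<Sum>k\<in>lattice_box n. indicator (lattice_cube k) y))"
    by simp
  also have "\<dots> \<le> (\<Sum>n. ennreal (decay_weight \<epsilon> n) * (\<Sum>k\<in>lattice_box n. indicator (lattice_cube k) y))"
    by (intro sum_le_suminf) auto
  finally show ?thesis .
qed

section \<open>Stationarity and point counts\<close>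

lemma stationary_nn_integral:
  assumes "stationary_law P" "G \<in> borel_measurable config_space"
  shows "(\<integral>\<^sup>+ \<omega>. G (translate x \<omega>) \<partial>P) = (\<integral>\<^sup>+ \<omega>. G \<omega> \<partial>P)"
proof -
  have "translate x \<in> measurable P config_space"
    using assms(1) measurable_translate by (simp add: stationary_law_def cong: measurable_cong_sets)
  then have "(\<integral>\<^sup>+ \<omega>. G \<omega> \<partial>distr P config_space (translate x)) = (\<integral>\<^sup>+ \<omega>. G (translate x \<omega>) \<partial>P)"
    using assms(2) by (simp add: nn_integral_distr)
  then show ?thesis using assms(1) by (simp add: stationary_law_def)
qed

lemma campbell_1:
  assumes "\<omega> \<in> Omega" "bounded B"
  shows "campbell B (\<lambda>_. 1) \<omega> = of_nat (card {u\<in>\<omega>. fst u \<in> B})"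
  using assms by (simp add: campbell_sum)

lemma card_pts:
  assumes "\<omega> \<in> Omega"
  shows "card (pts \<omega> \<inter> B) = card {u\<in>\<omega>. fst u \<in> B}"
  using sum_pts[OF assms, of "\<lambda>_. 1::nat" B] by simp

lemma intensity_campbell:
  assumes "sets P = sets config_space"
  shows "intensity P = (\<integral>\<^sup>+ \<omega>. campbell unit_cube (\<lambda>_. 1) \<omega> \<partial>P)"
  unfolding intensity_def using sets_eq_imp_space_eq[OF assms]
  by (intro nn_integral_cong) (simp add: campbell_1 card_pts)

section \<open>Moment bounds\<close>

definition count_moment :: "('n::finite) config measure \<Rightarrow> real \<Rightarrow> ennreal" where
  "count_moment P r = (\<integral>\<^sup>+ \<omega>. ennpowr (campbell unit_cube (\<lambda>_. 1) \<omega>) r \<partial>P)"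

definition campbell_moment :: "('n::finite) config measure \<Rightarrow> ('n config \<Rightarrow> ennreal) \<Rightarrow> real \<Rightarrow> ennreal" where
  "campbell_moment P f r = (\<integral>\<^sup>+ \<omega>. campbell unit_cube (\<lambda>\<omega>. ennpowr (f \<omega>) r) \<omega> \<partial>P)"

text \<open>The pair inequality for the points of two cubes. The terms of the distant cube are
  expressed through a translated configuration, so that under a stationary law they have the same
  mean as those of the unit cube.\<close>

lemma cube_pair_bound:
  fixes f :: "('n::finite) config \<Rightarrow> ennreal"
  assumes pq: "p > 1" "q > 1" "1 / p + 1 / q = 1" and \<omega>: "\<omega> \<in> Omega"
  defines "N \<equiv> \<lambda>\<omega>. ennpowr (campbell unit_cube (\<lambda>_. 1) \<omega>) (q + 1)"
    and "U \<equiv> campbell unit_cube (\<lambda>\<omega>. ennpowr (f \<omega>) (2 * p))"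
  shows "(\<integral>\<^sup>+ u. indicator unit_cube (fst u) * (\<integral>\<^sup>+ w. indicator (lattice_cube k) (fst w) *
      (1 + (f (translate (fst u) \<omega>))\<^sup>2 + (f (translate (fst w) \<omega>))\<^sup>2) \<partial>count_space \<omega>) \<partial>count_space \<omega>)
    \<le> 3 * (N \<omega> + N (translate (\<chi> i. real_of_int (k i)) \<omega>)) + U \<omega> + U (translate (\<chi> i. real_of_int (k i)) \<omega>)"
proof -
  let ?A = "{u\<in>\<omega>. fst u \<in> unit_cube}" and ?B = "{u\<in>\<omega>. fst u \<in> lattice_cube k}"
  let ?T = "\<lambda>u. f (translate (fst u) \<omega>)"
  have fin: "finite ?A" "finite ?B" by (auto intro!: finite_Omega[OF \<omega>])
  have N: "N \<omega> = ennreal (card ?A powr (q + 1))"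
    "N (translate (\<chi> i. real_of_int (k i)) \<omega>) = ennreal (card ?B powr (q + 1))"
    by (simp_all add: N_def campbell_1[OF \<omega>] ennreal_of_nat_eq_real_of_nat ennpowr_ennreal flip: campbell_lattice_cube)
  have U: "U \<omega> = (\<Sum>u\<in>?A. ennpowr (?T u) (2 * p))"
    "U (translate (\<chi> i. real_of_int (k i)) \<omega>) = (\<Sum>u\<in>?B. ennpowr (?T u) (2 * p))"
    by (simp_all add: U_def campbell_sum[OF \<omega>] flip: campbell_lattice_cube)
  show ?thesis
    unfolding N U nn_integral_count_Omega[OF \<omega> bounded_unit_cube] nn_integral_count_Omega[OF \<omega> bounded_lattice_cube]
    by (rule pair_sum_bound[OF pq fin])
qed

lemma measurable_sum_translate:
  fixes f :: "('n::finite) config \<Rightarrow> ennreal"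
  assumes f: "f \<in> borel_measurable config_space" and h: "h \<in> borel_measurable borel"
  shows "(\<lambda>\<omega>. \<integral>\<^sup>+ u. h (fst u) * (1 + (f \<omega>)\<^sup>2 + (f (translate (fst u) \<omega>))\<^sup>2) \<partial>count_space \<omega>)
    \<in> borel_measurable config_space"
proof -
  let ?M = "(config_space :: 'n config measure) \<Otimes>\<^sub>M (borel :: ((real ^ 'n) \<times> real) measure)"
  have x: "(\<lambda>z. fst (snd z)) \<in> borel_measurable ?M"
    by (rule measurable_compose[OF measurable_snd measurable_fst_mark])
  note [measurable] = measurable_compose[OF x h] measurable_compose[OF measurable_fst f]
    measurable_compose[OF measurable_translate_pair[OF x measurable_fst] f]
  have "(\<lambda>z. h (fst (snd z)) * (1 + (f (fst z))\<^sup>2 + (f (translate (fst (snd z)) (fst z)))\<^sup>2)) \<in> borel_measurable ?M"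
    by measurable
  from measurable_nn_integral_config[OF measurable_ident this] show ?thesis by simp
qed

text \<open>By Campbell's formula the left side is a mean of a sum over pairs of points, the first
  in the unit cube. Whichever lattice cube contains the second point, the bound has the same mean,
  so the constant is the series of weights times the numbers of cubes in the boxes.\<close>

lemma palm_decay_bound:
  fixes P :: "('n::finite) config measure" and f :: "'n config \<Rightarrow> ennreal"
  assumes st: "stationary_law P" and f: "f \<in> borel_measurable config_space" and \<epsilon>: "\<epsilon> > 0"
    and pq: "p > 1" "q > 1" "1 / p + 1 / q = 1"
  shows "(\<integral>\<^sup>+ \<omega>. (\<integral>\<^sup>+ x. ennreal (decay \<epsilon> x) * (1 + (f \<omega>)\<^sup>2 + (f (translate x \<omega>))\<^sup>2) \<partial>count_space (pts \<omega>)) \<partial>palm P)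
    \<le> ennreal (\<Sum>n. decay_weight \<epsilon> n * (2 * real n + 1) ^ CARD('n))
        * (6 * count_moment P (q + 1) + 2 * campbell_moment P f (2 * p)) / intensity P"
proof -
  have sets: "sets P = sets config_space" using st by (simp add: stationary_law_def)
  have sp: "space P = Omega" using sets_eq_imp_space_eq[OF sets] by simp
  define G where "G \<omega> = (\<integral>\<^sup>+ u. ennreal (decay \<epsilon> (fst u)) * (1 + (f \<omega>)\<^sup>2 + (f (translate (fst u) \<omega>))\<^sup>2) \<partial>count_space \<omega>)" for \<omega>
  define N where "N \<omega> = ennpowr (campbell unit_cube (\<lambda>_. 1) \<omega>) (q + 1)" for \<omega> :: "'n config"
  define U where "U = campbell unit_cube (\<lambda>\<omega>. ennpowr (f \<omega>) (2 * p))"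
  define v where "v k = ((\<chi> i. real_of_int (k i)) :: real ^ 'n)" for k
  define H where "H k \<omega> = 3 * (N \<omega> + N (translate (v k) \<omega>)) + U \<omega> + U (translate (v k) \<omega>)" for k \<omega>
  have Gm: "G \<in> borel_measurable config_space"
    unfolding G_def by (rule measurable_sum_translate[OF f]) (use measurable_decay in measurable)
  have Nm: "N \<in> borel_measurable config_space"
    unfolding N_def using measurable_campbell[OF unit_cube_borel, of "\<lambda>_. 1"] by measurable
  have Um: "U \<in> borel_measurable config_space"
    unfolding U_def by (intro measurable_campbell) (use f in measurable)
  note P_cong = measurable_cong_sets[OF sets refl]
  have meas [measurable]: "N \<in> borel_measurable P" "U \<in> borel_measurable P"
    "(\<lambda>\<omega>. N (translate x \<omega>)) \<in> borel_measurable P" "(\<lambda>\<omega>. U (translate x \<omega>)) \<in> borel_measurable P" for x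
    using Nm Um measurable_compose[OF measurable_translate Nm] measurable_compose[OF measurable_translate Um]
    by (simp_all add: P_cong)
  have H_int: "(\<integral>\<^sup>+ \<omega>. H k \<omega> \<partial>P) = 6 * count_moment P (q + 1) + 2 * campbell_moment P f (2 * p)" for k
  proof -
    have "(\<integral>\<^sup>+ \<omega>. H k \<omega> \<partial>P) = 3 * ((\<integral>\<^sup>+ \<omega>. N \<omega> \<partial>P) + (\<integral>\<^sup>+ \<omega>. N (translate (v k) \<omega>) \<partial>P))
        + (\<integral>\<^sup>+ \<omega>. U \<omega> \<partial>P) + (\<integral>\<^sup>+ \<omega>. U (translate (v k) \<omega>) \<partial>P)"
      unfolding H_def by (simp add: nn_integral_add nn_integral_cmult)
    also have "\<dots> = 3 * ((\<integral>\<^sup>+ \<omega>. N \<omega> \<partial>P) + (\<integral>\<^sup>+ \<omega>. N \<omega> \<partial>P)) + (\<integral>\<^sup>+ \<omega>. U \<omega> \<partial>P) + (\<integral>\<^sup>+ \<omega>. U \<omega> \<partial>P)"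
      by (simp add: stationary_nn_integral[OF st Nm] stationary_nn_integral[OF st Um])
    also have "\<dots> = 3 * (count_moment P (q + 1) + count_moment P (q + 1)) + campbell_moment P f (2 * p) + campbell_moment P f (2 * p)"
      by (simp only: count_moment_def campbell_moment_def N_def U_def)
    also have "\<dots> = 6 * count_moment P (q + 1) + 2 * campbell_moment P f (2 * p)"
    proof -
      have "3 * (a + a) + b + b = 6 * a + 2 * b" for a b :: ennreal
      proof -
        have "3 * (a + a) = (3 * 2) * a" by (simp only: mult_2[symmetric] mult.assoc)
        then show ?thesis by (simp only: add.assoc mult_2[symmetric]) simp
      qed
      then show ?thesis .
    qed
    finally show ?thesis .
  qed
  have le: "campbell unit_cube G \<omega> \<le> (\<Sum>n. ennreal (decay_weight \<epsilon> n) * (\<Sum>k\<in>lattice_box n. H k \<omega>))"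
    if \<omega>: "\<omega> \<in> Omega" for \<omega>
  proof -
    define \<phi> where "\<phi> u w = 1 + (f (translate (fst u) \<omega>))\<^sup>2 + (f (translate (fst w) \<omega>))\<^sup>2" for u w :: "(real ^ 'n) \<times> real"
    define \<psi> where "\<psi> u w k = indicator (lattice_cube k) (fst w) * \<phi> u w" for u w k
    define J where "J u k = (\<integral>\<^sup>+ w. \<psi> u w k \<partial>count_space \<omega>)" for u k
    define L where "L u k = indicator unit_cube (fst u) * J u k" for u k
    \<comment> \<open>Undoing the translation lets both points range over the original
      configuration, at the price of \<open>decay\<close> at the difference of their
      positions.\<close>
    have "campbell unit_cube G \<omega> = (\<integral>\<^sup>+ u. indicator unit_cube (fst u) *
        (\<integral>\<^sup>+ w. ennreal (decay \<epsilon> (fst w - fst u)) * \<phi> u w \<partial>count_space \<omega>) \<partial>count_space \<omega>)"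
      by (simp add: campbell_def G_def nn_integral_translate translate_translate \<phi>_def)
    also have "\<dots> \<le> (\<integral>\<^sup>+ u. indicator unit_cube (fst u) *
        (\<integral>\<^sup>+ w. (\<Sum>n. ennreal (decay_weight \<epsilon> n) * (\<Sum>k\<in>lattice_box n. indicator (lattice_cube k) (fst w))) * \<phi> u w \<partial>count_space \<omega>) \<partial>count_space \<omega>)"
    proof (intro nn_integral_mono)
      fix u :: "(real ^ 'n) \<times> real"
      show "indicator unit_cube (fst u) * (\<integral>\<^sup>+ w. ennreal (decay \<epsilon> (fst w - fst u)) * \<phi> u w \<partial>count_space \<omega>)
        \<le> indicator unit_cube (fst u) * (\<integral>\<^sup>+ w. (\<Sum>n. ennreal (decay_weight \<epsilon> n) * (\<Sum>k\<in>lattice_box n. indicator (lattice_cube k) (fst w))) * \<phi> u w \<partial>count_space \<omega>)"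
        by (cases "fst u \<in> unit_cube") (auto intro!: nn_integral_mono mult_right_mono decay_le_layers[OF \<epsilon>])
    qed
    also have "\<dots> = (\<integral>\<^sup>+ u. indicator unit_cube (fst u) *
        (\<Sum>n. ennreal (decay_weight \<epsilon> n) * (\<Sum>k\<in>lattice_box n. J u k)) \<partial>count_space \<omega>)"
    proof (intro nn_integral_cong arg_cong2[where f="(*)"] refl)
      fix u
      have "(\<integral>\<^sup>+ w. (\<Sum>n. ennreal (decay_weight \<epsilon> n) * (\<Sum>k\<in>lattice_box n. indicator (lattice_cube k) (fst w))) * \<phi> u w \<partial>count_space \<omega>)
        = (\<integral>\<^sup>+ w. (\<Sum>n. ennreal (decay_weight \<epsilon> n) * (\<Sum>k\<in>lattice_box n. \<psi> u w k)) \<partial>count_space \<omega>)"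
        by (simp only: ennreal_suminf_multc[symmetric] sum_distrib_right mult.assoc \<psi>_def)
      also have "\<dots> = (\<Sum>n. ennreal (decay_weight \<epsilon> n) * (\<Sum>k\<in>lattice_box n. J u k))"
        by (simp add: nn_integral_suminf nn_integral_cmult nn_integral_sum J_def)
      finally show "(\<integral>\<^sup>+ w. (\<Sum>n. ennreal (decay_weight \<epsilon> n) * (\<Sum>k\<in>lattice_box n. indicator (lattice_cube k) (fst w))) * \<phi> u w \<partial>count_space \<omega>)
        = (\<Sum>n. ennreal (decay_weight \<epsilon> n) * (\<Sum>k\<in>lattice_box n. J u k))" .
    qed
    also have "\<dots> = (\<integral>\<^sup>+ u. (\<Sum>n. ennreal (decay_weight \<epsilon> n) * (\<Sum>k\<in>lattice_box n. L u k)) \<partial>count_space \<omega>)"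
      by (simp only: ennreal_suminf_cmult[symmetric] sum_distrib_left mult.left_commute L_def)
    also have "\<dots> = (\<Sum>n. ennreal (decay_weight \<epsilon> n) * (\<Sum>k\<in>lattice_box n. \<integral>\<^sup>+ u. L u k \<partial>count_space \<omega>))"
      by (simp add: nn_integral_suminf nn_integral_cmult nn_integral_sum)
    also have "\<dots> \<le> (\<Sum>n. ennreal (decay_weight \<epsilon> n) * (\<Sum>k\<in>lattice_box n. H k \<omega>))"
      unfolding L_def J_def \<psi>_def \<phi>_def H_def N_def U_def v_def
      by (intro suminf_le mult_left_mono sum_mono cube_pair_bound[OF pq \<omega>]) auto
    finally show ?thesis .
  qed
  let ?m = "6 * count_moment P (q + 1) + 2 * campbell_moment P f (2 * p)"
  have "(\<integral>\<^sup>+ \<omega>. campbell unit_cube G \<omega> \<partial>P) \<le> (\<integral>\<^sup>+ \<omega>. (\<Sum>n. ennreal (decay_weight \<epsilon> n) * (\<Sum>k\<in>lattice_box n. H k \<omega>)) \<partial>P)"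
    by (intro nn_integral_mono le) (simp add: sp)
  also have "\<dots> = (\<Sum>n. ennreal (decay_weight \<epsilon> n) * (\<Sum>k\<in>lattice_box n. \<integral>\<^sup>+ \<omega>. H k \<omega> \<partial>P))"
  proof -
    have [measurable]: "H k \<in> borel_measurable P" for k unfolding H_def by measurable
    show ?thesis by (simp add: nn_integral_suminf nn_integral_cmult nn_integral_sum)
  qed
  also have "\<dots> = (\<Sum>n. ennreal (decay_weight \<epsilon> n * (2 * real n + 1) ^ CARD('n)) * ?m)"
  proof (intro suminf_cong)
    fix n
    have "ennreal (decay_weight \<epsilon> n) * of_nat (card (lattice_box n :: ('n \<Rightarrow> int) set)) = ennreal (decay_weight \<epsilon> n * (2 * real n + 1) ^ CARD('n))"
      unfolding card_lattice_box
      by (simp add: ennreal_of_nat_eq_real_of_nat decay_weight_def ennreal_mult add_ac del: of_nat_power_eq_of_nat_cancel_iff)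
    then show "ennreal (decay_weight \<epsilon> n) * (\<Sum>k\<in>(lattice_box n :: ('n \<Rightarrow> int) set). \<integral>\<^sup>+ \<omega>. H k \<omega> \<partial>P)
      = ennreal (decay_weight \<epsilon> n * (2 * real n + 1) ^ CARD('n)) * ?m"
      unfolding H_int by (simp only: sum_constant mult.assoc[symmetric])
  qed
  also have "\<dots> = (\<Sum>n. ennreal (decay_weight \<epsilon> n * (2 * real n + 1) ^ CARD('n))) * ?m"
    by simp
  also have "(\<Sum>n. ennreal (decay_weight \<epsilon> n * (2 * real n + 1) ^ CARD('n))) = ennreal (\<Sum>n. decay_weight \<epsilon> n * (2 * real n + 1) ^ CARD('n))"
    by (intro suminf_ennreal2 summable_decay_weight \<epsilon>) (simp add: decay_weight_def)
  finally have bound: "(\<integral>\<^sup>+ \<omega>. campbell unit_cube G \<omega> \<partial>P) \<le> ennreal (\<Sum>n. decay_weight \<epsilon> n * (2 * real n + 1) ^ CARD('n)) * ?m" .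
  have "(\<integral>\<^sup>+ \<omega>. (\<integral>\<^sup>+ x. ennreal (decay \<epsilon> x) * (1 + (f \<omega>)\<^sup>2 + (f (translate x \<omega>))\<^sup>2) \<partial>count_space (pts \<omega>)) \<partial>palm P)
      = (\<integral>\<^sup>+ \<omega>. G \<omega> \<partial>palm P)"
    by (intro nn_integral_cong) (simp add: G_def Omega0_def nn_integral_pts)
  also have "\<dots> = (\<integral>\<^sup>+ \<omega>. campbell unit_cube G \<omega> \<partial>P) / intensity P"
    by (rule nn_integral_palm[OF sets Gm])
  also have "\<dots> \<le> ennreal (\<Sum>n. decay_weight \<epsilon> n * (2 * real n + 1) ^ CARD('n)) * ?m / intensity P"
    by (rule divide_right_mono_ennreal[OF bound])
  finally show ?thesis .
qed

text \<open>The unit cube of the rescaled configuration is a cube of side \<zeta> in the original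
  one, covered by the box of radius \<open>n\<close>. Polynomial growth in \<zeta> is enough against
  the exponential gain.\<close>

lemma intensity_rescaled_le:
  fixes P :: "('n::finite) config measure"
  assumes st: "stationary_law P" and pos: "\<zeta> > 0" "\<beta> > 0" and n: "\<zeta> \<le> real n"
  shows "intensity (rescaled_law \<zeta> \<beta> P) \<le> of_nat ((2 * n + 1) ^ CARD('n)) * intensity P"
proof -
  have sets: "sets P = sets config_space" using st by (simp add: stationary_law_def)
  have sp: "space P = Omega" using sets_eq_imp_space_eq[OF sets] by simp
  have resc: "rescale \<zeta> \<beta> \<in> measurable P config_space"
    using measurable_rescale[OF pos] by (simp add: measurable_cong_sets[OF sets refl])
  have cm: "campbell unit_cube (\<lambda>_. 1) \<in> borel_measurable (config_space :: 'n config measure)"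
    by (intro measurable_campbell) auto
  have "intensity (rescaled_law \<zeta> \<beta> P) = (\<integral>\<^sup>+ \<omega>. campbell unit_cube (\<lambda>_. 1) \<omega> \<partial>rescaled_law \<zeta> \<beta> P)"
    by (rule intensity_campbell) (simp add: rescaled_law_def)
  also have "\<dots> = (\<integral>\<^sup>+ \<omega>. campbell unit_cube (\<lambda>_. 1) (rescale \<zeta> \<beta> \<omega>) \<partial>P)"
    unfolding rescaled_law_def using resc cm by (simp add: nn_integral_distr)
  also have "\<dots> \<le> (\<integral>\<^sup>+ \<omega>. (\<Sum>k\<in>lattice_box n. campbell (lattice_cube k) (\<lambda>_. 1) \<omega>) \<partial>P)"
  proof (intro nn_integral_mono)
    fix \<omega> assume "\<omega> \<in> space P"
    then have \<omega>: "\<omega> \<in> Omega" by (simp add: sp)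
    have R: "rescale \<zeta> \<beta> \<omega> \<in> Omega" using measurable_space[OF resc] \<open>\<omega> \<in> space P\<close> by simp
    let ?A = "{u \<in> rescale \<zeta> \<beta> \<omega>. fst u \<in> unit_cube}"
    let ?g = "\<lambda>u::(real ^ 'n) \<times> real. (\<zeta> *\<^sub>R fst u, \<zeta> * snd u / \<beta>)"
    let ?B = "\<lambda>k. {u \<in> \<omega>. fst u \<in> lattice_cube k}"
    have "inj_on ?g ?A" using pos by (auto simp: inj_on_def prod_eq_iff)
    moreover have "?g ` ?A \<subseteq> (\<Union>k\<in>lattice_box n. ?B k)"
    proof
      fix w assume "w \<in> ?g ` ?A"
      then obtain u where u: "u \<in> rescale \<zeta> \<beta> \<omega>" "fst u \<in> unit_cube" "w = ?g u" by blast
      have "\<bar>fst w $ i\<bar> \<le> real n" for i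
      proof -
        have "0 \<le> fst u $ i" "fst u $ i \<le> 1" using u(2) by (auto simp: unit_cube_def)
        then have "\<zeta> * fst u $ i \<le> \<zeta> * 1" "0 \<le> \<zeta> * fst u $ i" using pos by (auto intro!: mult_left_mono)
        then show ?thesis using u(3) n by simp
      qed
      from lattice_box_cover[OF this] show "w \<in> (\<Union>k\<in>lattice_box n. ?B k)"
        using u pos by (auto simp: rescale_iff)
    qed
    moreover have fin: "finite (?B k)" for k by (intro finite_Omega[OF \<omega>]) simp
    ultimately have "card ?A \<le> card (\<Union>k\<in>lattice_box n. ?B k)"
      by (intro card_inj_on_le[of ?g]) auto
    also have "\<dots> \<le> (\<Sum>k\<in>lattice_box n. card (?B k))"
      by (rule card_UN_le) simp
    finally have "of_nat (card ?A) \<le> (of_nat (\<Sum>k\<in>lattice_box n. card (?B k)) :: ennreal)"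
      by (simp only: of_nat_le_iff)
    then show "campbell unit_cube (\<lambda>_. 1) (rescale \<zeta> \<beta> \<omega>) \<le> (\<Sum>k\<in>lattice_box n. campbell (lattice_cube k) (\<lambda>_. 1) \<omega>)"
      by (simp add: campbell_1[OF R] campbell_1[OF \<omega>])
  qed
  also have "\<dots> = (\<Sum>k\<in>(lattice_box n :: ('n \<Rightarrow> int) set). \<integral>\<^sup>+ \<omega>. campbell unit_cube (\<lambda>_. 1) (translate (\<chi> i. real_of_int (k i)) \<omega>) \<partial>P)"
    unfolding campbell_lattice_cube
    using measurable_compose[OF measurable_translate cm]
    by (subst nn_integral_sum) (simp_all add: measurable_cong_sets[OF sets refl])
  also have "\<dots> = (\<Sum>k\<in>(lattice_box n :: ('n \<Rightarrow> int) set). intensity P)"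
    by (simp only: stationary_nn_integral[OF st cm] intensity_campbell[OF sets])
  also have "\<dots> = of_nat ((2 * n + 1) ^ CARD('n)) * intensity P"
    by (simp only: sum_constant card_lattice_box)
  finally show ?thesis .
qed

text \<open>The bridge between the two laws. As \<zeta> \<ge> 1, rescaling maps the unit cube into
  itself, and sites deleted by the thinning contribute 0 by \<open>F0\<close>. What remains is at
  most a Campbell sum of the rescaled configuration, whose mean is intensity times Palm
  mean.\<close>

lemma campbell_moment_rescale_le:
  fixes P :: "('n::finite) config measure" and F :: "'n config \<Rightarrow> ennreal"
  assumes st: "stationary_law P" and pos: "\<zeta> \<ge> 1" "\<beta> > 0"
    and F: "F \<in> borel_measurable config_space" and F0: "\<And>\<omega>. 0 \<notin> pts \<omega> \<Longrightarrow> F \<omega> = 0"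
    and fin: "intensity P < \<infinity>"
  shows "campbell_moment P (\<lambda>\<omega>. ennreal \<zeta> * F (rescale \<zeta> \<beta> \<omega>)) r
    \<le> ennreal (\<zeta> powr r) * (intensity (rescaled_law \<zeta> \<beta> P) * (\<integral>\<^sup>+ \<omega>. ennpowr (F \<omega>) r \<partial>palm (rescaled_law \<zeta> \<beta> P)))"
proof -
  have \<zeta>: "\<zeta> > 0" using pos by simp
  let ?R = "rescaled_law \<zeta> \<beta> P"
  let ?G = "\<lambda>\<omega>. ennpowr (F \<omega>) r"
  have sets: "sets P = sets config_space" using st by (simp add: stationary_law_def)
  have setsR: "sets ?R = sets config_space" by (simp add: rescaled_law_def)
  have sp: "space P = Omega" using sets_eq_imp_space_eq[OF sets] by simp
  have resc: "rescale \<zeta> \<beta> \<in> measurable P config_space"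
    using measurable_rescale[OF \<zeta> pos(2)] by (simp add: measurable_cong_sets[OF sets refl])
  have Gm: "?G \<in> borel_measurable config_space" using F by measurable
  have cm: "campbell unit_cube ?G \<in> borel_measurable config_space"
    by (rule measurable_campbell[OF unit_cube_borel Gm])
  have "campbell_moment P (\<lambda>\<omega>. ennreal \<zeta> * F (rescale \<zeta> \<beta> \<omega>)) r
      \<le> (\<integral>\<^sup>+ \<omega>. ennreal (\<zeta> powr r) * campbell unit_cube ?G (rescale \<zeta> \<beta> \<omega>) \<partial>P)"
    unfolding campbell_moment_def
  proof (intro nn_integral_mono)
    fix \<omega> assume "\<omega> \<in> space P"
    then have \<omega>: "\<omega> \<in> Omega" by (simp add: sp)
    have R: "rescale \<zeta> \<beta> \<omega> \<in> Omega" using measurable_space[OF resc] \<open>\<omega> \<in> space P\<close> by simp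
    let ?A = "{u \<in> \<omega>. fst u \<in> unit_cube}"
    let ?A' = "{u \<in> ?A. \<bar>\<beta> * snd u / \<zeta>\<bar> \<le> 1}"
    let ?B = "{u \<in> rescale \<zeta> \<beta> \<omega>. fst u \<in> unit_cube}"
    let ?g = "\<lambda>u::(real ^ 'n) \<times> real. (fst u /\<^sub>R \<zeta>, \<beta> * snd u / \<zeta>)"
    have finA: "finite ?A" and finB: "finite ?B" by (auto intro!: finite_Omega[OF \<omega>] finite_Omega[OF R])
    \<comment> \<open>A site with too large a mark is absent from the rescaled configuration: by
      uniqueness of marks, no other copy of it can survive.\<close>
    have zero: "?G (translate (fst u /\<^sub>R \<zeta>) (rescale \<zeta> \<beta> \<omega>)) = 0" if "u \<in> ?A - ?A'" for u
    proof -
      have "0 \<notin> pts (translate (fst u /\<^sub>R \<zeta>) (rescale \<zeta> \<beta> \<omega>))"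
      proof
        assume "0 \<in> pts (translate (fst u /\<^sub>R \<zeta>) (rescale \<zeta> \<beta> \<omega>))"
        then obtain e where e: "(fst u, \<zeta> * e / \<beta>) \<in> \<omega>" "\<bar>e\<bar> \<le> 1"
          using \<zeta> pos by (auto simp: pts_def translate_iff rescale_iff)
        then have "\<zeta> * e / \<beta> = snd u"
          using mark_eq[OF \<omega> e(1)] mark_eq[OF \<omega>, of u] that by auto
        then have "\<beta> * snd u / \<zeta> = e" using \<zeta> pos by (auto simp: field_simps)
        then show False using that e by auto
      qed
      then show ?thesis by (simp add: F0)
    qed
    have "campbell unit_cube (\<lambda>\<omega>. ennpowr (ennreal \<zeta> * F (rescale \<zeta> \<beta> \<omega>)) r) \<omega>
        = ennreal (\<zeta> powr r) * (\<Sum>u\<in>?A. ?G (translate (fst u /\<^sub>R \<zeta>) (rescale \<zeta> \<beta> \<omega>)))"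
      using \<zeta> pos by (simp add: campbell_sum[OF \<omega>] ennpowr_cmult rescale_translate sum_distrib_left)
    also have "(\<Sum>u\<in>?A. ?G (translate (fst u /\<^sub>R \<zeta>) (rescale \<zeta> \<beta> \<omega>)))
        = (\<Sum>u\<in>?A'. ?G (translate (fst u /\<^sub>R \<zeta>) (rescale \<zeta> \<beta> \<omega>)))"
      using zero by (intro sum.mono_neutral_right[OF finA]) auto
    also have "\<dots> = (\<Sum>u\<in>?g ` ?A'. ?G (translate (fst u) (rescale \<zeta> \<beta> \<omega>)))"
      using \<zeta> pos by (subst sum.reindex) (auto simp: inj_on_def prod_eq_iff)
    also have "\<dots> \<le> (\<Sum>u\<in>?B. ?G (translate (fst u) (rescale \<zeta> \<beta> \<omega>)))"
    proof (intro sum_mono2 finB)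
      show "?g ` ?A' \<subseteq> ?B"
      proof
        fix w assume "w \<in> ?g ` ?A'"
        then obtain u where u: "u \<in> \<omega>" "fst u \<in> unit_cube" "\<bar>\<beta> * snd u / \<zeta>\<bar> \<le> 1" "w = ?g u" by blast
        have "0 \<le> inverse \<zeta> * fst u $ i \<and> inverse \<zeta> * fst u $ i \<le> 1" for i
        proof -
          have "0 \<le> fst u $ i" "fst u $ i \<le> 1" using u(2) by (auto simp: unit_cube_def)
          moreover have "0 \<le> inverse \<zeta>" "inverse \<zeta> \<le> 1" using pos by (auto simp: field_simps)
          ultimately show ?thesis using mult_mono[of "inverse \<zeta>" 1 "fst u $ i" 1] by auto
        qed
        then show "w \<in> ?B" using u \<zeta> pos by (auto simp: rescale_iff unit_cube_def)
      qed
    qed simp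
    also have "\<dots> = campbell unit_cube ?G (rescale \<zeta> \<beta> \<omega>)" by (simp add: campbell_sum[OF R])
    finally show "campbell unit_cube (\<lambda>\<omega>. ennpowr (ennreal \<zeta> * F (rescale \<zeta> \<beta> \<omega>)) r) \<omega>
        \<le> ennreal (\<zeta> powr r) * campbell unit_cube ?G (rescale \<zeta> \<beta> \<omega>)"
      by (simp add: mult_left_mono)
  qed
  also have "\<dots> = ennreal (\<zeta> powr r) * (\<integral>\<^sup>+ \<omega>. campbell unit_cube ?G \<omega> \<partial>?R)"
    using measurable_compose[OF resc cm] resc cm
    by (simp add: nn_integral_cmult rescaled_law_def nn_integral_distr)
  also have "(\<integral>\<^sup>+ \<omega>. campbell unit_cube ?G \<omega> \<partial>?R) \<le> intensity ?R * (\<integral>\<^sup>+ \<omega>. ?G \<omega> \<partial>palm ?R)"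
  proof -
    obtain n where "\<zeta> \<le> real n" using real_arch_simple by blast
    have "of_nat ((2 * n + 1) ^ CARD('n)) * intensity P < \<infinity>"
      using fin by (simp add: ennreal_mult_less_top of_nat_less_top del: of_nat_power)
    with intensity_rescaled_le[OF st \<zeta> pos(2) \<open>\<zeta> \<le> real n\<close>]
    have fin': "intensity ?R < \<infinity>"
      by (rule le_less_trans)
    have cmR: "campbell unit_cube ?G \<in> borel_measurable ?R" "campbell unit_cube (\<lambda>_. 1) \<in> borel_measurable ?R"
      using cm measurable_campbell[OF unit_cube_borel, of "\<lambda>_. 1"] by (simp_all add: measurable_cong_sets[OF setsR refl])
    show ?thesis
    \<comment> \<open>Cancelling the division in \<open>palm\<close> requires a finite nonzero
      intensity. At intensity 0 the cube is almost surely empty and both sides vanish.\<close>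
    proof (cases "intensity ?R = 0")
      case True
      then have "AE \<omega> in ?R. campbell unit_cube (\<lambda>_. 1) \<omega> = 0"
        using nn_integral_0_iff_AE[OF cmR(2)] by (simp add: intensity_campbell[OF setsR])
      then have "AE \<omega> in ?R. campbell unit_cube ?G \<omega> = 0"
      proof (rule AE_mp[OF _ AE_I2])
        fix \<omega> assume "\<omega> \<in> space ?R"
        then have "\<omega> \<in> Omega" using sets_eq_imp_space_eq[OF setsR] by simp
        then show "campbell unit_cube (\<lambda>_. 1) \<omega> = 0 \<longrightarrow> campbell unit_cube ?G \<omega> = 0"
          using finite_Omega[of \<omega> unit_cube] by (auto simp: campbell_sum)
      qed
      then show ?thesis using nn_integral_0_iff_AE[OF cmR(1)] by simp
    next
      case False
      with fin' have "x \<le> intensity ?R * (x / intensity ?R)" for x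
        by (simp add: ennreal_times_divide ennreal_mult_divide_eq mult.commute[of _ x])
      then show ?thesis by (simp only: nn_integral_palm[OF setsR Gm])
    qed
  qed
  finally show ?thesis by (simp add: mult_left_mono)
qed

section \<open>Existence and uniqueness of the diffusion matrix\<close>

text \<open>Such a function vanishes at the integers, so the bound near 0 extends to the whole line
  through fractional parts; a nonzero value would be unbounded along its multiples.\<close>

lemma additive_bounded_imp_zero:
  fixes \<phi> :: "real \<Rightarrow> real"
  assumes add: "\<And>s t. \<phi> (s + t) = \<phi> s + \<phi> t" and one: "\<phi> 1 = 0"
    and bd: "\<And>t. \<bar>t\<bar> \<le> 1 \<Longrightarrow> \<bar>\<phi> t\<bar> \<le> K"
  shows "\<phi> t = 0"
proof -
  have zero: "\<phi> 0 = 0" using add[of 0 0] by simp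
  have nat: "\<phi> (real n * t) = real n * \<phi> t" for n t
    by (induction n) (simp_all add: zero add distrib_right)
  have minus: "\<phi> (- t) = - \<phi> t" for t using add[of t "- t"] zero by simp
  have int: "\<phi> (real_of_int k) = 0" for k
  proof (cases k)
    case (nonneg n)
    then show ?thesis using nat[of n 1] one by simp
  next
    case (neg n)
    then have "real_of_int k = - (real (Suc n) * 1)" by simp
    then show ?thesis using nat[of "Suc n" 1] one minus by (simp del: of_nat_Suc)
  qed
  have bd': "\<bar>\<phi> s\<bar> \<le> K" for s
  proof -
    have "\<phi> s = \<phi> (frac s)" using add[of "real_of_int \<lfloor>s\<rfloor>" "frac s"] int by (simp add: frac_def)
    moreover have "\<bar>frac s\<bar> \<le> 1" using frac_ge_0[of s] frac_lt_1[of s] by simp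
    ultimately show ?thesis using bd by simp
  qed
  show ?thesis
  proof (rule ccontr)
    assume "\<phi> t \<noteq> 0"
    then obtain n where "K < real n * \<bar>\<phi> t\<bar>" using reals_Archimedean3[of "\<bar>\<phi> t\<bar>"] by auto
    with bd'[of "real n * t"] show False by (simp add: nat abs_mult)
  qed
qed

text \<open>The Jordan--von Neumann argument, with real homogeneity of the polar form obtained from
  local boundedness.\<close>

lemma parallelogram_imp_matrix:
  fixes Q :: "real ^ 'n::finite \<Rightarrow> real"
  assumes nonneg: "\<And>x. 0 \<le> Q x" and hom: "\<And>t x. Q (t *\<^sub>R x) = t\<^sup>2 * Q x"
    and par: "\<And>x y. Q (x + y) + Q (x - y) = 2 * Q x + 2 * Q y"
  shows "\<exists>M :: real ^ 'n ^ 'n. transpose M = M \<and> (\<forall>a. a \<bullet> (M *v a) = Q a)"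
proof -
  define B where "B x y = (Q (x + y) - Q (x - y)) / 4" for x y
  have minus: "Q (- x) = Q x" for x using hom[of "-1" x] by simp
  have minus': "Q (x - y) = Q (y - x)" for x y using minus[of "x - y"] by simp
  have zero: "Q 0 = 0" using hom[of 0 0] by simp
  have sym: "B x y = B y x" for x y by (simp add: B_def add.commute minus'[of x y])
  have diag: "B x x = Q x" for x using hom[of 2 x] by (simp add: B_def zero scaleR_2)
  have add: "B (x + z) y = B x y + B z y" for x y z
  proof -
    \<comment> \<open>Subtracting within the first and within the second pair of identities removes
      \<open>r\<close> and \<open>s\<close>; adding the two differences removes \<open>B\<close> and
      \<open>C\<close>.\<close>
    have key: "(A - D) / 4 = (E - F) / 4 + (G - H) / 4"
      if "A + B = 2 * E + 2 * r" "D + C = 2 * F + 2 * r" "A + C = 2 * G + 2 * s" "D + B = 2 * H + 2 * s"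
      for A B C D E F G H r s :: real
      using that by (simp add: field_simps)
    show ?thesis
      unfolding B_def
    proof (rule key)
      show "Q (x + z + y) + Q (x + y - z) = 2 * Q (x + y) + 2 * Q z"
        using par[of "x + y" z] by (simp add: algebra_simps)
      show "Q (x + z - y) + Q (x - y - z) = 2 * Q (x - y) + 2 * Q z"
        using par[of "x - y" z] by (simp add: algebra_simps)
      show "Q (x + z + y) + Q (x - y - z) = 2 * Q (z + y) + 2 * Q x"
        using par[of "z + y" x] minus'[of "z + y" x] by (simp add: algebra_simps)
      show "Q (x + z - y) + Q (x + y - z) = 2 * Q (z - y) + 2 * Q x"
        using par[of "z - y" x] minus'[of "z - y" x] by (simp add: algebra_simps)
    qed
  qed
  have bound: "\<bar>B x y\<bar> \<le> (Q x + Q y) / 2" for x y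
    using par[of x y] nonneg[of "x + y"] nonneg[of "x - y"] by (simp add: B_def)
  have scale: "B (t *\<^sub>R x) y = t * B x y" for t x y
  proof -
    have "B (t *\<^sub>R x) y - t * B x y = 0"
    \<comment> \<open>Subtracting the linear function normalises the additive map to vanish at
      1.\<close>
    proof (rule additive_bounded_imp_zero[where \<phi> = "\<lambda>t. B (t *\<^sub>R x) y - t * B x y"])
      show "\<bar>B (t *\<^sub>R x) y - t * B x y\<bar> \<le> (Q x + Q y) / 2 + \<bar>B x y\<bar>" if "\<bar>t\<bar> \<le> 1" for t
      proof -
        have "t\<^sup>2 * Q x \<le> 1 * Q x"
          using that nonneg[of x] by (intro mult_right_mono) (auto simp: abs_square_le_1)
        then have "\<bar>B (t *\<^sub>R x) y\<bar> \<le> (Q x + Q y) / 2" using bound[of "t *\<^sub>R x" y] by (simp add: hom)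
        moreover have "\<bar>t * B x y\<bar> \<le> \<bar>B x y\<bar>"
          using that by (simp add: abs_mult mult_left_le_one_le)
        ultimately show ?thesis by linarith
      qed
    qed (simp_all add: scaleR_add_left add distrib_right)
    then show ?thesis by simp
  qed
  have lin: "linear (\<lambda>x. B x y)" for y by (rule linearI) (simp_all add: add scale)
  have expand: "B a y = (\<Sum>i\<in>UNIV. a $ i * B (axis i 1) y)" for a y
  proof -
    have "B a y = B (\<Sum>i\<in>UNIV. a $ i *\<^sub>R axis i 1) y"
      using basis_expansion[of a] by (simp only: scalar_mult_eq_scaleR)
    also have "\<dots> = (\<Sum>i\<in>UNIV. a $ i * B (axis i 1) y)"
      by (simp add: linear_sum[OF lin] scale)
    finally show ?thesis .
  qed
  define M :: "real ^ 'n ^ 'n" where "M = (\<chi> i j. B (axis i 1) (axis j 1))"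
  have "transpose M = M" by (simp add: M_def transpose_def vec_eq_iff sym)
  moreover have "a \<bullet> (M *v a) = Q a" for a
  proof -
    have "a \<bullet> (M *v a) = (\<Sum>i\<in>UNIV. a $ i * (\<Sum>j\<in>UNIV. a $ j * B (axis j 1) (axis i 1)))"
      by (simp add: M_def inner_vec_def matrix_vector_mult_def mult.commute sym)
    also have "\<dots> = (\<Sum>i\<in>UNIV. a $ i * B (axis i 1) a)"
    proof (intro sum.cong arg_cong2[where f="(*)"] refl)
      show "(\<Sum>j\<in>UNIV. a $ j * B (axis j 1) (axis i 1)) = B (axis i 1) a" for i
        using expand[of a "axis i 1"] sym[of a "axis i 1"] by presburger
    qed
    also have "\<dots> = Q a" using expand[of a a] diag[of a] by simp
    finally show ?thesis .
  qed
  ultimately show ?thesis by blast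
qed

text \<open>Polarisation: a symmetric bilinear form is determined by its diagonal.\<close>

lemma symmetric_matrix_eqI:
  fixes M N :: "real ^ 'n::finite ^ 'n"
  assumes sym: "transpose M = M" "transpose N = N" and eq: "\<And>a. a \<bullet> (M *v a) = a \<bullet> (N *v a)"
  shows "M = N"
proof -
  have polar: "x \<bullet> (A *v y) = ((x + y) \<bullet> (A *v (x + y)) - x \<bullet> (A *v x) - y \<bullet> (A *v y)) / 2"
    if "transpose A = A" for A :: "real ^ 'n ^ 'n" and x y
  proof -
    have "y \<bullet> (A *v x) = x \<bullet> (A *v y)"
      using that by (metis dot_lmul_matrix inner_commute transpose_matrix_vector)
    then show ?thesis by (simp add: matrix_vector_right_distrib inner_add_left inner_add_right)
  qed
  have "x \<bullet> (M *v y) = x \<bullet> (N *v y)" for x y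
    using polar[OF sym(1), of x y] polar[OF sym(2), of x y] by (simp add: eq)
  then have "M *v y = N *v y" for y by (metis vector_eq_ldot)
  then show ?thesis by (simp add: matrix_eq)
qed

section \<open>The energy as a quadratic form\<close>

lemma measurable_mark0: "(\<lambda>\<omega>. mark \<omega> 0) \<in> borel_measurable (palm (P :: ('n::finite) config measure))"
proof (rule borel_measurableI_greater)
  fix c
  let ?M = "(config_space :: 'n config measure) \<Otimes>\<^sub>M (borel :: ((real ^ 'n) \<times> real) measure)"
  have [measurable]: "(\<lambda>z. fst (snd z)) \<in> borel_measurable ?M" "(\<lambda>z. snd (snd z)) \<in> borel_measurable ?M"
    by (rule measurable_compose[OF measurable_snd measurable_fst_mark] measurable_compose[OF measurable_snd measurable_snd_mark])+
  have "Measurable.pred ?M (\<lambda>z. fst (snd z) = 0 \<and> c < snd (snd z))" by measurable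
  from pred_bex_config[OF measurable_ident this]
  have "{\<omega> \<in> Omega. \<exists>u\<in>\<omega>. fst u = (0 :: real ^ 'n) \<and> c < snd u} \<in> sets config_space" by (simp add: pred_def)
  then have "{\<omega> \<in> Omega. \<exists>u\<in>\<omega>. fst u = (0 :: real ^ 'n) \<and> c < snd u} \<inter> Omega0 \<in> sets (palm P)"
    using Omega0_sets by (auto simp: sets_palm_iff)
  moreover have "{\<omega> \<in> space (palm P). c < mark \<omega> 0} = {\<omega> \<in> Omega. \<exists>u\<in>\<omega>. fst u = (0 :: real ^ 'n) \<and> c < snd u} \<inter> Omega0"
    using mark_eq by (force simp: Omega0_def pts_def)
  ultimately show "{\<omega> \<in> space (palm P). c < mark \<omega> 0} \<in> sets (palm P)" by simp
qed

lemma palm_to_config: "(\<lambda>\<omega>. \<omega>) \<in> measurable (palm P) config_space"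
  by (rule measurable_palmI) simp

lemma translate_Omega0: "\<omega> \<in> Omega \<Longrightarrow> x \<in> pts \<omega> \<Longrightarrow> translate x \<omega> \<in> Omega0"
  by (simp add: Omega0_def translate_Omega pts_translate)

definition energy_density :: "real \<Rightarrow> real ^ 'n \<Rightarrow> (('n::finite) config \<Rightarrow> real) \<Rightarrow> 'n config \<Rightarrow> real ^ 'n \<Rightarrow> real" where
  "energy_density \<beta> a f \<omega> x = cond \<omega> \<beta> 0 x * (a \<bullet> x - (f (translate x \<omega>) - f \<omega>))\<^sup>2"

lemma energy_alt:
  "energy P \<beta> a f = (1 / 2) * (\<integral>\<^sup>+ \<omega>. (\<integral>\<^sup>+ x. ennreal (energy_density \<beta> a f \<omega> x) \<partial>count_space (pts \<omega>)) \<partial>palm P)"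
  by (simp add: energy_def energy_density_def)

lemma energy_density_nonneg: "0 \<le> energy_density \<beta> a f \<omega> x"
  by (simp add: energy_density_def cond_def)

lemma measurable_energy_inner:
  fixes f :: "('n::finite) config \<Rightarrow> real"
  assumes f: "f \<in> borel_measurable (palm P)"
  shows "(\<lambda>\<omega>. \<integral>\<^sup>+ x. ennreal (energy_density \<beta> a f \<omega> x) \<partial>count_space (pts \<omega>)) \<in> borel_measurable (palm P)"
proof -
  let ?M = "palm P \<Otimes>\<^sub>M (borel :: ((real ^ 'n) \<times> real) measure)"
  \<comment> \<open>\<open>f\<close> is known to be measurable only on \<open>Omega0\<close>. Its
    extension by 0 can be composed with the joint translation, and agrees with \<open>f\<close>
    wherever it is evaluated, since all shifts are by points of \<omega>.\<close>
  define g where "g \<omega> = (if \<omega> \<in> Omega0 then f \<omega> else 0)" for \<omega>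
  have "f \<in> borel_measurable (restrict_space config_space Omega0)"
    using f measurable_cong_sets[OF sets_palm refl] by blast
  then have g: "g \<in> borel_measurable config_space"
    unfolding g_def
    using measurable_restrict_space_iff[where c = 0 and f = f, OF sets.Int[OF Omega0_sets sets.top]] by simp
  have x: "(\<lambda>z. fst (snd z)) \<in> borel_measurable ?M" and e: "(\<lambda>z. snd (snd z)) \<in> borel_measurable ?M"
    by (rule measurable_compose[OF measurable_snd measurable_fst_mark] measurable_compose[OF measurable_snd measurable_snd_mark])+
  have \<omega>: "fst \<in> measurable ?M config_space"
    by (rule measurable_compose[OF measurable_fst palm_to_config])
  note [measurable] = x e measurable_compose[OF \<omega> g] measurable_compose[OF measurable_fst measurable_mark0]
    measurable_compose[OF measurable_translate_pair[OF x \<omega>] g]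
  define h where "h z = (if fst (snd z) = 0 then 0 else
      exp (- norm (fst (snd z)) - \<beta> * (\<bar>mark (fst z) 0\<bar> + \<bar>snd (snd z)\<bar> + \<bar>mark (fst z) 0 - snd (snd z)\<bar>)))
      * (a \<bullet> fst (snd z) - (g (translate (fst (snd z)) (fst z)) - g (fst z)))\<^sup>2" for z
  have "(\<lambda>z. ennreal (h z)) \<in> borel_measurable ?M"
    unfolding h_def by measurable
  from measurable_nn_integral_config[OF palm_to_config this]
  have "(\<lambda>\<omega>. \<integral>\<^sup>+ u. ennreal (h (\<omega>, u)) \<partial>count_space \<omega>) \<in> borel_measurable (palm P)" .
  moreover have "(\<integral>\<^sup>+ x. ennreal (energy_density \<beta> a f \<omega> x) \<partial>count_space (pts \<omega>)) = (\<integral>\<^sup>+ u. ennreal (h (\<omega>, u)) \<partial>count_space \<omega>)"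
    if "\<omega> \<in> space (palm P)" for \<omega>
  proof -
    have \<omega>: "\<omega> \<in> Omega0" "\<omega> \<in> Omega" using that by (auto simp: Omega0_def)
    have "energy_density \<beta> a f \<omega> (fst u) = h (\<omega>, u)" if "u \<in> \<omega>" for u
      using translate_Omega0[OF \<omega>(2), of "fst u"] mark_eq[OF \<omega>(2) that] \<omega>(1) that
      by (auto simp: energy_density_def h_def cond_def g_def pts_def)
    then show ?thesis
      by (simp add: nn_integral_pts[OF \<omega>(2)] cong: nn_integral_cong_simp)
  qed
  ultimately show ?thesis by (simp cong: measurable_cong del: space_palm)
qed

lemma Linfty_zero: "(\<lambda>_. 0) \<in> Linfty M"
  by (auto simp: Linfty_def)

lemma Linfty_add:
  assumes "f \<in> Linfty M" "g \<in> Linfty M"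
  shows "(\<lambda>\<omega>. f \<omega> + g \<omega>) \<in> Linfty M"
proof -
  from assms obtain C D where "AE \<omega> in M. \<bar>f \<omega>\<bar> \<le> C" "AE \<omega> in M. \<bar>g \<omega>\<bar> \<le> D"
    by (auto simp: Linfty_def)
  then have "AE \<omega> in M. \<bar>f \<omega> + g \<omega>\<bar> \<le> C + D" by eventually_elim linarith
  with assms show ?thesis by (auto simp: Linfty_def)
qed

lemma Linfty_scale:
  assumes "f \<in> Linfty M"
  shows "(\<lambda>\<omega>. t * f \<omega>) \<in> Linfty M"
proof -
  from assms obtain C where "AE \<omega> in M. \<bar>f \<omega>\<bar> \<le> C" by (auto simp: Linfty_def)
  then have "AE \<omega> in M. \<bar>t * f \<omega>\<bar> \<le> \<bar>t\<bar> * C" by eventually_elim (simp add: abs_mult mult_left_mono)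
  with assms show ?thesis by (auto simp: Linfty_def)
qed

lemma Linfty_diff: "f \<in> Linfty M \<Longrightarrow> g \<in> Linfty M \<Longrightarrow> (\<lambda>\<omega>. f \<omega> - g \<omega>) \<in> Linfty M"
  using Linfty_add[OF _ Linfty_scale[of g M "- 1"], of f] by simp

lemma energy_scale:
  assumes "f \<in> Linfty (palm P)"
  shows "energy P \<beta> (t *\<^sub>R a) (\<lambda>\<omega>. t * f \<omega>) = ennreal (t\<^sup>2) * energy P \<beta> a f"
proof -
  have f: "f \<in> borel_measurable (palm P)" using assms by (simp add: Linfty_def)
  have "energy_density \<beta> (t *\<^sub>R a) (\<lambda>\<omega>. t * f \<omega>) \<omega> x = t\<^sup>2 * energy_density \<beta> a f \<omega> x" for \<omega> x
    by (simp add: energy_density_def power2_eq_square algebra_simps)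
  then have "energy P \<beta> (t *\<^sub>R a) (\<lambda>\<omega>. t * f \<omega>) = (1 / 2) * (ennreal (t\<^sup>2) *
      (\<integral>\<^sup>+ \<omega>. (\<integral>\<^sup>+ x. ennreal (energy_density \<beta> a f \<omega> x) \<partial>count_space (pts \<omega>)) \<partial>palm P))"
    by (simp add: energy_alt ennreal_mult energy_density_nonneg nn_integral_cmult measurable_energy_inner[OF f])
  then show ?thesis by (simp add: energy_alt mult.left_commute)
qed

text \<open>The increment in the density is jointly linear in slope and function, so its square
  obeys the identity pointwise. Combining \<open>f + g\<close> with \<open>f - g\<close> is the
  choice that carries over to infima.\<close>

lemma energy_parallelogram:
  fixes P :: "('n::finite) config measure"
  assumes "f \<in> Linfty (palm P)" "g \<in> Linfty (palm P)"
  shows "energy P \<beta> (a + b) (\<lambda>\<omega>. f \<omega> + g \<omega>) + energy P \<beta> (a - b) (\<lambda>\<omega>. f \<omega> - g \<omega>)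
    = 2 * energy P \<beta> a f + 2 * energy P \<beta> b g"
proof -
  have m: "f \<in> borel_measurable (palm P)" "g \<in> borel_measurable (palm P)"
    "(\<lambda>\<omega>. f \<omega> + g \<omega>) \<in> borel_measurable (palm P)" "(\<lambda>\<omega>. f \<omega> - g \<omega>) \<in> borel_measurable (palm P)"
    using assms by (auto simp: Linfty_def)
  define I where "I a f \<omega> = (\<integral>\<^sup>+ x. ennreal (energy_density \<beta> a f \<omega> x) \<partial>count_space (pts \<omega>))"
    for a and f :: "'n config \<Rightarrow> real" and \<omega>
  note meas = measurable_energy_inner[of _ P \<beta>, folded I_def]
  note [measurable] = meas[OF m(1)] meas[OF m(2)] meas[OF m(3)] meas[OF m(4)]
  have dens: "energy_density \<beta> (a + b) (\<lambda>\<omega>. f \<omega> + g \<omega>) \<omega> x + energy_density \<beta> (a - b) (\<lambda>\<omega>. f \<omega> - g \<omega>) \<omega> x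
      = 2 * energy_density \<beta> a f \<omega> x + 2 * energy_density \<beta> b g \<omega> x" for \<omega> x
    by (simp add: energy_density_def power2_eq_square algebra_simps)
  have "I (a + b) (\<lambda>\<omega>. f \<omega> + g \<omega>) \<omega> + I (a - b) (\<lambda>\<omega>. f \<omega> - g \<omega>) \<omega> = 2 * I a f \<omega> + 2 * I b g \<omega>" for \<omega>
  proof -
    have "I (a + b) (\<lambda>\<omega>. f \<omega> + g \<omega>) \<omega> + I (a - b) (\<lambda>\<omega>. f \<omega> - g \<omega>) \<omega>
      = (\<integral>\<^sup>+ x. ennreal (energy_density \<beta> (a + b) (\<lambda>\<omega>. f \<omega> + g \<omega>) \<omega> x + energy_density \<beta> (a - b) (\<lambda>\<omega>. f \<omega> - g \<omega>) \<omega> x) \<partial>count_space (pts \<omega>))"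
      unfolding I_def by (simp add: nn_integral_add[symmetric] energy_density_nonneg)
    also have "\<dots> = (\<integral>\<^sup>+ x. 2 * ennreal (energy_density \<beta> a f \<omega> x) + 2 * ennreal (energy_density \<beta> b g \<omega> x) \<partial>count_space (pts \<omega>))"
      unfolding dens by (simp add: energy_density_nonneg ennreal_mult)
    also have "\<dots> = 2 * I a f \<omega> + 2 * I b g \<omega>"
      unfolding I_def by (simp add: nn_integral_add nn_integral_cmult)
    finally show ?thesis .
  qed
  then have "(\<integral>\<^sup>+ \<omega>. I (a + b) (\<lambda>\<omega>. f \<omega> + g \<omega>) \<omega> + I (a - b) (\<lambda>\<omega>. f \<omega> - g \<omega>) \<omega> \<partial>palm P)
      = (\<integral>\<^sup>+ \<omega>. 2 * I a f \<omega> + 2 * I b g \<omega> \<partial>palm P)" by simp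
  then have "(\<integral>\<^sup>+ \<omega>. I (a + b) (\<lambda>\<omega>. f \<omega> + g \<omega>) \<omega> \<partial>palm P) + (\<integral>\<^sup>+ \<omega>. I (a - b) (\<lambda>\<omega>. f \<omega> - g \<omega>) \<omega> \<partial>palm P)
      = 2 * (\<integral>\<^sup>+ \<omega>. I a f \<omega> \<partial>palm P) + 2 * (\<integral>\<^sup>+ \<omega>. I b g \<omega> \<partial>palm P)"
    by (simp add: nn_integral_add nn_integral_cmult)
  then show ?thesis
    by (simp only: energy_alt I_def[symmetric] distrib_left[symmetric] mult.left_commute[of 2])
qed

text \<open>Minimising a jointly quadratic functional over a linear space leaves a quadratic form in
  the slope; finite energy of the zero function makes it real valued. Existence and uniqueness of
  its matrix give meaning to \<open>THE\<close> in \<open>diffusion_matrix\<close>.\<close>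

lemma is_diffusion_matrix_diffusion_matrix:
  fixes P :: "('n::finite) config measure"
  assumes fin: "\<And>a. energy P \<beta> a (\<lambda>_. 0) < \<infinity>"
  shows "is_diffusion_matrix P \<beta> (diffusion_matrix P \<beta>)"
proof -
  let ?L = "Linfty (palm P)"
  define E where "E a = (INF f \<in> ?L. energy P \<beta> a f)" for a
  define Q where "Q a = enn2real (E a)" for a
  have E_le: "E a \<le> energy P \<beta> a f" if "f \<in> ?L" for a f
    unfolding E_def using that by (rule INF_lower)
  have E_fin: "E a < \<infinity>" for a using E_le[OF Linfty_zero] fin by (rule le_less_trans)
  have E_Q: "E a = ennreal (Q a)" for a using E_fin[of a] by (simp add: Q_def)
  have Q_nonneg: "0 \<le> Q a" for a by (simp add: Q_def)
  have approx: "\<exists>f\<in>?L. energy P \<beta> a f < ennreal (Q a + e)" if "e > 0" for a e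
  proof -
    have "E a < ennreal (Q a + e)" using that Q_nonneg[of a] by (simp add: E_Q ennreal_less_iff)
    then show ?thesis by (simp add: E_def INF_less_iff)
  qed
  have hom_le: "Q (t *\<^sub>R a) \<le> t\<^sup>2 * Q a" for t a
  proof (rule field_le_epsilon)
    fix e :: real assume e: "e > 0"
    have "0 < t\<^sup>2 + 1" by (simp add: add_nonneg_pos)
    \<comment> \<open>The denominator keeps the error below \<open>e\<close> after multiplication by
      \<open>t\<^sup>2\<close>, and is safe at \<open>t = 0\<close>.\<close>
    then obtain f where f: "f \<in> ?L" "energy P \<beta> a f < ennreal (Q a + e / (t\<^sup>2 + 1))"
      using approx[of "e / (t\<^sup>2 + 1)" a] e by auto
    have "E (t *\<^sub>R a) \<le> ennreal (t\<^sup>2) * energy P \<beta> a f"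
      using E_le[OF Linfty_scale[OF f(1)]] energy_scale[OF f(1)] by metis
    also have "\<dots> \<le> ennreal (t\<^sup>2) * ennreal (Q a + e / (t\<^sup>2 + 1))"
      using f(2) by (intro mult_left_mono) auto
    also have "\<dots> = ennreal (t\<^sup>2 * Q a + t\<^sup>2 * e / (t\<^sup>2 + 1))"
      using Q_nonneg e by (simp add: ennreal_mult[symmetric] distrib_left)
    finally have "Q (t *\<^sub>R a) \<le> t\<^sup>2 * Q a + t\<^sup>2 * e / (t\<^sup>2 + 1)"
      using Q_nonneg e by (simp add: E_Q ennreal_le_iff del: ennreal_plus)
    also have "t\<^sup>2 * e / (t\<^sup>2 + 1) \<le> e"
      using \<open>0 < t\<^sup>2 + 1\<close> e by (simp add: pos_divide_le_eq algebra_simps)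
    finally show "Q (t *\<^sub>R a) \<le> t\<^sup>2 * Q a + e" by simp
  qed
  have hom: "Q (t *\<^sub>R a) = t\<^sup>2 * Q a" for t a
  proof (cases "t = 0")
    case True
    then show ?thesis using hom_le[of 0 a] Q_nonneg[of 0] by simp
  next
    case False
    have "Q a \<le> (inverse t)\<^sup>2 * Q (t *\<^sub>R a)" using hom_le[of "inverse t" "t *\<^sub>R a"] False by simp
    then have "t\<^sup>2 * Q a \<le> t\<^sup>2 * ((inverse t)\<^sup>2 * Q (t *\<^sub>R a))" by (intro mult_left_mono) auto
    then show ?thesis using hom_le[of t a] False by (simp add: power_inverse mult.assoc[symmetric])
  qed
  have par_le: "Q (a + b) + Q (a - b) \<le> 2 * Q a + 2 * Q b" for a b
  proof (rule field_le_epsilon)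
    fix e :: real assume e: "e > 0"
    obtain f where f: "f \<in> ?L" "energy P \<beta> a f < ennreal (Q a + e / 4)" using approx[of "e / 4" a] e by auto
    obtain g where g: "g \<in> ?L" "energy P \<beta> b g < ennreal (Q b + e / 4)" using approx[of "e / 4" b] e by auto
    have "E (a + b) + E (a - b) \<le> 2 * energy P \<beta> a f + 2 * energy P \<beta> b g"
      unfolding energy_parallelogram[OF f(1) g(1), symmetric]
      by (intro add_mono E_le Linfty_add Linfty_diff f g)
    also have "\<dots> \<le> ennreal 2 * ennreal (Q a + e / 4) + ennreal 2 * ennreal (Q b + e / 4)"
      using f g by (intro add_mono mult_mono) auto
    also have "\<dots> = ennreal (2 * Q a + 2 * Q b + e)"
      using Q_nonneg[of a] Q_nonneg[of b] e by (simp add: ennreal_mult[symmetric] ennreal_plus[symmetric] del: ennreal_plus ennreal_numeral)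
    finally show "Q (a + b) + Q (a - b) \<le> 2 * Q a + 2 * Q b + e"
      using Q_nonneg e by (simp add: E_Q ennreal_le_iff ennreal_plus[symmetric] del: ennreal_plus)
  qed
  \<comment> \<open>Near-minimisers give only one inequality. Applied to \<open>a + b\<close> and
    \<open>a - b\<close>, with homogeneity for the factor 2, it becomes its own converse.\<close>
  have par: "Q (a + b) + Q (a - b) = 2 * Q a + 2 * Q b" for a b
  proof (rule antisym[OF par_le])
    have "Q (a + b + (a - b)) = 4 * Q a" "Q (a + b - (a - b)) = 4 * Q b"
      using hom[of 2 a] hom[of 2 b] by (simp_all add: scaleR_2)
    with par_le[of "a + b" "a - b"] show "2 * Q a + 2 * Q b \<le> Q (a + b) + Q (a - b)" by simp
  qed
  obtain M :: "real ^ 'n ^ 'n" where M: "transpose M = M" "\<And>a. a \<bullet> (M *v a) = Q a"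
    using parallelogram_imp_matrix[OF Q_nonneg hom par] by blast
  have "is_diffusion_matrix P \<beta> M"
    using M Q_nonneg E_Q by (simp add: is_diffusion_matrix_def E_def)
  moreover have "N = M" if "is_diffusion_matrix P \<beta> N" for N
  proof (rule symmetric_matrix_eqI)
    show "transpose N = N" "transpose M = M" using that M by (auto simp: is_diffusion_matrix_def)
    show "a \<bullet> (N *v a) = a \<bullet> (M *v a)" for a
    proof -
      have "ennreal (a \<bullet> (N *v a)) = ennreal (Q a)" "0 \<le> a \<bullet> (N *v a)"
        using that E_Q by (auto simp: is_diffusion_matrix_def E_def)
      then show ?thesis using Q_nonneg[of a] by (simp add: M(2))
    qed
  qed
  ultimately show ?thesis unfolding diffusion_matrix_def by (rule theI)
qed

section \<open>The test function\<close>

text \<open>The three squares added in the proof cancel all cross terms and complete the left side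
  to exactly three times the sum of squares.\<close>

lemma square_diff_le:
  fixes y s s' :: real
  assumes "\<bar>y\<bar> \<le> r"
  shows "(y - (s' - s))\<^sup>2 \<le> 3 * (r\<^sup>2 + s\<^sup>2 + s'\<^sup>2)"
proof -
  have "y\<^sup>2 \<le> r\<^sup>2" using assms by (simp add: abs_le_square_iff[symmetric])
  then have r: "3 * (y\<^sup>2 + s\<^sup>2 + s'\<^sup>2) \<le> 3 * (r\<^sup>2 + s\<^sup>2 + s'\<^sup>2)" by simp
  have "(y - (s' - s))\<^sup>2 \<le> (y - (s' - s))\<^sup>2 + ((y + s')\<^sup>2 + (y - s)\<^sup>2 + (s' + s)\<^sup>2)" by simp
  also have "\<dots> = 3 * (y\<^sup>2 + s\<^sup>2 + s'\<^sup>2)" by (simp add: power2_eq_square algebra_simps)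
  finally show ?thesis using r by (rule order_trans)
qed

text \<open>The truncation level \<open>exp (\<zeta> / 2)\<close> is chosen so that a truncated value already pays the
  factor \<open>exp (- \<zeta>)\<close>.\<close>

lemma truncated_gradient_bound:
  fixes s s' r y t \<zeta> \<epsilon> :: real
  assumes nn: "0 \<le> s" "0 \<le> s'" and y: "\<bar>y\<bar> \<le> r" and t: "r \<le> t" and \<epsilon>: "0 < \<epsilon>" "\<epsilon> < 1" and \<zeta>: "0 < \<zeta>"
    and edge: "t \<le> \<zeta> \<Longrightarrow> s' = s + y"
  shows "exp (- t) * (y - (min s' (exp (\<zeta> / 2)) - min s (exp (\<zeta> / 2))))\<^sup>2
    \<le> 4 * exp (- ((1 - \<epsilon>) * \<zeta>)) * (((1 + r\<^sup>2) * exp (- \<epsilon> * r)) * (1 + s\<^sup>2 + s'\<^sup>2))"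
proof -
  let ?n = "exp (\<zeta> / 2)"
  let ?g = "y - (min s' ?n - min s ?n)"
  have r: "0 \<le> r" using y by linarith
  have prod: "r\<^sup>2 + s\<^sup>2 + s'\<^sup>2 \<le> (1 + r\<^sup>2) * (1 + s\<^sup>2 + s'\<^sup>2)"
    by (simp add: algebra_simps)
  show ?thesis
  proof (cases "t \<le> \<zeta>")
    case False
    \<comment> \<open>For a pair outside the graph, \<open>t\<close> is split into shares
      \<open>1 - \<epsilon>\<close> and \<epsilon>: the first is bounded below by \<zeta>, the
      second by the distance.\<close>
    have "(1 - \<epsilon>) * \<zeta> + \<epsilon> * r \<le> (1 - \<epsilon>) * t + \<epsilon> * t"
      using False t \<epsilon> by (intro add_mono mult_left_mono) auto
    then have "exp (- t) \<le> exp (- ((1 - \<epsilon>) * \<zeta>) + - \<epsilon> * r)" by (simp add: algebra_simps)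
    then have e: "exp (- t) \<le> exp (- ((1 - \<epsilon>) * \<zeta>)) * exp (- \<epsilon> * r)" by (simp only: exp_add)
    have "?g\<^sup>2 \<le> 3 * (r\<^sup>2 + (min s ?n)\<^sup>2 + (min s' ?n)\<^sup>2)" by (rule square_diff_le[OF y])
    also have "\<dots> \<le> 3 * (r\<^sup>2 + s\<^sup>2 + s'\<^sup>2)"
      using nn r by (intro mult_left_mono add_mono power_mono) auto
    also have "\<dots> \<le> 4 * ((1 + r\<^sup>2) * (1 + s\<^sup>2 + s'\<^sup>2))"
      using prod nn r by (intro mult_mono) auto
    finally have "exp (- t) * ?g\<^sup>2 \<le> (exp (- ((1 - \<epsilon>) * \<zeta>)) * exp (- \<epsilon> * r)) * (4 * ((1 + r\<^sup>2) * (1 + s\<^sup>2 + s'\<^sup>2)))"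
      using e by (intro mult_mono) auto
    then show ?thesis by (simp add: mult_ac)
  next
    case True
    note s' = edge[OF True]
    show ?thesis
    proof (cases "s \<le> ?n \<and> s' \<le> ?n")
      case True
      then have "?g = 0" using s' by (simp add: min_def)
      then show ?thesis by simp
    next
      case False
      have "exp \<zeta> = ?n\<^sup>2" by (simp add: power2_eq_square flip: exp_add)
      also have "\<dots> \<le> s\<^sup>2 + s'\<^sup>2"
      proof (cases "s \<le> ?n")
        case True
        with False have "?n\<^sup>2 \<le> s'\<^sup>2" by (intro power_mono) auto
        then show ?thesis by (simp add: add_increasing)
      next
        case False
        then have "?n\<^sup>2 \<le> s\<^sup>2" by (intro power_mono) auto
        then show ?thesis by (simp add: add_increasing2)
      qed
      finally have one: "1 \<le> exp (- \<zeta>) * (s\<^sup>2 + s'\<^sup>2)" by (simp add: exp_minus field_simps)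
      \<comment> \<open>Truncation is monotone and 1-Lipschitz, so along an edge it cancels a part
        of \<open>y\<close> without overshooting.\<close>
      have "\<bar>?g\<bar> \<le> r" using s' y by (auto simp: min_def abs_le_iff)
      then have g: "?g\<^sup>2 \<le> r\<^sup>2" by (simp add: abs_le_square_iff[symmetric])
      have e1: "exp (- t) \<le> exp (- \<epsilon> * r)"
        using t \<epsilon> r mult_right_mono[of \<epsilon> 1 r] by simp
      have e2: "exp (- \<zeta>) \<le> exp (- ((1 - \<epsilon>) * \<zeta>))" using \<epsilon> \<zeta> by (simp add: algebra_simps)
      then have e3: "exp (- \<zeta>) \<le> 4 * exp (- ((1 - \<epsilon>) * \<zeta>))"
        using exp_ge_zero[of "- ((1 - \<epsilon>) * \<zeta>)"] by linarith
      have "exp (- t) * ?g\<^sup>2 \<le> exp (- \<epsilon> * r) * r\<^sup>2" using e1 g by (intro mult_mono) auto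
      also have "\<dots> \<le> exp (- \<epsilon> * r) * r\<^sup>2 * (exp (- \<zeta>) * (s\<^sup>2 + s'\<^sup>2))"
        using mult_left_mono[OF one, of "exp (- \<epsilon> * r) * r\<^sup>2"] by simp
      also have "\<dots> = exp (- \<zeta>) * (r\<^sup>2 * exp (- \<epsilon> * r) * (s\<^sup>2 + s'\<^sup>2))" by (simp add: mult_ac)
      also have "\<dots> \<le> 4 * exp (- ((1 - \<epsilon>) * \<zeta>)) * (((1 + r\<^sup>2) * exp (- \<epsilon> * r)) * (1 + s\<^sup>2 + s'\<^sup>2))"
        using e3 by (intro mult_mono) auto
      finally show ?thesis .
    qed
  qed
qed

text \<open>The factor \<zeta> restores original lengths, so that the increment along an edge is
  \<open>a \<bullet> x\<close> in the unscaled configuration.\<close>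

definition rescaled_height :: "real \<Rightarrow> real \<Rightarrow> real ^ 'n \<Rightarrow> ('n::finite) config \<Rightarrow> ennreal" where
  "rescaled_height \<zeta> \<beta> a \<omega> = ennreal \<zeta> * cluster_height a (rescale \<zeta> \<beta> \<omega>)"

text \<open>The minimum is taken before \<open>enn2real\<close>, which sends \<infinity> to 0: an
  infinite height is truncated like any other large one.\<close>

definition test_function :: "real \<Rightarrow> real \<Rightarrow> real ^ 'n \<Rightarrow> ('n::finite) config \<Rightarrow> real" where
  "test_function \<zeta> \<beta> a \<omega> = enn2real (min (rescaled_height \<zeta> \<beta> a \<omega>) (ennreal (exp (\<zeta> / 2))))"

lemma measurable_rescaled_height:
  assumes "\<zeta> > 0" "\<beta> > 0"
  shows "rescaled_height \<zeta> \<beta> a \<in> borel_measurable (config_space :: ('n::finite) config measure)"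
  unfolding rescaled_height_def[abs_def]
  using measurable_compose[OF measurable_rescale[OF assms] measurable_cluster_height] by measurable

lemma test_function_Linfty:
  assumes "\<zeta> > 0" "\<beta> > 0"
  shows "test_function \<zeta> \<beta> a \<in> Linfty (palm P)"
proof -
  have "test_function \<zeta> \<beta> a \<in> borel_measurable config_space"
    unfolding test_function_def[abs_def] using measurable_rescaled_height[OF assms] by measurable
  moreover have "\<bar>test_function \<zeta> \<beta> a \<omega>\<bar> \<le> exp (\<zeta> / 2)" for \<omega>
    unfolding test_function_def by (simp add: enn2real_leI)
  ultimately show ?thesis by (auto simp: Linfty_def intro: measurable_palmI)
qed

lemma energy_density_test_function_le:
  fixes a x :: "real ^ 'n::finite"
  assumes pos: "\<zeta> > 0" "\<beta> > 0" and \<epsilon>: "0 < \<epsilon>" "\<epsilon> < 1" and a: "norm a = 1"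
    and \<omega>: "\<omega> \<in> Omega0" and x: "x \<in> pts \<omega>"
  shows "ennreal (energy_density \<beta> a (test_function \<zeta> \<beta> a) \<omega> x)
    \<le> ennreal (4 * exp (- ((1 - \<epsilon>) * \<zeta>))) *
      (ennreal (decay \<epsilon> x) * (1 + (rescaled_height \<zeta> \<beta> a \<omega>)\<^sup>2 + (rescaled_height \<zeta> \<beta> a (translate x \<omega>))\<^sup>2))"
\<comment> \<open>The self-pair has zero conductance, and an infinite height makes the right side
  infinite because \<open>decay\<close> is positive. Otherwise everything is real and
  \<open>truncated_gradient_bound\<close> applies, with \<open>exp (- t)\<close> the
  conductance.\<close>
proof (cases "x = 0 \<or> rescaled_height \<zeta> \<beta> a \<omega> = \<top> \<or> rescaled_height \<zeta> \<beta> a (translate x \<omega>) = \<top>")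
  case True
  then show ?thesis
  proof (elim disjE)
    assume "x = 0"
    then show ?thesis by (simp add: energy_density_def cond_def)
  qed (use decay_pos[of \<epsilon> x] in \<open>auto simp: ennreal_mult_top ennreal_top_mult ennreal_mult_eq_top_iff power2_eq_square\<close>)
next
  case False
  then have x0: "x \<noteq> 0" by simp
  from False obtain s where s: "rescaled_height \<zeta> \<beta> a \<omega> = ennreal s" "0 \<le> s" by (cases "rescaled_height \<zeta> \<beta> a \<omega>") auto
  from False obtain s' where s': "rescaled_height \<zeta> \<beta> a (translate x \<omega>) = ennreal s'" "0 \<le> s'"
    by (cases "rescaled_height \<zeta> \<beta> a (translate x \<omega>)") auto
  have test: "test_function \<zeta> \<beta> a \<omega> = min s (exp (\<zeta> / 2))" "test_function \<zeta> \<beta> a (translate x \<omega>) = min s' (exp (\<zeta> / 2))"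
    using s s' by (simp_all add: test_function_def min_def ennreal_le_iff)
  define t where "t = norm x + \<beta> * (\<bar>mark \<omega> 0\<bar> + \<bar>mark \<omega> x\<bar> + \<bar>mark \<omega> 0 - mark \<omega> x\<bar>)"
  have rt: "norm x \<le> t" using pos unfolding t_def by simp
  have edge: "s' = s + a \<bullet> x" if "t \<le> \<zeta>"
  proof -
    have e: "(0, x /\<^sub>R \<zeta>) \<in> graph_edges (rescale \<zeta> \<beta> \<omega>)"
      using that \<omega> x x0 pos by (intro rescale_edge) (auto simp: Omega0_def t_def)
    obtain c where c: "cluster_height a (rescale \<zeta> \<beta> \<omega>) = ennreal c" "0 \<le> c"
      using s(1) pos unfolding rescaled_height_def
      by (cases "cluster_height a (rescale \<zeta> \<beta> \<omega>)") (auto simp: ennreal_mult_top)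
    have sc: "s = \<zeta> * c" using s c pos by (simp add: rescaled_height_def flip: ennreal_mult)
    note h = cluster_height_edge[OF e c]
    have "rescaled_height \<zeta> \<beta> a (translate x \<omega>) = ennreal \<zeta> * ennreal (c + a \<bullet> (x /\<^sub>R \<zeta>))"
      unfolding rescaled_height_def rescale_translate[OF pos] h(2) ..
    also have "\<dots> = ennreal (\<zeta> * (c + a \<bullet> (x /\<^sub>R \<zeta>)))" using pos h(1) by (simp add: ennreal_mult)
    also have eq: "\<zeta> * (c + a \<bullet> (x /\<^sub>R \<zeta>)) = s + a \<bullet> x" using pos by (simp add: sc distrib_left)
    finally have "ennreal s' = ennreal (s + a \<bullet> x)" using s' by simp
    moreover have "0 \<le> s + a \<bullet> x"
      unfolding eq[symmetric] using h(1) pos by (intro mult_nonneg_nonneg) auto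
    ultimately show ?thesis using s' by simp
  qed
  have ax: "\<bar>a \<bullet> x\<bar> \<le> norm x" using Cauchy_Schwarz_ineq2[of a x] a by simp
  have "energy_density \<beta> a (test_function \<zeta> \<beta> a) \<omega> x
      = exp (- t) * (a \<bullet> x - (min s' (exp (\<zeta> / 2)) - min s (exp (\<zeta> / 2))))\<^sup>2"
    using x0 by (simp add: energy_density_def cond_def test t_def)
  also have "\<dots> \<le> 4 * exp (- ((1 - \<epsilon>) * \<zeta>)) * (decay \<epsilon> x * (1 + s\<^sup>2 + s'\<^sup>2))"
    unfolding decay_def
    by (rule truncated_gradient_bound[OF s(2) s'(2) ax rt \<epsilon> pos(1) edge])
  finally have "ennreal (energy_density \<beta> a (test_function \<zeta> \<beta> a) \<omega> x)
      \<le> ennreal (4 * exp (- ((1 - \<epsilon>) * \<zeta>)) * (decay \<epsilon> x * (1 + s\<^sup>2 + s'\<^sup>2)))" by (rule ennreal_leI)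
  also have "\<dots> = ennreal (4 * exp (- ((1 - \<epsilon>) * \<zeta>))) * (ennreal (decay \<epsilon> x) * (1 + (ennreal s)\<^sup>2 + (ennreal s')\<^sup>2))"
  proof -
    have "1 + (ennreal s)\<^sup>2 + (ennreal s')\<^sup>2 = ennreal (1 + s\<^sup>2 + s'\<^sup>2)"
      using s s' by (simp add: ennreal_power)
    then show ?thesis
      using decay_pos[of \<epsilon> x] by (simp only: ennreal_mult' ennreal_mult'' less_imp_le exp_ge_zero mult_nonneg_nonneg zero_le_numeral) 
  qed
  finally show ?thesis by (simp add: s s')
qed

text \<open>The passage from a pointwise density bound to the energy, shared by the test function
  and the zero function. The factor 1/2 is estimated by 1.\<close>

lemma energy_le_of_density_le:
  fixes P :: "('n::finite) config measure" and f :: "'n config \<Rightarrow> ennreal"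
  assumes st: "stationary_law P" and f: "f \<in> borel_measurable config_space" and \<epsilon>: "\<epsilon> > 0"
    and pq: "p > 1" "q > 1" "1 / p + 1 / q = 1"
    and le: "\<And>\<omega> x. \<omega> \<in> Omega0 \<Longrightarrow> x \<in> pts \<omega> \<Longrightarrow> ennreal (energy_density \<beta> a g \<omega> x)
      \<le> c * (ennreal (decay \<epsilon> x) * (1 + (f \<omega>)\<^sup>2 + (f (translate x \<omega>))\<^sup>2))"
  shows "energy P \<beta> a g \<le> c * (ennreal (\<Sum>n. decay_weight \<epsilon> n * (2 * real n + 1) ^ CARD('n))
        * (6 * count_moment P (q + 1) + 2 * campbell_moment P f (2 * p)) / intensity P)"
proof -
  define G where "G \<omega> = (\<integral>\<^sup>+ x. ennreal (decay \<epsilon> x) * (1 + (f \<omega>)\<^sup>2 + (f (translate x \<omega>))\<^sup>2) \<partial>count_space (pts \<omega>))" for \<omega>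
  have "(\<lambda>\<omega>. \<integral>\<^sup>+ u. ennreal (decay \<epsilon> (fst u)) * (1 + (f \<omega>)\<^sup>2 + (f (translate (fst u) \<omega>))\<^sup>2) \<partial>count_space \<omega>) \<in> borel_measurable (palm P)"
    by (intro measurable_palmI measurable_sum_translate[OF f]) (use measurable_decay in measurable)
  moreover have "(\<integral>\<^sup>+ u. ennreal (decay \<epsilon> (fst u)) * (1 + (f \<omega>)\<^sup>2 + (f (translate (fst u) \<omega>))\<^sup>2) \<partial>count_space \<omega>) = G \<omega>"
    if "\<omega> \<in> space (palm P)" for \<omega>
    using that by (simp add: G_def nn_integral_pts Omega0_def)
  ultimately have Gm: "G \<in> borel_measurable (palm P)" by (simp cong: measurable_cong del: space_palm)
  have "energy P \<beta> a g \<le> 1 * (\<integral>\<^sup>+ \<omega>. (\<integral>\<^sup>+ x. ennreal (energy_density \<beta> a g \<omega> x) \<partial>count_space (pts \<omega>)) \<partial>palm P)"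
    unfolding energy_alt by (intro mult_right_mono) (simp_all add: divide_le_posI_ennreal)
  also have "\<dots> \<le> (\<integral>\<^sup>+ \<omega>. c * G \<omega> \<partial>palm P)"
    unfolding G_def mult_1
    by (intro nn_integral_mono, subst nn_integral_cmult[symmetric]) (auto intro!: nn_integral_mono le)
  also have "\<dots> = c * (\<integral>\<^sup>+ \<omega>. G \<omega> \<partial>palm P)"
    by (rule nn_integral_cmult[OF Gm])
  also have "\<dots> \<le> c * (ennreal (\<Sum>n. decay_weight \<epsilon> n * (2 * real n + 1) ^ CARD('n))
        * (6 * count_moment P (q + 1) + 2 * campbell_moment P f (2 * p)) / intensity P)"
    unfolding G_def by (intro mult_left_mono palm_decay_bound[OF st f \<epsilon> pq]) simp
  finally show ?thesis .
qed

text \<open>The square integrability behind the existence of the diffusion matrix. Zero height and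
  decay rate 1 leave only the count moment.\<close>

lemma energy_zero_finite:
  fixes P :: "('n::finite) config measure"
  assumes st: "stationary_law P" and pq: "p > 1" "q > 1" "1 / p + 1 / q = 1"
    and fin: "count_moment P (q + 1) < \<infinity>" and pos: "intensity P > 0" and \<beta>: "\<beta> \<ge> 0"
  shows "energy P \<beta> a (\<lambda>_. 0) < \<infinity>"
proof -
  have "energy P \<beta> a (\<lambda>_. 0) \<le> ennreal ((norm a)\<^sup>2) * (ennreal (\<Sum>n. decay_weight 1 n * (2 * real n + 1) ^ CARD('n))
        * (6 * count_moment P (q + 1) + 2 * campbell_moment P (\<lambda>_. 0) (2 * p)) / intensity P)"
  proof (rule energy_le_of_density_le[OF st _ _ pq])
    fix \<omega> :: "'n config" and x :: "real ^ 'n"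
    have "cond \<omega> \<beta> 0 x * (a \<bullet> x)\<^sup>2 \<le> exp (- norm x) * ((norm a)\<^sup>2 * (norm x)\<^sup>2)"
    proof (intro mult_mono)
      show "cond \<omega> \<beta> 0 x \<le> exp (- norm x)" using \<beta> by (simp add: cond_def)
      show "(a \<bullet> x)\<^sup>2 \<le> (norm a)\<^sup>2 * (norm x)\<^sup>2"
        using Cauchy_Schwarz_ineq2[of a x] by (simp add: abs_le_square_iff[symmetric] flip: power_mult_distrib)
    qed auto
    also have "\<dots> \<le> (norm a)\<^sup>2 * decay 1 x" by (simp add: decay_def algebra_simps)
    finally show "ennreal (energy_density \<beta> a (\<lambda>_. 0) \<omega> x)
      \<le> ennreal ((norm a)\<^sup>2) * (ennreal (decay 1 x) * (1 + 0\<^sup>2 + 0\<^sup>2))"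
      using decay_pos[of 1 x] by (simp add: energy_density_def flip: ennreal_mult)
  qed auto
  also have "campbell_moment P (\<lambda>_. 0) (2 * p) = 0"
    by (simp add: campbell_moment_def campbell_def)
  finally show ?thesis
    by (rule le_less_trans) (use fin pos in \<open>auto simp: less_top[symmetric] ennreal_mult_eq_top_iff ennreal_divide_eq_top_iff\<close>)
qed

section \<open>The upper bound\<close>

lemma palm_cluster_height_le:
  fixes R :: "('n::finite) config measure" and v :: "real ^ 'n"
  assumes v: "norm v = 1" and r: "r \<ge> 0"
    and Y: "(\<integral>\<^sup>+ \<omega>. ennpowr (sup_diam (cluster0 \<omega>)) r \<partial>palm R) \<le> ennreal Y"
  shows "(\<integral>\<^sup>+ \<omega>. ennpowr (cluster_height v \<omega>) r \<partial>palm R) \<le> ennreal (real CARD('n) powr r) * ennreal Y"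
proof -
  define d where "d = real CARD('n)"
  have d: "d > 0" by (simp add: d_def)
  have m: "(\<lambda>\<omega>. ennpowr (cluster_height v \<omega>) r) \<in> borel_measurable (palm R)"
    by (intro measurable_palmI measurable_ennpowr measurable_cluster_height)
  \<comment> \<open>The dimension factor is attached to the height, whose measurability allows
    pulling it out of the integral; the diameter enters only through monotonicity.\<close>
  have "ennreal ((1 / d) powr r) * (\<integral>\<^sup>+ \<omega>. ennpowr (cluster_height v \<omega>) r \<partial>palm R)
      = (\<integral>\<^sup>+ \<omega>. ennpowr (ennreal (1 / d) * cluster_height v \<omega>) r \<partial>palm R)"
    using d m by (simp add: ennpowr_cmult nn_integral_cmult del: ennreal_1)
  also have "\<dots> \<le> (\<integral>\<^sup>+ \<omega>. ennpowr (sup_diam (cluster0 \<omega>)) r \<partial>palm R)"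
  proof (intro nn_integral_mono ennpowr_mono r)
    fix \<omega> :: "'n config"
    have "ennreal (1 / d) * cluster_height v \<omega> \<le> ennreal (1 / d) * (ennreal d * sup_diam (cluster0 \<omega>))"
      using cluster_height_le_sup_diam[OF v, of \<omega>]
      by (intro mult_left_mono) (simp_all add: d_def ennreal_of_nat_eq_real_of_nat)
    also have "\<dots> = sup_diam (cluster0 \<omega>)"
      using d by (simp add: mult.assoc[symmetric] ennreal_mult[symmetric])
    finally show "ennreal (1 / d) * cluster_height v \<omega> \<le> sup_diam (cluster0 \<omega>)" .
  qed
  also note Y
  finally have "ennreal (d powr r) * (ennreal ((1 / d) powr r) * (\<integral>\<^sup>+ \<omega>. ennpowr (cluster_height v \<omega>) r \<partial>palm R))
      \<le> ennreal (d powr r) * ennreal Y" by (rule mult_left_mono) simp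
  moreover have "ennreal (d powr r) * ennreal ((1 / d) powr r) = 1"
    using d by (simp add: powr_divide flip: ennreal_mult)
  ultimately show ?thesis by (simp add: mult.assoc[symmetric] d_def)
qed

text \<open>\<open>A\<close> is chosen before \<zeta>, \<beta> and \<open>Y\<close>, so \<zeta> can
  be tied to \<beta> later with all growth visible in the last bracket. Its factors stem from the
  length scale of the height, the intensity of the rescaled law and the cluster moment.\<close>

lemma diffusion_matrix_bound:
  fixes P :: "('n::finite) config measure" and v :: "real ^ 'n"
  assumes st: "stationary_law P" and pq: "p > 1" "q > 1" "1 / p + 1 / q = 1"
    and \<rho>: "\<rho> > 0" "intensity P = ennreal \<rho>" and fin: "count_moment P (q + 1) < \<infinity>"
    and \<epsilon>: "0 < \<epsilon>" "\<epsilon> < 1" and v: "norm v = 1"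
  shows "\<exists>A>0. \<forall>\<zeta>\<ge>1. \<forall>\<beta>>0. \<forall>Y\<ge>1.
    (\<integral>\<^sup>+ \<omega>. ennpowr (sup_diam (cluster0 \<omega>)) (2 * p) \<partial>palm (rescaled_law \<zeta> \<beta> P)) \<le> ennreal Y \<longrightarrow>
    v \<bullet> (diffusion_matrix P \<beta> *v v) \<le> A * exp (- ((1 - \<epsilon>) * \<zeta>)) * (\<zeta> powr (2 * p) * (2 * \<zeta> + 3) ^ CARD('n) * Y)"
proof -
  define S where "S = (\<Sum>n. decay_weight \<epsilon> n * (2 * real n + 1) ^ CARD('n))"
  define d where "d = real CARD('n) powr (2 * p)"
  obtain m where m: "count_moment P (q + 1) = ennreal m" "0 \<le> m"
    using fin by (cases "count_moment P (q + 1)") auto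
  have S: "0 \<le> S"
    unfolding S_def by (intro suminf_nonneg summable_decay_weight \<epsilon>) (simp add: decay_weight_def)
  have d: "0 \<le> d" by (simp add: d_def)
  define A where "A = 4 * (S * (6 * m + 2 * (\<rho> * d)) / \<rho>) + 1"
  have A: "A > 0" using S m d \<rho> by (simp add: A_def add_nonneg_pos)
  show ?thesis
  proof (intro exI[of _ A] conjI A allI impI)
    fix \<zeta> \<beta> Y :: real
    assume \<zeta>: "1 \<le> \<zeta>" and \<beta>: "0 < \<beta>" and Y1: "1 \<le> Y"
      and Y: "(\<integral>\<^sup>+ \<omega>. ennpowr (sup_diam (cluster0 \<omega>)) (2 * p) \<partial>palm (rescaled_law \<zeta> \<beta> P)) \<le> ennreal Y"
    have \<zeta>0: "\<zeta> > 0" using \<zeta> by simp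
    let ?R = "rescaled_law \<zeta> \<beta> P"
    let ?f = "rescaled_height \<zeta> \<beta> v"
    define W where "W = \<zeta> powr (2 * p) * (2 * \<zeta> + 3) ^ CARD('n) * Y"
    have "1 \<le> \<zeta> powr (2 * p)" "1 \<le> (2 * \<zeta> + 3) ^ CARD('n)"
      using \<zeta> pq by (auto intro: ge_one_powr_ge_zero)
    \<comment> \<open>Since \<open>W\<close> is at least 1, the count moment, which carries no such
      factor, can be absorbed into the same product.\<close>
    then have W: "1 \<le> W"
      unfolding W_def using Y1 mult_mono[of 1 "\<zeta> powr (2 * p)" 1 "(2 * \<zeta> + 3) ^ CARD('n)"]
        mult_mono[of 1 "\<zeta> powr (2 * p) * (2 * \<zeta> + 3) ^ CARD('n)" 1 Y] by simp
    define n where "n = nat \<lceil>\<zeta>\<rceil>"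
    have n: "\<zeta> \<le> real n" "real n \<le> \<zeta> + 1" using \<zeta> unfolding n_def by linarith+
    have "real ((2 * n + 1) ^ CARD('n)) \<le> (2 * \<zeta> + 3) ^ CARD('n)"
      using n unfolding of_nat_power by (intro power_mono) auto
    then have "of_nat ((2 * n + 1) ^ CARD('n)) \<le> ennreal ((2 * \<zeta> + 3) ^ CARD('n))"
      unfolding ennreal_of_nat_eq_real_of_nat by (rule ennreal_leI)
    then have I: "intensity ?R \<le> ennreal ((2 * \<zeta> + 3) ^ CARD('n)) * ennreal \<rho>"
      using order_trans[OF intensity_rescaled_le[OF st \<zeta>0 \<beta> n(1)] mult_right_mono] \<rho>(2) by simp
    have "campbell_moment P ?f (2 * p)
      \<le> ennreal (\<zeta> powr (2 * p)) * (intensity ?R * (\<integral>\<^sup>+ \<omega>. ennpowr (cluster_height v \<omega>) (2 * p) \<partial>palm ?R))"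
      unfolding rescaled_height_def[abs_def]
      by (rule campbell_moment_rescale_le[OF st \<zeta> \<beta> measurable_cluster_height cluster_height_isolated])
         (simp_all add: \<rho>)
    also have "\<dots> \<le> ennreal (\<zeta> powr (2 * p)) * (ennreal ((2 * \<zeta> + 3) ^ CARD('n)) * ennreal \<rho> * (ennreal d * ennreal Y))"
      unfolding d_def using pq by (intro mult_left_mono mult_mono I palm_cluster_height_le[OF v _ Y]) auto
    also have "\<dots> = ennreal (W * (\<rho> * d))"
      using \<zeta> \<rho> d Y1 by (simp add: W_def ennreal_mult[symmetric] mult_ac)
    finally have u: "campbell_moment P ?f (2 * p) \<le> ennreal (W * (\<rho> * d))" .
    have "energy P \<beta> v (test_function \<zeta> \<beta> v) \<le> ennreal (4 * exp (- ((1 - \<epsilon>) * \<zeta>))) *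
        (ennreal S * (6 * count_moment P (q + 1) + 2 * campbell_moment P ?f (2 * p)) / intensity P)"
      unfolding S_def
      by (rule energy_le_of_density_le[OF st measurable_rescaled_height[OF \<zeta>0 \<beta>] \<epsilon>(1) pq])
         (rule energy_density_test_function_le[OF \<zeta>0 \<beta> \<epsilon> v])
    also have "\<dots> \<le> ennreal (4 * exp (- ((1 - \<epsilon>) * \<zeta>))) *
        (ennreal S * (ennreal 6 * ennreal m + ennreal 2 * ennreal (W * (\<rho> * d))) / ennreal \<rho>)"
      unfolding \<rho>(2) m(1) using u
      by (intro mult_left_mono divide_right_mono_ennreal add_mono) (auto intro: mult_left_mono)
    also have "\<dots> = ennreal (4 * exp (- ((1 - \<epsilon>) * \<zeta>)) * (S * (6 * m + 2 * (W * (\<rho> * d))) / \<rho>))"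
      using S m d \<rho> W
      by (simp add: ennreal_mult[symmetric] ennreal_plus[symmetric] divide_ennreal del: ennreal_plus ennreal_numeral)
    also have "\<dots> \<le> ennreal (A * exp (- ((1 - \<epsilon>) * \<zeta>)) * W)"
    proof (rule ennreal_leI)
      have "6 * m + 2 * (W * (\<rho> * d)) \<le> (6 * m + 2 * (\<rho> * d)) * W"
        using W m mult_left_mono[OF W, of "6 * m"] by (simp add: algebra_simps)
      then have "S * (6 * m + 2 * (W * (\<rho> * d))) / \<rho> \<le> S * ((6 * m + 2 * (\<rho> * d)) * W) / \<rho>"
        using S \<rho> by (intro divide_right_mono mult_left_mono) auto
      then have "4 * (S * (6 * m + 2 * (W * (\<rho> * d))) / \<rho>) \<le> A * W"
        using W unfolding A_def by (simp add: distrib_right mult.assoc)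
      moreover have gen: "4 * e * T \<le> A * e * W" if "4 * T \<le> A * W" "0 \<le> e" for e T
        using mult_left_mono[OF that] by (simp add: mult_ac)
      ultimately show "4 * exp (- ((1 - \<epsilon>) * \<zeta>)) * (S * (6 * m + 2 * (W * (\<rho> * d))) / \<rho>) \<le> A * exp (- ((1 - \<epsilon>) * \<zeta>)) * W"
        by (intro gen) auto
    qed
    finally have E: "energy P \<beta> v (test_function \<zeta> \<beta> v) \<le> ennreal (A * exp (- ((1 - \<epsilon>) * \<zeta>)) * W)" .
    have "is_diffusion_matrix P \<beta> (diffusion_matrix P \<beta>)"
      using \<beta> \<rho> by (intro is_diffusion_matrix_diffusion_matrix energy_zero_finite[OF st pq fin]) auto
    then have "ennreal (v \<bullet> (diffusion_matrix P \<beta> *v v)) = (INF f \<in> Linfty (palm P). energy P \<beta> v f)"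
      by (simp add: is_diffusion_matrix_def)
    also have "\<dots> \<le> energy P \<beta> v (test_function \<zeta> \<beta> v)"
      by (rule INF_lower[OF test_function_Linfty[OF \<zeta>0 \<beta>]])
    also note E
    finally show "v \<bullet> (diffusion_matrix P \<beta> *v v)
        \<le> A * exp (- ((1 - \<epsilon>) * \<zeta>)) * (\<zeta> powr (2 * p) * (2 * \<zeta> + 3) ^ CARD('n) * Y)"
      using A W by (subst (asm) ennreal_le_iff) (simp_all add: W_def)
  qed
qed

section \<open>Asymptotics on the logarithmic scale\<close>

lemma eventually_poly_le_exp:
  fixes A c r :: real
  assumes "c > 0"
  shows "\<forall>\<^sub>F z in at_top. A * (z powr r * (2 * z + 3) ^ d) \<le> exp (c * z)"
proof -
  have "((\<lambda>z. A * (z powr r * (2 * z + 3) powr real d) * exp (- c * z)) \<longlongrightarrow> 0) at_top"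
    using assms by real_asymp
  then have "\<forall>\<^sub>F z in at_top. A * (z powr r * (2 * z + 3) powr real d) * exp (- c * z) < 1"
    by (rule order_tendstoD) simp
  then show ?thesis
    using eventually_gt_at_top[of 0]
  proof eventually_elim
    case (elim z)
    then show ?case by (simp add: powr_realpow exp_minus field_simps)
  qed
qed

lemma ennln_le:
  assumes "t \<le> exp s"
  shows "ennln (ennreal t) \<le> ereal s"
proof (cases "t \<le> 0")
  case True
  then show ?thesis by (simp add: ennln_def ennreal_neg)
next
  case False
  then have "ln t \<le> s" using assms ln_le_cancel_iff[of t "exp s"] by simp
  then show ?thesis using False by (simp add: ennln_def)
qed

lemma le_ennreal_exp_of_ennln:
  assumes "b > 0" and less: "ereal b * ennln x < ereal c"
  shows "x \<le> ennreal (exp (c / b))"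
proof (cases x)
  case top
  then show ?thesis using assms by (simp add: ennln_def)
next
  case (real t)
  show ?thesis
  proof (cases "t = 0")
    case False
    then have "b * ln t < c" using real less by (simp add: ennln_def)
    then have "ln t \<le> c / b" using assms(1) by (simp add: field_simps)
    then have "t \<le> exp (c / b)" using False real by (metis exp_le_cancel_iff exp_ln less_eq_real_def)
    then show ?thesis using real by (simp add: ennreal_leI)
  qed (simp add: real)
qed

theorem theorem8p4:
  fixes P :: "('n::finite) config measure"
    and \<alpha> lam C \<rho> p q :: real
    and ell :: "real \<Rightarrow> real"
    and v :: "real ^ 'n"
  assumes "\<alpha> \<ge> 0" and "lam > 0" and "C > 0"
    and "stationary_law P"
    and "\<rho> > 0" and "intensity P = ennreal \<rho>"
    and "AE \<omega> in P. \<forall>x x'. x \<noteq> x' \<longrightarrow> translate x \<omega> \<noteq> translate x' \<omega>"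
    and "\<forall>s > 0. emeasure (palm P) {\<omega> \<in> Omega0. mark \<omega> 0 \<in> {-s<..<s}} > 0"
    and "ell = (\<lambda>\<beta>. (lam * C powr (\<alpha> + 1) / \<rho>) powr (1 / (\<alpha> + 1 + real CARD('n)))
                 * \<beta> powr ((\<alpha> + 1) / (\<alpha> + 1 + real CARD('n))))"
    and "p > 1" and "q > 1" and "1 / p + 1 / q = 1"
    and "(\<integral>\<^sup>+ \<omega>. ennreal (real (card (pts \<omega> \<inter> unit_cube)) powr (q + 1)) \<partial>P) < \<infinity>"
    and "Limsup at_top (\<lambda>\<beta>. \<integral>\<^sup>+ \<omega>. ennpowr (sup_diam (cluster0 \<omega>)) (2 * p)
             \<partial>palm (rescaled_law (ell \<beta>) \<beta> P)) < \<infinity>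
       \<or> Limsup at_top (\<lambda>\<beta>. ereal (\<beta> powr (- ((\<alpha> + 1) / (\<alpha> + 1 + real CARD('n)))))
           * ennln (\<integral>\<^sup>+ \<omega>. ennpowr (sup_diam (cluster0 \<omega>)) (2 * p)
               \<partial>palm (rescaled_law (ell \<beta>) \<beta> P))) \<le> 0"
    and "norm v = 1"
  shows "Limsup at_top (\<lambda>\<beta>. ereal (\<beta> powr (- ((\<alpha> + 1) / (\<alpha> + 1 + real CARD('n)))))
           * ennln (ennreal (v \<bullet> (diffusion_matrix P \<beta> *v v))))
         \<le> ereal (- ((lam * C powr (\<alpha> + 1) / \<rho>) powr (1 / (\<alpha> + 1 + real CARD('n)))))"
proof -
  define \<gamma> where "\<gamma> = (\<alpha> + 1) / (\<alpha> + 1 + real CARD('n))"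
  define K where "K = (lam * C powr (\<alpha> + 1) / \<rho>) powr (1 / (\<alpha> + 1 + real CARD('n)))"
  have \<gamma>: "\<gamma> > 0" using \<open>\<alpha> \<ge> 0\<close> by (simp add: \<gamma>_def add_pos_nonneg)
  have K: "K > 0" using assms(2,3,5) by (simp add: K_def)
  have ell: "ell \<beta> = K * \<beta> powr \<gamma>" for \<beta> by (simp add: assms(9) K_def \<gamma>_def)
  define X where "X \<beta> = (\<integral>\<^sup>+ \<omega>. ennpowr (sup_diam (cluster0 \<omega>)) (2 * p) \<partial>palm (rescaled_law (ell \<beta>) \<beta> P))" for \<beta>
  have hyp: "Limsup at_top X < \<infinity> \<or> Limsup at_top (\<lambda>\<beta>. ereal (\<beta> powr - \<gamma>) * ennln (X \<beta>)) \<le> 0"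
    using assms(14) by (simp only: X_def[abs_def] \<gamma>_def)
  have powr_top: "filterlim (\<lambda>\<beta>::real. \<beta> powr \<gamma>) at_top at_top"
    using \<gamma> by real_asymp
  have ell_top: "filterlim ell at_top at_top"
    unfolding ell using powr_top K by (rule filterlim_tendsto_pos_mult_at_top[OF tendsto_const, rotated])
  have fin: "count_moment P (q + 1) < \<infinity>"
  proof -
    have sets: "sets P = sets config_space" using assms(4) by (simp add: stationary_law_def)
    have "count_moment P (q + 1) = (\<integral>\<^sup>+ \<omega>. ennreal (real (card (pts \<omega> \<inter> unit_cube)) powr (q + 1)) \<partial>P)"
      unfolding count_moment_def using sets_eq_imp_space_eq[OF sets]
      by (intro nn_integral_cong) (simp add: campbell_1 card_pts ennreal_of_nat_eq_real_of_nat ennpowr_ennreal)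
    then show ?thesis using assms(13) by simp
  qed
  \<comment> \<open>Both alternatives of the hypothesis enter only through this consequence: the
    cluster moment grows slower than every exponential of
    \<open>\<beta> powr \<gamma>\<close>.\<close>
  have X_le: "\<forall>\<^sub>F \<beta> in at_top. X \<beta> \<le> ennreal (exp (\<delta> * \<beta> powr \<gamma>))" if \<delta>: "\<delta> > 0" for \<delta>
    using hyp
  proof
    assume "Limsup at_top X < \<infinity>"
    then obtain b where b: "Limsup at_top X < b" "b < \<infinity>" using dense by blast
    then obtain b' where b': "b = ennreal b'" "0 \<le> b'" by (cases b) auto
    have "filterlim (\<lambda>\<beta>::real. exp (\<delta> * \<beta> powr \<gamma>)) at_top at_top"
      by (rule filterlim_compose[OF exp_at_top filterlim_tendsto_pos_mult_at_top[OF tendsto_const \<delta> powr_top]])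
    then have "\<forall>\<^sub>F \<beta> in at_top. b' \<le> exp (\<delta> * \<beta> powr \<gamma>)"
      by (simp add: filterlim_at_top)
    then show ?thesis
      using Limsup_lessD[OF b(1)]
    proof eventually_elim
      case (elim \<beta>)
      then show ?case unfolding b' by (meson ennreal_leI less_imp_le order_trans)
    qed
  next
    assume "Limsup at_top (\<lambda>\<beta>. ereal (\<beta> powr - \<gamma>) * ennln (X \<beta>)) \<le> 0"
    then have "Limsup at_top (\<lambda>\<beta>. ereal (\<beta> powr - \<gamma>) * ennln (X \<beta>)) < ereal \<delta>"
      using \<delta> by (simp add: order_le_less_trans)
    from Limsup_lessD[OF this] show ?thesis
      using eventually_gt_at_top[of 0]
    proof eventually_elim
      case (elim \<beta>)
      then have "X \<beta> \<le> ennreal (exp (\<delta> / \<beta> powr - \<gamma>))"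
        by (intro le_ennreal_exp_of_ennln) auto
      then show ?case by (simp add: powr_minus divide_inverse)
    qed
  qed
  have "\<forall>\<^sub>F \<beta> in at_top. ereal (\<beta> powr - \<gamma>) * ennln (ennreal (v \<bullet> (diffusion_matrix P \<beta> *v v))) < y"
    if y: "ereal (- K) < y" for y
  proof -
    obtain z where z: "ereal (- K) < ereal z" "ereal z < y" using ereal_dense2[OF y] by blast
    \<comment> \<open>The gap between \<open>z\<close> and \<open>- K\<close> pays for three losses,
      one share each: the polynomial factors, the cluster moment, and the part \<epsilon> of the
      decay given up in \<open>diffusion_matrix_bound\<close>.\<close>
    define \<eta> where "\<eta> = (z + K) / 3"
    have \<eta>: "\<eta> > 0" using z(1) by (simp add: \<eta>_def)
    \<comment> \<open>\<open>\<eta> / K\<close> limits the loss \<open>\<epsilon> * K\<close> to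
      \<eta>; 1/2 keeps \<epsilon> below 1.\<close>
    define \<epsilon> where "\<epsilon> = min (1 / 2) (\<eta> / K)"
    have \<epsilon>: "0 < \<epsilon>" "\<epsilon> < 1" and \<epsilon>K: "\<epsilon> * K \<le> \<eta>"
      using \<eta> K by (auto simp: \<epsilon>_def min_def field_simps)
    from diffusion_matrix_bound[OF assms(4,10,11,12,5,6) fin \<epsilon> assms(15)] obtain A where A: "A > 0"
      and bound: "\<And>\<zeta> \<beta> Y. 1 \<le> \<zeta> \<Longrightarrow> 0 < \<beta> \<Longrightarrow> 1 \<le> Y \<Longrightarrow>
        (\<integral>\<^sup>+ \<omega>. ennpowr (sup_diam (cluster0 \<omega>)) (2 * p) \<partial>palm (rescaled_law \<zeta> \<beta> P)) \<le> ennreal Y \<Longrightarrow>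
        v \<bullet> (diffusion_matrix P \<beta> *v v) \<le> A * exp (- ((1 - \<epsilon>) * \<zeta>)) * (\<zeta> powr (2 * p) * (2 * \<zeta> + 3) ^ CARD('n) * Y)"
      by blast
    have c: "\<eta> / K > 0" using \<eta> K by simp
    have e1: "\<forall>\<^sub>F \<beta> in at_top. A * (ell \<beta> powr (2 * p) * (2 * ell \<beta> + 3) ^ CARD('n)) \<le> exp (\<eta> / K * ell \<beta>)"
      by (rule eventually_compose_filterlim[OF eventually_poly_le_exp[OF c] ell_top])
    have e2: "\<forall>\<^sub>F \<beta> in at_top. 1 \<le> ell \<beta>" using ell_top by (simp add: filterlim_at_top)
    show ?thesis
      using e1 e2 X_le[OF \<eta>] eventually_gt_at_top[of 0]
    proof eventually_elim
      case (elim \<beta>)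
      define g where "g = \<beta> powr \<gamma>"
      have g: "g > 0" using elim by (simp add: g_def)
      have l: "ell \<beta> = K * g" by (simp add: ell g_def)
      have "v \<bullet> (diffusion_matrix P \<beta> *v v) \<le> A * exp (- ((1 - \<epsilon>) * ell \<beta>)) * (ell \<beta> powr (2 * p) * (2 * ell \<beta> + 3) ^ CARD('n) * exp (\<eta> * g))"
        using elim \<eta> g by (intro bound) (auto simp: X_def g_def)
      also have "\<dots> = (A * (ell \<beta> powr (2 * p) * (2 * ell \<beta> + 3) ^ CARD('n))) * exp (- ((1 - \<epsilon>) * ell \<beta>)) * exp (\<eta> * g)"
        by (simp only: mult_ac)
      also have "\<dots> \<le> exp (\<eta> / K * ell \<beta>) * exp (- ((1 - \<epsilon>) * ell \<beta>)) * exp (\<eta> * g)"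
        using elim by (intro mult_right_mono) auto
      also have "\<dots> = exp (g * (2 * \<eta> - K + \<epsilon> * K))"
        using K by (simp add: l exp_add[symmetric] algebra_simps)
      also have "\<dots> \<le> exp (g * z)"
      proof -
        have "3 * \<eta> = z + K" by (simp add: \<eta>_def)
        then have "2 * \<eta> - K + \<epsilon> * K \<le> z" using \<epsilon>K by linarith
        then show ?thesis using g by simp
      qed
      finally have "ennln (ennreal (v \<bullet> (diffusion_matrix P \<beta> *v v))) \<le> ereal (g * z)"
        by (rule ennln_le)
      then have "ereal (\<beta> powr - \<gamma>) * ennln (ennreal (v \<bullet> (diffusion_matrix P \<beta> *v v))) \<le> ereal (\<beta> powr - \<gamma>) * ereal (g * z)"
        by (rule ereal_mult_left_mono) simp
      also have "\<dots> = ereal z"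
        using g by (simp add: powr_minus g_def[symmetric])
      finally show ?case using z(2) by (rule le_less_trans)
    qed
  qed
  then show ?thesis
    unfolding Limsup_le_iff \<gamma>_def[symmetric] K_def[symmetric] by blast
qed

end
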